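(* Let the exponents $\theta_j^\pm$ be admissible and such that $\max_{1\le\mu\le M-1}r(\rho_\mu^-)<\min_{1\le\nu\le N-1}r(\rho_\nu^+)$, and let $\gamma>0$ lie strictly between these two numbers. Let $\Gamma_\nu^+(t)=h^{-1}(h_t(\rho_\nu^+(t))-\gamma t)$ and $\Gamma_\mu^-(t)=h^{-1}(h_t(\rho_\mu^-(t))-\gamma t)$ be the orbits of the tip points. For each $\nu=1,\dots,N-1$, the curve $\Gamma_\nu^+(t)$ converges, as $t\to+\infty$, to $\mathbb{R}$ by angle $$\pi\,\frac{\sum_{j=1}^{\mu_\nu}b_j^--\sum_{j=\nu+1}^Nb_j^+}{b_{\mu_\nu}^-}\in(0,\pi).$$ For each $\mu=1,\dots,M$, the curve $\Gamma_\mu^-(t)$ converges, as $t\to+\infty$, to $\mathbb{R}$ by angle (1) $\displaystyle \pi\,\frac{\sum_{j=1}^\mu b_j^--\sum_{j=2}^Nb_j^+}{b_1^+}\in(0,\pi)$, if $\mu\in\{\mu_1,\dots,M\}$; (2) $\displaystyle \pi\,\frac{\sum_{j=1}^\mu b_j^--\sum_{j=\nu_\omega+1}^Nb_j^+}{b_{\nu_\omega}^+}\in(0,\pi)$, if $\mu\in\{\mu_{N-1},\dots,\mu_1-1\}$ and $h(\rho_\mu^-(0))\in S_{\nu_\omega}^+$; (3) $\displaystyle \pi\,\frac{\sum_{j=1}^\mu b_j^-}{b_N^+}\in(0,\pi)$, if $\mu\in\{1,\dots,\mu_{N-1}-1\}$.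
   Context: $\mathbb{H}$ is the upper half-plane, $\log$ is the principal branch, $'$ denotes $\partial_z$. Parameters. $N\ge2$, $M\ge1$ are integers; $k_1^+<\dots<k_N^+<k_1^-<\dots<k_M^-$ are real; $b_1^+,\dots,b_N^+,b_1^-,\dots,b_M^->0$; $b^+=\sum_{j=1}^Nb_j^+$, $b^-=\sum_{j=1}^Mb_j^-$. Assume $b^+>b^-$, $\sum_{j=2}^Nb_j^+<b^-$, and $\sum_{j=\nu+1}^Nb_j^+\ne\sum_{j=1}^{\mu}b_j^-$ for all $1\le\nu\le N-1$, $1\le\mu\le M$. Time dependence. For positive exponents $\theta_2^+,\dots,\theta_{N-1}^+$, $\theta_1^-,\dots,\theta_M^-$ put, for $t\ge0$, $k_1^+(t)=k_1^+$, $k_N^+(t)=k_N^+$, $k_j^+(t)=k_N^++(k_j^+-k_N^+)e^{-\theta_j^+t}$ ($2\le j\le N-1$), $k_j^-(t)=k_N^++(k_j^--k_N^+)e^{-\theta_j^-t}$ ($1\le j\le M$), and $$h_t(z)=\sum_{j=1}^Nb_j^+\log(z-k_j^+(t))-\sum_{j=1}^Mb_j^-\log(z-k_j^-(t)),$$ $h=h_0$; $h_t$ is extended to real points other than the $k_j^\pm(t)$ by continuity from $\mathbb{H}$. $h_t$ is univalent on $\mathbb{H}$. The zeros of $h_t'$ are simple and real: $\rho_\nu^+(t)\in(k_\nu^+(t),k_{\nu+1}^+(t))$ ($1\le\nu\le N-1$), $\rho_\mu^-(t)\in(k_\mu^-(t),k_{\mu+1}^-(t))$ ($1\le\mu\le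 M-1$), $\rho_M^-(t)>k_M^-(t)$. The rates are $r(\rho_j^\pm)=\lim_{t\to+\infty}\frac1t\mathrm{Re}\,h_t(\rho_j^\pm(t))$. (If $M=1$, a maximum over the empty set is $-\infty$.) Heights and strips. $y_\nu^+=\mathrm{Im}\,h_t(\rho_\nu^+(t))=\pi(\sum_{j=\nu+1}^Nb_j^+-b^-)$ and $y_\mu^-=\mathrm{Im}\,h_t(\rho_\mu^-(t))=-\pi\sum_{j=\mu+1}^Mb_j^-$ do not depend on $t$. Put $S_1^+=\{y_1^+<\mathrm{Im}\,w<\pi(b^+-b^-)\}$, $S_\nu^+=\{y_\nu^+<\mathrm{Im}\,w<y_{\nu-1}^+\}$ ($2\le\nu\le N-1$), $S_N^+=\{-\pi b^-<\mathrm{Im}\,w<y_{N-1}^+\}$, $S_1^-=\{-\pi b^-<\mathrm{Im}\,w<y_1^-\}$, $S_\mu^-=\{y_{\mu-1}^-<\mathrm{Im}\,w<y_\mu^-\}$ ($2\le\mu\le M$). For $1\le\nu\le N-1$, $\mu_\nu\in\{1,\dots,M\}$ is the index with $\sum_{j=1}^{\mu_\nu-1}b_j^-<\sum_{j=\nu+1}^Nb_j^+<\sum_{j=1}^{\mu_\nu}b_j^-$; thus $M\ge\mu_1\ge\dots\ge\mu_{N-1}\ge1$. Let $1=\nu_1<\dots<\nu_\lambda\le N-1$ be defined by $\nu_{\omega+1}=\min\{\nu>\nu_\omega:\mu_\nu<\mu_{\nu_\omega}\}$ as long as this set is nonempty (the indices where the value of $\mu_\nu$ changes). Admissible exponents: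 (E0) $\theta_2^+\le\dots\le\theta_{N-1}^+$ and $\theta_1^-\ge\dots\ge\theta_M^-$. (E1) For $2\le\nu\le N-1$, $1\le\mu\le M$: if one of $S_\nu^+$, $S_\mu^-$ is contained in the other, then $\theta_\nu^+=\theta_\mu^-$; otherwise the exponent of the strip lying higher is strictly smaller. (E2) The $\theta_\mu^-$ with $S_\mu^-\subset S_1^+$ (i.e. $\mu>\mu_1$) are all equal and strictly smaller than $\theta_{\mu_1}^-$; the $\theta_\mu^-$ with $S_\mu^-\subset S_N^+$ (i.e. $\mu<\mu_{N-1}$) are all equal and strictly larger than $\theta_{\mu_{N-1}}^-$. For $\gamma$ as in the claim, $h_t(\rho_j^\pm(t))-\gamma t\in h(\mathbb{H})$ for $t>0$, and $h^{-1}$ is the inverse of $h:\mathbb{H}\to h(\mathbb{H})$ (with $\Gamma_j^\pm(0)=\rho_j^\pm(0)$). A curve $\eta:[0,+\infty)\to\overline{\mathbb{H}}$ with $\eta(t)\in\mathbb{H}$ for $t>0$ converges to $\mathbb{R}$ by angle $\theta\in[0,\pi]$ if $\eta(t)\to x$ for some $x\in\mathbb{R}$ and $\lim_{t\to+\infty}\arg(\eta(t)-x)=\theta$; equivalently, $\lim_{t\to+\infty}\omega(\eta(t),[x,+\infty),\mathbb{H})=(\pi-\theta)/\pi$, where $\omega$ is harmonic measure. *)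

theory Defs
  imports "HOL-Analysis.Analysis"
begin

text \<open>The data: all families are indexed from 1, and values outside the index ranges
  \<open>1..Np\<close>, \<open>1..Nm\<close> (for \<open>thetap\<close>: \<open>2..Np-1\<close>) are never used.
  \<open>kp0\<close>, \<open>km0\<close> are the singularities at time 0.\<close>

record slit_data =
  Np :: nat
  Nm :: nat
  kp0 :: "nat \<Rightarrow> real"
  km0 :: "nat \<Rightarrow> real"
  bp :: "nat \<Rightarrow> real"
  bm :: "nat \<Rightarrow> real"
  thetap :: "nat \<Rightarrow> real"
  thetam :: "nat \<Rightarrow> real"

abbreviation upper_half_plane :: "complex set" where
  "upper_half_plane \<equiv> {z. 0 < Im z}"

definition bp_total :: "slit_data \<Rightarrow> real" where
  "bp_total P = (\<Sum>j=1..Np P. bp P j)"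

definition bm_total :: "slit_data \<Rightarrow> real" where
  "bm_total P = (\<Sum>j=1..Nm P. bm P j)"

definition standing :: "slit_data \<Rightarrow> bool" where
  "standing P \<longleftrightarrow>
     2 \<le> Np P \<and> 1 \<le> Nm P \<and>
     strict_mono_on {1..Np P} (kp0 P) \<and> kp0 P (Np P) < km0 P 1 \<and>
     strict_mono_on {1..Nm P} (km0 P) \<and>
     (\<forall>j\<in>{1..Np P}. 0 < bp P j) \<and> (\<forall>j\<in>{1..Nm P}. 0 < bm P j) \<and>
     bm_total P < bp_total P \<and>
     (\<Sum>j=2..Np P. bp P j) < bm_total P \<and>
     (\<forall>\<nu>\<in>{1..Np P - 1}. \<forall>\<mu>\<in>{1..Nm P}.
        (\<Sum>j=\<nu>+1..Np P. bp P j) \<noteq> (\<Sum>j=1..\<mu>. bm P j))"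


definition kp :: "slit_data \<Rightarrow> real \<Rightarrow> nat \<Rightarrow> real" where
  "kp P t j = (if j = 1 \<or> j = Np P then kp0 P j
     else kp0 P (Np P) + (kp0 P j - kp0 P (Np P)) * exp (- thetap P j * t))"

definition km :: "slit_data \<Rightarrow> real \<Rightarrow> nat \<Rightarrow> real" where
  "km P t j = kp0 P (Np P) + (km0 P j - kp0 P (Np P)) * exp (- thetam P j * t)"

text \<open>On the negative real axis \<open>Ln\<close> has imaginary part \<open>\<pi>\<close>, which is its limit from the upper
  half-plane. Hence the formula below also gives the continuous extension of \<open>h\<^sub>t\<close> from the upper
  half-plane to the real points other than the singularities
  (see \<open>h_has_field_derivative\<close> and \<open>h_continuous\<close>).\<close>

definition h :: "slit_data \<Rightarrow> real \<Rightarrow> complex \<Rightarrow> complex" where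
  "h P t z = (\<Sum>j=1..Np P. of_real (bp P j) * Ln (z - of_real (kp P t j)))
           - (\<Sum>j=1..Nm P. of_real (bm P j) * Ln (z - of_real (km P t j)))"

text \<open>The derivative of \<open>h\<^sub>t\<close> as a rational function. (The library's \<open>deriv (h P t)\<close> would be wrong
  at real points, where the two-sided derivative of the principal branch need not exist.)\<close>

definition h' :: "slit_data \<Rightarrow> real \<Rightarrow> complex \<Rightarrow> complex" where
  "h' P t z = (\<Sum>j=1..Np P. of_real (bp P j) / (z - of_real (kp P t j)))
            - (\<Sum>j=1..Nm P. of_real (bm P j) / (z - of_real (km P t j)))"

lemma Ln_has_field_derivative_closed_half_plane:
  assumes "z \<noteq> 0" "0 \<le> Im z"
  shows "(Ln has_field_derivative 1 / z) (at z within {z. 0 \<le> Im z})"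
proof -
  have eq: "Ln w = Ln (- \<i> * w) + \<i> * of_real (pi / 2)" if "w \<noteq> 0" "0 \<le> Im w" for w
    using Ln_times_ii[of "- \<i> * w"] that by simp
  have nr: "- \<i> * z \<notin> \<real>\<^sub>\<le>\<^sub>0"
    using assms by (auto simp: complex_nonpos_Reals_iff complex_eq_iff)
  have "((\<lambda>w. Ln (- \<i> * w) + \<i> * of_real (pi / 2)) has_field_derivative 1 / z)
          (at z within {z. 0 \<le> Im z})"
    using nr assms(1) by (auto intro!: derivative_eq_intros simp: field_simps)
  moreover have "\<forall>\<^sub>F w in at z within {z. 0 \<le> Im z}. Ln w = Ln (- \<i> * w) + \<i> * of_real (pi / 2)"
  proof -
    have "\<forall>\<^sub>F w in at z within {z. 0 \<le> Im z}. w \<noteq> 0"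
      using assms(1) tendsto_imp_eventually_ne[OF tendsto_ident_at] by blast
    moreover have "\<forall>\<^sub>F w in at z within {z. 0 \<le> Im z}. 0 \<le> Im w"
      by (simp add: eventually_at_filter)
    ultimately show ?thesis
      by eventually_elim (rule eq)
  qed
  ultimately show ?thesis
    by (subst has_field_derivative_cong_eventually[where g = "\<lambda>w. Ln (- \<i> * w) + \<i> * of_real (pi / 2)"])
       (use eq[OF assms] in auto)
qed

lemma h_has_field_derivative:
  assumes "0 \<le> Im z"
    and "\<And>j. j \<in> {1..Np P} \<Longrightarrow> z \<noteq> of_real (kp P t j)"
    and "\<And>j. j \<in> {1..Nm P} \<Longrightarrow> z \<noteq> of_real (km P t j)"
  shows "(h P t has_field_derivative h' P t z) (at z within {z. 0 \<le> Im z})"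
proof -
  have *: "((\<lambda>w. Ln (w - of_real a)) has_field_derivative 1 / (z - of_real a))
             (at z within {z. 0 \<le> Im z})" if "z \<noteq> of_real a" for a :: real
  proof -
    have im: "(\<lambda>w. w - of_real a) ` {z. 0 \<le> Im z} \<subseteq> {z. 0 \<le> Im z}" by auto
    have "(Ln has_field_derivative 1 / (z - of_real a))
            (at (z - of_real a) within (\<lambda>w. w - of_real a) ` {z. 0 \<le> Im z})"
      using Ln_has_field_derivative_closed_half_plane[of "z - of_real a"] that assms(1)
      by (auto intro: DERIV_subset[OF _ im])
    moreover have "((\<lambda>w. w - of_real a) has_field_derivative 1) (at z within {z. 0 \<le> Im z})"
      by (auto intro!: derivative_eq_intros)
    ultimately have "(Ln \<circ> (\<lambda>w. w - of_real a) has_field_derivative 1 / (z - of_real a) * 1)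
                       (at z within {z. 0 \<le> Im z})"
      by (rule DERIV_image_chain)
    then show ?thesis
      by (simp add: o_def)
  qed
  have "((\<lambda>z. (\<Sum>j=1..Np P. of_real (bp P j) * Ln (z - of_real (kp P t j)))
           - (\<Sum>j=1..Nm P. of_real (bm P j) * Ln (z - of_real (km P t j))))
     has_field_derivative
       (\<Sum>j=1..Np P. of_real (bp P j) * (1 / (z - of_real (kp P t j))))
     - (\<Sum>j=1..Nm P. of_real (bm P j) * (1 / (z - of_real (km P t j)))))
     (at z within {z. 0 \<le> Im z})"
    by (intro DERIV_diff DERIV_sum DERIV_cmult * assms)
  then show ?thesis
    by (simp add: h_def [abs_def] h'_def)
qed

lemma h_continuous:
  assumes "0 \<le> Im z"
    and "\<And>j. j \<in> {1..Np P} \<Longrightarrow> z \<noteq> of_real (kp P t j)"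
    and "\<And>j. j \<in> {1..Nm P} \<Longrightarrow> z \<noteq> of_real (km P t j)"
  shows "continuous (at z within {z. 0 \<le> Im z}) (h P t)"
  using h_has_field_derivative[OF assms] by (rule DERIV_continuous)


definition rhop :: "slit_data \<Rightarrow> nat \<Rightarrow> real \<Rightarrow> real" where
  "rhop P \<nu> t = (THE x. kp P t \<nu> < x \<and> x < kp P t (\<nu> + 1) \<and> h' P t (of_real x) = 0)"

definition rhom :: "slit_data \<Rightarrow> nat \<Rightarrow> real \<Rightarrow> real" where
  "rhom P \<mu> t = (THE x. km P t \<mu> < x \<and> (\<mu> < Nm P \<longrightarrow> x < km P t (\<mu> + 1)) \<and> h' P t (of_real x) = 0)"

definition rate :: "slit_data \<Rightarrow> (real \<Rightarrow> real) \<Rightarrow> real" where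
  "rate P \<rho> = Lim at_top (\<lambda>t. Re (h P t (of_real (\<rho> t))) / t)"

text \<open>Over the finite index sets the supremum and the infimum are a maximum and a minimum;
  in \<open>ereal\<close> the supremum of the empty set is \<open>-\<infinity>\<close>.\<close>

definition max_rate_minus :: "slit_data \<Rightarrow> ereal" where
  "max_rate_minus P = (SUP \<mu>\<in>{1..Nm P - 1}. ereal (rate P (rhom P \<mu>)))"

definition min_rate_plus :: "slit_data \<Rightarrow> ereal" where
  "min_rate_plus P = (INF \<nu>\<in>{1..Np P - 1}. ereal (rate P (rhop P \<nu>)))"


text \<open>\<open>yp P \<nu>\<close> for \<open>\<nu> = 1..Np-1\<close> and \<open>ym P \<mu>\<close> for \<open>\<mu> = 1..Nm\<close> are the heights of the critical values.
  At the remaining indices the formulas give the edges of the whole strip: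
  \<open>yp P 0 = \<pi> (b\<^sup>+ - b\<^sup>-)\<close> and \<open>yp P (Np P) = ym P 0 = - \<pi> b\<^sup>-\<close>, so that the extremal strips
  need no separate definition.\<close>

definition yp :: "slit_data \<Rightarrow> nat \<Rightarrow> real" where
  "yp P \<nu> = pi * ((\<Sum>j=\<nu>+1..Np P. bp P j) - bm_total P)"

definition ym :: "slit_data \<Rightarrow> nat \<Rightarrow> real" where
  "ym P \<mu> = - pi * (\<Sum>j=\<mu>+1..Nm P. bm P j)"

definition Sp :: "slit_data \<Rightarrow> nat \<Rightarrow> complex set" where
  "Sp P \<nu> = {w. yp P \<nu> < Im w \<and> Im w < yp P (\<nu> - 1)}"

definition Sm :: "slit_data \<Rightarrow> nat \<Rightarrow> complex set" where
  "Sm P \<mu> = {w. ym P (\<mu> - 1) < Im w \<and> Im w < ym P \<mu>}"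

definition mu_index :: "slit_data \<Rightarrow> nat \<Rightarrow> nat" where
  "mu_index P \<nu> = (THE \<mu>. \<mu> \<in> {1..Nm P} \<and>
     (\<Sum>j=1..\<mu>-1. bm P j) < (\<Sum>j=\<nu>+1..Np P. bp P j) \<and>
     (\<Sum>j=\<nu>+1..Np P. bp P j) < (\<Sum>j=1..\<mu>. bm P j))"

definition later_drops :: "slit_data \<Rightarrow> nat \<Rightarrow> nat set" where
  "later_drops P \<nu> = {\<nu>' \<in> {1..Np P - 1}. \<nu> < \<nu>' \<and> mu_index P \<nu>' < mu_index P \<nu>}"

text \<open>\<open>is_nu P \<omega> \<nu>\<close> says that the finite sequence \<open>\<nu>\<^sub>1 < \<dots> < \<nu>\<^sub>\<lambda>\<close> has an \<open>\<omega>\<close>-th term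
  (i.e. \<open>1 \<le> \<omega> \<le> \<lambda>\<close>) and that this term is \<open>\<nu>\<close>.\<close>

inductive is_nu :: "slit_data \<Rightarrow> nat \<Rightarrow> nat \<Rightarrow> bool" for P where
  is_nu_first: "is_nu P 1 1"
| is_nu_next: "is_nu P \<omega> \<nu> \<Longrightarrow> later_drops P \<nu> \<noteq> {} \<Longrightarrow> is_nu P (Suc \<omega>) (Min (later_drops P \<nu>))"


text \<open>Two strips neither of which contains the other have lower and upper edges ordered in the same
  way, so in \<open>E1\<close> the order of the lower edges tells which of them lies higher.\<close>

definition E0 :: "slit_data \<Rightarrow> bool" where
  "E0 P \<longleftrightarrow> mono_on {2..Np P - 1} (thetap P) \<and> antimono_on {1..Nm P} (thetam P)"

definition E1 :: "slit_data \<Rightarrow> bool" where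
  "E1 P \<longleftrightarrow> (\<forall>\<nu>\<in>{2..Np P - 1}. \<forall>\<mu>\<in>{1..Nm P}.
     (if Sp P \<nu> \<subseteq> Sm P \<mu> \<or> Sm P \<mu> \<subseteq> Sp P \<nu> then thetap P \<nu> = thetam P \<mu>
      else (ym P (\<mu> - 1) < yp P \<nu> \<longrightarrow> thetap P \<nu> < thetam P \<mu>) \<and>
           (yp P \<nu> < ym P (\<mu> - 1) \<longrightarrow> thetam P \<mu> < thetap P \<nu>)))"

definition E2 :: "slit_data \<Rightarrow> bool" where
  "E2 P \<longleftrightarrow>
     (\<forall>\<mu>\<in>{1..Nm P}. \<forall>\<mu>'\<in>{1..Nm P}.
        Sm P \<mu> \<subseteq> Sp P 1 \<and> Sm P \<mu>' \<subseteq> Sp P 1 \<longrightarrow> thetam P \<mu> = thetam P \<mu>') \<and>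
     (\<forall>\<mu>\<in>{1..Nm P}. Sm P \<mu> \<subseteq> Sp P 1 \<longrightarrow> thetam P \<mu> < thetam P (mu_index P 1)) \<and>
     (\<forall>\<mu>\<in>{1..Nm P}. \<forall>\<mu>'\<in>{1..Nm P}.
        Sm P \<mu> \<subseteq> Sp P (Np P) \<and> Sm P \<mu>' \<subseteq> Sp P (Np P) \<longrightarrow> thetam P \<mu> = thetam P \<mu>') \<and>
     (\<forall>\<mu>\<in>{1..Nm P}. Sm P \<mu> \<subseteq> Sp P (Np P) \<longrightarrow> thetam P (mu_index P (Np P - 1)) < thetam P \<mu>)"

definition admissible :: "slit_data \<Rightarrow> bool" where
  "admissible P \<longleftrightarrow>
     (\<forall>j\<in>{2..Np P - 1}. 0 < thetap P j) \<and> (\<forall>j\<in>{1..Nm P}. 0 < thetam P j) \<and>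
     E0 P \<and> E1 P \<and> E2 P"


definition tip_orbit :: "slit_data \<Rightarrow> real \<Rightarrow> (real \<Rightarrow> real) \<Rightarrow> real \<Rightarrow> complex" where
  "tip_orbit P \<gamma> \<rho> t = (if t = 0 then of_real (\<rho> 0)
     else inv_into upper_half_plane (h P 0) (h P t (of_real (\<rho> t)) - of_real (\<gamma> * t)))"

abbreviation Gammap :: "slit_data \<Rightarrow> real \<Rightarrow> nat \<Rightarrow> real \<Rightarrow> complex" where
  "Gammap P \<gamma> \<nu> \<equiv> tip_orbit P \<gamma> (rhop P \<nu>)"

abbreviation Gammam :: "slit_data \<Rightarrow> real \<Rightarrow> nat \<Rightarrow> real \<Rightarrow> complex" where
  "Gammam P \<gamma> \<mu> \<equiv> tip_orbit P \<gamma> (rhom P \<mu>)"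

definition converges_to_real_by_angle :: "(real \<Rightarrow> complex) \<Rightarrow> real \<Rightarrow> bool" where
  "converges_to_real_by_angle \<eta> \<theta> \<longleftrightarrow>
     continuous_on {0..} \<eta> \<and> (\<forall>t\<ge>0. 0 \<le> Im (\<eta> t)) \<and> (\<forall>t>0. \<eta> t \<in> upper_half_plane) \<and>
     0 \<le> \<theta> \<and> \<theta> \<le> pi \<and>
     (\<exists>x::real. (\<eta> \<longlongrightarrow> of_real x) at_top \<and> ((\<lambda>t. Arg (\<eta> t - of_real x)) \<longlongrightarrow> \<theta>) at_top)"

end

theory Submission
  imports Defs
begin

text \<open>The function \<open>h\<^sub>0\<close> maps the upper half-plane univalently into the strip
  \<open>-\<pi> b\<^sup>- < Im w < \<pi> (b\<^sup>+ - b\<^sup>-)\<close>, and the image omits a half-line going to the left at each height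
  \<open>y\<^sup>+\<^sub>\<nu>\<close> and a half-line going to the right at each height \<open>y\<^sup>-\<^sub>\<mu>\<close>. The tips of these slits are the
  critical values, and their heights do not change with \<open>t\<close>. Hence the point \<open>h\<^sub>t(\<rho>(t)) - \<gamma> t\<close> moves on
  the horizontal line that carries the slit of \<open>\<rho>\<close>. If it leaves the tip into the free part of that
  line and runs along it to infinity, its preimage is a curve in the half-plane that starts at
  \<open>\<rho>(0)\<close> and can only end at a pole of \<open>h\<^sub>0'\<close>. Near a pole \<open>k\<close> with charge \<open>c\<close> one has
  \<open>Im h\<^sub>0(z) = \<sigma> + c arg (z - k) + o(1)\<close>, where \<open>\<sigma>\<close> is the height of the boundary just to the right of
  \<open>k\<close>. So the height of the line selects the pole, and it gives the angle
  \<open>(y - \<sigma>) / c\<close>. All formulas of the theorem are instances of this one.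

  Four ingredients make this rigorous.

  Univalence: with \<open>K = k\<^sup>+\<^sub>N\<close> every term of \<open>(z - K) h\<^sub>0'(z)\<close> has nonnegative imaginary part, because the
  positive charges sit at or to the left of \<open>K\<close> and the negative ones to its right. This product is
  the derivative of \<open>h\<^sub>0\<close> with respect to \<open>log (z - K)\<close>, which ranges over a convex strip, so \<open>h\<^sub>0\<close> is
  injective (\<open>log_pot_eq_imp_eq\<close>). On the real axis the same product increases between poles,
  which gives the uniqueness of the critical points and the extremality of the critical values.

  Image: \<open>|Re h\<^sub>0|\<close> tends to infinity at the poles and at infinity, so \<open>h\<^sub>0\<close> is proper. An open and closed
  argument shows that the whole free half-line lies in the image (\<open>half_line_in_image\<close>), and
  compactness gives continuity of the inverse up to the tip as well as the limit point and angle at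
  the far end (\<open>inverse_half_line_converges\<close>).

  Motion of the tips: in the variable \<open>ln |x - K|\<close> the real potential between two poles is jointly
  concave (left of \<open>K\<close>) or convex (right of \<open>K\<close>) with respect to position and time, since the moving
  poles are exponentials in \<open>t\<close> and weighted geometric means are superadditive. Thus
  \<open>Re h\<^sub>t(\<rho>\<^sup>+(t))\<close>, a maximum over the position, is concave in \<open>t\<close>, and \<open>Re h\<^sub>t(\<rho>\<^sup>-(t))\<close>, a minimum, is convex.
  Concavity turns the asymptotic rate \<open>L\<close> into the inequality \<open>\<Phi>(t) \<ge> \<Phi>(0) + L t\<close> for all \<open>t \<ge> 0\<close>, so a
  speed \<open>\<gamma>\<close> strictly between the rates moves every tip into the free part of its line at once and
  with linear growth (\<open>plus_tip_growth\<close>, \<open>minus_tip_growth\<close>).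

  Combinatorics: the heights \<open>y\<^sup>+\<^sub>\<nu>\<close> decrease and the heights \<open>y\<^sup>-\<^sub>\<mu>\<close> increase, so comparing partial sums
  of the weights shows in which strip each tip lies (\<open>mu_index\<close>, \<open>strip_of_middle_tip\<close>).\<close>

section \<open>Logarithmic potentials of real charges\<close>

definition log_pot :: "'i set \<Rightarrow> ('i \<Rightarrow> real) \<Rightarrow> ('i \<Rightarrow> real) \<Rightarrow> complex \<Rightarrow> complex" where
  "log_pot I c p z = (\<Sum>i\<in>I. of_real (c i) * Ln (z - of_real (p i)))"

text \<open>Poles are excluded because \<open>Ln 0\<close> is an ordinary (default) value, so that properness would
  fail at a pole.\<close>

definition free_points :: "'i set \<Rightarrow> ('i \<Rightarrow> real) \<Rightarrow> complex set" where
  "free_points I p = {z. 0 \<le> Im z \<and> (\<forall>i\<in>I. z \<noteq> of_real (p i))}"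

lemma free_points_upper: "0 < Im z \<Longrightarrow> z \<in> free_points I p"
  by (auto simp: free_points_def)

lemma log_pot_has_field_derivative:
  assumes "z \<in> free_points I p"
  shows "(log_pot I c p has_field_derivative (\<Sum>i\<in>I. of_real (c i) / (z - of_real (p i))))
           (at z within {z. 0 \<le> Im z})"
proof -
  have "((\<lambda>w. Ln (w - of_real a)) has_field_derivative 1 / (z - of_real a) * 1)
          (at z within {z. 0 \<le> Im z})" if "z \<noteq> of_real a" for a :: real
  proof -
    have "(Ln has_field_derivative 1 / (z - of_real a))
            (at (z - of_real a) within (\<lambda>w. w - of_real a) ` {z. 0 \<le> Im z})"
      by (rule DERIV_subset[OF Ln_has_field_derivative_closed_half_plane])
         (use that assms in \<open>auto simp: free_points_def\<close>)
    moreover have "((\<lambda>w. w - of_real a) has_field_derivative 1) (at z within {z. 0 \<le> Im z})"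
      by (auto intro!: derivative_eq_intros)
    ultimately show ?thesis
      by (rule DERIV_image_chain[unfolded o_def])
  qed
  then have "((\<lambda>z. \<Sum>i\<in>I. of_real (c i) * Ln (z - of_real (p i))) has_field_derivative
          (\<Sum>i\<in>I. of_real (c i) * (1 / (z - of_real (p i))))) (at z within {z. 0 \<le> Im z})"
    using assms by (intro DERIV_sum DERIV_cmult) (auto simp: free_points_def)
  then show ?thesis
    by (simp add: log_pot_def [abs_def])
qed

lemma log_pot_tendsto:
  assumes "z0 \<in> free_points I p" "(z \<longlongrightarrow> z0) F" "\<forall>\<^sub>F n in F. 0 \<le> Im (z n)"
  shows "((\<lambda>n. log_pot I c p (z n)) \<longlongrightarrow> log_pot I c p z0) F"
  using continuous_within_tendsto_compose[OF
      DERIV_continuous[OF log_pot_has_field_derivative[OF assms(1)]] _ assms(2)] assms(3)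
  by simp

lemma Re_log_pot:
  assumes "z \<in> free_points I p"
  shows "Re (log_pot I c p z) = (\<Sum>i\<in>I. c i * ln (cmod (z - of_real (p i))))"
  using assms unfolding log_pot_def Re_sum by (intro sum.cong) (auto simp: free_points_def)

lemma Im_log_pot:
  assumes "z \<in> free_points I p"
  shows "Im (log_pot I c p z) = (\<Sum>i\<in>I. c i * Arg (z - of_real (p i)))"
  using assms unfolding log_pot_def Im_sum
  by (intro sum.cong) (auto simp: free_points_def Arg_eq_Im_Ln)

lemma Im_log_pot_real:
  assumes "finite I" "of_real x \<in> free_points I p"
  shows "Im (log_pot I c p (of_real x)) = pi * (\<Sum>i\<in>{i\<in>I. x < p i}. c i)"
proof -
  have "Im (log_pot I c p (of_real x)) = (\<Sum>i\<in>I. if x < p i then pi * c i else 0)"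
    unfolding Im_log_pot[OF assms(2)]
    by (intro sum.cong) (auto simp: simp flip: of_real_diff)
  also have "\<dots> = pi * (\<Sum>i\<in>{i\<in>I. x < p i}. c i)"
    unfolding sum.inter_filter[OF assms(1)] sum_distrib_left by (intro sum.cong) auto
  finally show ?thesis .
qed

lemma log_pot_uminus: "log_pot I (\<lambda>i. - c i) p z = - log_pot I c p z"
  by (simp add: log_pot_def sum_negf)

locale charges =
  fixes I :: "'i set" and c p :: "'i \<Rightarrow> real"
  assumes finite_I: "finite I" and inj_p: "inj_on p I" and c_nonzero: "i \<in> I \<Longrightarrow> c i \<noteq> 0"
begin

abbreviation "f \<equiv> log_pot I c p"
abbreviation "\<Omega> \<equiv> free_points I p"
abbreviation "net_charge \<equiv> (\<Sum>i\<in>I. c i)"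

text \<open>The limit of \<open>Im f\<close> along the real axis at the pole from the right. Turning around the pole by
  the angle \<open>\<alpha>\<close> adds \<open>c j * \<alpha>\<close>.\<close>

definition pole_height :: "'i \<Rightarrow> real" where
  "pole_height j = pi * (\<Sum>i\<in>{i\<in>I. p j < p i}. c i)"

lemma pole_free: "j \<in> I \<Longrightarrow> of_real (p j) \<in> free_points (I - {j}) p"
  using inj_p by (auto simp: free_points_def inj_on_def)

lemma split_pole: "j \<in> I \<Longrightarrow> f z = log_pot (I - {j}) c p z + of_real (c j) * Ln (z - of_real (p j))"
  unfolding log_pot_def using finite_I by (simp add: sum.remove)

lemma Im_regular_part:
  assumes "j \<in> I"
  shows "Im (log_pot (I - {j}) c p (of_real (p j))) = pole_height j"
proof -
  have "{i \<in> I - {j}. p j < p i} = {i \<in> I. p j < p i}" by auto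
  then show ?thesis
    using Im_log_pot_real[OF _ pole_free[OF assms]] finite_I
    by (simp add: pole_height_def)
qed

text \<open>Apart from the charge at \<open>p j\<close> itself the potential is continuous at \<open>p j\<close>. This
  converts a prescribed height into an argument.\<close>

lemma height_near_pole:
  assumes "j \<in> I" "(z \<longlongrightarrow> of_real (p j)) F" "\<forall>\<^sub>F n in F. z n \<in> \<Omega>"
  shows "((\<lambda>n. Im (f (z n)) - c j * Arg (z n - of_real (p j))) \<longlongrightarrow> pole_height j) F"
proof -
  have "\<forall>\<^sub>F n in F. 0 \<le> Im (z n)"
    using assms(3) by eventually_elim (auto simp: free_points_def)
  from tendsto_Im[OF log_pot_tendsto[where c = c, OF pole_free[OF assms(1)] assms(2) this]]
  have "((\<lambda>n. Im (log_pot (I - {j}) c p (z n))) \<longlongrightarrow> pole_height j) F"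
    by (simp add: Im_regular_part[OF assms(1)])
  moreover have "\<forall>\<^sub>F n in F. Im (log_pot (I - {j}) c p (z n))
                    = Im (f (z n)) - c j * Arg (z n - of_real (p j))"
    using assms(3)
  proof eventually_elim
    case (elim n)
    then have "z n - of_real (p j) \<noteq> 0" using assms(1) by (auto simp: free_points_def)
    then show ?case
      by (subst split_pole[OF assms(1)]) (simp add: Arg_eq_Im_Ln)
  qed
  ultimately show ?thesis by (rule Lim_transform_eventually)
qed

lemma Re_at_negative_pole:
  assumes "j \<in> I" "c j < 0" "(z \<longlongrightarrow> of_real (p j)) F" "\<forall>\<^sub>F n in F. z n \<in> \<Omega>"
  shows "filterlim (\<lambda>n. Re (f (z n))) at_top F"
proof -
  have ne: "\<forall>\<^sub>F n in F. z n - of_real (p j) \<noteq> 0"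
    using assms(4) by eventually_elim (use assms(1) in \<open>auto simp: free_points_def\<close>)
  have "\<forall>\<^sub>F n in F. 0 \<le> Im (z n)"
    using assms(4) by eventually_elim (auto simp: free_points_def)
  from tendsto_Re[OF log_pot_tendsto[where c = c, OF pole_free[OF assms(1)] assms(3) this]]
  have reg: "((\<lambda>n. Re (log_pot (I - {j}) c p (z n))) \<longlongrightarrow>
          Re (log_pot (I - {j}) c p (of_real (p j)))) F" .
  have "((\<lambda>n. cmod (z n - of_real (p j))) \<longlongrightarrow> 0) F"
    using assms(3) by (simp add: LIM_zero tendsto_norm_zero)
  then have "filterlim (\<lambda>n. cmod (z n - of_real (p j))) (at_right 0) F"
    using ne by (auto simp: filterlim_at elim: eventually_mono)
  then have "filterlim (\<lambda>n. ln (cmod (z n - of_real (p j)))) at_bot F"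
    by (rule filterlim_compose[OF ln_at_0])
  then have "filterlim (\<lambda>n. c j * ln (cmod (z n - of_real (p j)))) at_top F"
    using assms(2) filterlim_tendsto_neg_mult_at_bot[OF tendsto_const[of "c j"]]
    by (simp add: filterlim_tendsto_neg_mult_at_bot filterlim_uminus_at_top
        filterlim_tendsto_pos_mult_at_bot[OF tendsto_const[of "- c j"], simplified])
  with reg have "filterlim (\<lambda>n. Re (log_pot (I - {j}) c p (z n))
                    + c j * ln (cmod (z n - of_real (p j)))) at_top F"
    by (rule filterlim_tendsto_add_at_top)
  moreover have "\<forall>\<^sub>F n in F. Re (log_pot (I - {j}) c p (z n)) + c j * ln (cmod (z n - of_real (p j)))
                    = Re (f (z n))"
    using ne by eventually_elim (simp add: split_pole[OF assms(1)])
  ultimately show ?thesis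
    by (rule filterlim_cong[OF refl refl, THEN iffD1, rotated])
qed

lemma ratio_at_infinity:
  fixes a :: real
  assumes "filterlim z at_infinity F"
  shows "((\<lambda>n. (z n - of_real a) / z n) \<longlongrightarrow> (1::complex)) F"
proof -
  have "((\<lambda>n. 1 - of_real a / z n) \<longlongrightarrow> 1 - 0) F"
    by (intro tendsto_diff tendsto_const tendsto_divide_0[OF tendsto_const assms])
  moreover have "\<forall>\<^sub>F n in F. 1 - of_real a / z n = (z n - of_real a) / z n"
    using filterlim_at_infinity_imp_eventually_ne[OF assms, of 0]
    by eventually_elim (simp add: field_simps)
  ultimately show ?thesis by (simp add: Lim_transform_eventually)
qed

lemma Re_at_infinity:
  assumes "0 < net_charge" "filterlim z at_infinity F" "\<forall>\<^sub>F n in F. z n \<in> \<Omega>"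
  shows "filterlim (\<lambda>n. Re (f (z n))) at_top F"
proof -
  have ne: "\<forall>\<^sub>F n in F. z n \<noteq> 0"
    using filterlim_at_infinity_imp_eventually_ne[OF assms(2)] .
  have "((\<lambda>n. \<Sum>i\<in>I. c i * ln (cmod ((z n - of_real (p i)) / z n))) \<longlongrightarrow> (\<Sum>i\<in>I. c i * ln (cmod 1))) F"
    by (intro tendsto_sum tendsto_mult tendsto_const tendsto_ln tendsto_norm
          ratio_at_infinity[OF assms(2)]) auto
  then have 1: "((\<lambda>n. \<Sum>i\<in>I. c i * ln (cmod ((z n - of_real (p i)) / z n))) \<longlongrightarrow> 0) F"
    by simp
  have "filterlim (\<lambda>n. net_charge * ln (cmod (z n))) at_top F"
    using assms(1) filterlim_compose[OF ln_at_top filterlim_at_infinity_imp_norm_at_top[OF assms(2)]]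
    by (rule filterlim_tendsto_pos_mult_at_top[OF tendsto_const])
  with 1 have "filterlim (\<lambda>n. (\<Sum>i\<in>I. c i * ln (cmod ((z n - of_real (p i)) / z n)))
        + net_charge * ln (cmod (z n))) at_top F"
    by (rule filterlim_tendsto_add_at_top)
  moreover have "\<forall>\<^sub>F n in F. (\<Sum>i\<in>I. c i * ln (cmod ((z n - of_real (p i)) / z n)))
        + net_charge * ln (cmod (z n)) = Re (f (z n))"
    using ne assms(3)
  proof eventually_elim
    case (elim n)
    have "(\<Sum>i\<in>I. c i * ln (cmod ((z n - of_real (p i)) / z n)))
        = (\<Sum>i\<in>I. c i * ln (cmod (z n - of_real (p i))) - c i * ln (cmod (z n)))"
      using elim by (intro sum.cong) (auto simp: norm_divide ln_div free_points_def right_diff_distrib)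
    then show ?case
      by (simp add: Re_log_pot[OF elim(2)] sum_subtractf sum_distrib_right)
  qed
  ultimately show ?thesis
    by (rule filterlim_cong[OF refl refl, THEN iffD1, rotated])
qed

text \<open>Far away all charges act as one nonnegative charge at the origin, for which the height is
  nonnegative.\<close>

lemma Im_at_infinity:
  assumes "0 \<le> net_charge" "filterlim z at_infinity F" "\<forall>\<^sub>F n in F. 0 < Im (z n)" "y < 0"
  shows "\<forall>\<^sub>F n in F. y < Im (f (z n))"
proof -
  have "((\<lambda>n. \<Sum>i\<in>I. c i * Im (Ln ((z n - of_real (p i)) / z n))) \<longlongrightarrow> (\<Sum>i\<in>I. c i * Im (Ln 1))) F"
    by (intro tendsto_sum tendsto_mult tendsto_const tendsto_Im tendsto_Ln
          ratio_at_infinity[OF assms(2)]) auto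
  then have "\<forall>\<^sub>F n in F. y < (\<Sum>i\<in>I. c i * Im (Ln ((z n - of_real (p i)) / z n)))"
    using assms(4) by (intro order_tendstoD(1)) auto
  with assms(3) show ?thesis
  proof eventually_elim
    case (elim n)
    have "Im (Ln ((z n - of_real a) / z n)) = Arg (z n - of_real a) - Arg (z n)" for a :: real
    proof -
      have nz: "z n \<noteq> 0" "z n - of_real a \<noteq> 0" using elim(1) by (auto simp: complex_eq_iff)
      have "Arg ((z n - of_real a) / z n) = Arg (z n - of_real a) - Arg (z n)"
        by (rule Arg_unique_lemma[OF is_Arg_Arg Arg_divide, symmetric])
           (use Arg_lt_pi[of "z n"] Arg_lt_pi[of "z n - of_real a"] elim(1) nz
             in \<open>auto simp: mpi_less_Arg Arg_le_pi\<close>)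
      then show ?thesis using nz by (simp add: Arg_eq_Im_Ln)
    qed
    then have "(\<Sum>i\<in>I. c i * Im (Ln ((z n - of_real (p i)) / z n)))
         = Im (f (z n)) - net_charge * Arg (z n)"
      by (simp add: Im_log_pot[OF free_points_upper[OF elim(1)]] sum_subtractf sum_distrib_right
          right_diff_distrib)
    moreover have "0 \<le> net_charge * Arg (z n)"
      using assms(1) Arg_lt_pi[of "z n"] elim(1) by auto
    ultimately show ?case using elim(2) by linarith
  qed
qed

lemma uminus_charges: "charges I (\<lambda>i. - c i) p"
  using finite_I inj_p c_nonzero by unfold_locales auto


section \<open>Preimages of horizontal half-lines\<close>

lemma Re_far_away:
  assumes "0 < net_charge"
  obtains B where "\<And>z. z \<in> \<Omega> \<Longrightarrow> B \<le> cmod z \<Longrightarrow> R < Re (f z)"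
proof -
  have "filterlim (\<lambda>z. Re (f z)) at_top (inf at_infinity (principal \<Omega>))"
    using assms by (rule Re_at_infinity) (simp_all add: filterlim_def filtermap_ident eventually_inf_principal)
  then have "\<forall>\<^sub>F z in inf at_infinity (principal \<Omega>). R < Re (f z)"
    by (auto simp: filterlim_at_top_dense)
  then show ?thesis
    using that by (auto simp: eventually_inf_principal eventually_at_infinity)
qed

lemma Im_far_away:
  assumes "0 \<le> net_charge" "y < 0"
  obtains B where "\<And>z. 0 < Im z \<Longrightarrow> B \<le> cmod z \<Longrightarrow> y < Im (f z)"
proof -
  have "\<forall>\<^sub>F z in inf at_infinity (principal {z. 0 < Im z}). y < Im (f z)"
    using assms(1) _ _ assms(2)
    by (rule Im_at_infinity) (simp_all add: filterlim_def filtermap_ident eventually_inf_principal)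
  then show ?thesis
    using that by (auto simp: eventually_inf_principal eventually_at_infinity)
qed

lemma abs_Re_at_pole:
  assumes "j \<in> I" "(z \<longlongrightarrow> of_real (p j)) F" "\<forall>\<^sub>F n in F. z n \<in> \<Omega>"
  shows "filterlim (\<lambda>n. \<bar>Re (f (z n))\<bar>) at_top F"
proof -
  interpret minus: charges I "\<lambda>i. - c i" p by (rule uminus_charges)
  consider "c j < 0" | "- c j < 0" using c_nonzero[OF assms(1)] by linarith
  then show ?thesis
  proof cases
    case 1
    show ?thesis
      by (rule filterlim_at_top_mono[OF Re_at_negative_pole[OF assms(1) 1 assms(2,3)]])
         (intro always_eventually allI abs_ge_self)
  next
    case 2
    show ?thesis
      by (rule filterlim_at_top_mono[OF minus.Re_at_negative_pole[OF assms(1) 2 assms(2,3)]])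
         (intro always_eventually allI, simp add: log_pot_uminus abs_ge_minus_self)
  qed
qed

lemma abs_Re_far_away:
  assumes "net_charge \<noteq> 0"
  obtains B where "\<And>z. z \<in> \<Omega> \<Longrightarrow> B \<le> cmod z \<Longrightarrow> R < \<bar>Re (f z)\<bar>"
proof -
  interpret minus: charges I "\<lambda>i. - c i" p by (rule uminus_charges)
  consider "0 < net_charge" | "0 < (\<Sum>i\<in>I. - c i)" using assms by (force simp: sum_negf)
  then show ?thesis
  proof cases
    case 1
    then show ?thesis by (rule Re_far_away[where R = R]) (use that in fastforce)
  next
    case 2
    then show ?thesis
      by (rule minus.Re_far_away[where R = R]) (use that in \<open>fastforce simp: log_pot_uminus\<close>)
  qed
qed

text \<open>Properness of \<open>f\<close>: a bounded real part keeps the points away from the poles and from infinity.\<close>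

lemma convergent_values:
  fixes z :: "nat \<Rightarrow> complex"
  assumes "net_charge \<noteq> 0" "\<And>n. z n \<in> \<Omega>" "(\<lambda>n. f (z n)) \<longlonglongrightarrow> w"
  obtains r l where "strict_mono r" "(z \<circ> r) \<longlonglongrightarrow> l" "l \<in> \<Omega>" "f l = w"
proof -
  have "Bseq (\<lambda>n. Re (f (z n)))"
    using tendsto_Re[OF assms(3)] by (intro convergent_imp_Bseq convergentI)
  then obtain R where R: "\<And>n. \<bar>Re (f (z n))\<bar> \<le> R"
    by (auto simp: Bseq_def)
  obtain B where B: "\<And>z. z \<in> \<Omega> \<Longrightarrow> B \<le> cmod z \<Longrightarrow> R < \<bar>Re (f z)\<bar>"
    using abs_Re_far_away[OF assms(1)] by blast
  have "cmod (z n) \<le> B" for n using B[OF assms(2), of n] R[of n] by force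
  then have "bounded (range z)" by (auto intro: boundedI)
  then obtain l r where r: "strict_mono (r :: nat \<Rightarrow> nat)" "(z \<circ> r) \<longlonglongrightarrow> l"
    using bounded_imp_convergent_subsequence by blast
  have free: "\<forall>\<^sub>F n in sequentially. (z \<circ> r) n \<in> \<Omega>" using assms(2) by auto
  have "0 \<le> Im l"
    using tendsto_Im[OF r(2)] assms(2)
    by (intro LIMSEQ_le_const[where X = "\<lambda>n. Im ((z \<circ> r) n)"]) (auto simp: free_points_def)
  moreover have "l \<noteq> of_real (p j)" if j: "j \<in> I" for j
  proof
    assume "l = of_real (p j)"
    with r(2) have "filterlim (\<lambda>n. \<bar>Re (f ((z \<circ> r) n))\<bar>) at_top sequentially"
      using abs_Re_at_pole[OF j _ free] by (simp only:)
    then obtain n where "R < \<bar>Re (f ((z \<circ> r) n))\<bar>"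
      by (metis (no_types, lifting) filterlim_at_top_dense eventually_happens sequentially_bot)
    then show False using R[of "r n"] by simp
  qed
  ultimately have l: "l \<in> \<Omega>" by (auto simp: free_points_def)
  have "(\<lambda>n. f ((z \<circ> r) n)) \<longlonglongrightarrow> f l"
    using assms(2) by (intro log_pot_tendsto[OF l r(2)]) (simp add: free_points_def)
  moreover have "(\<lambda>n. f ((z \<circ> r) n)) \<longlonglongrightarrow> w"
    using LIMSEQ_subseq_LIMSEQ[OF assms(3) r(1)] by (simp add: o_def)
  ultimately have "f l = w" by (rule LIMSEQ_unique)
  with r l that show ?thesis by blast
qed

text \<open>A value with a single preimage in the closed half-plane is a continuity point of the inverse.
  This covers interior points and slit tips alike.\<close>

lemma preimages_converge:
  fixes z :: "nat \<Rightarrow> complex"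
  assumes "net_charge \<noteq> 0" "\<And>n. z n \<in> \<Omega>" "(\<lambda>n. f (z n)) \<longlonglongrightarrow> f a"
    and unique: "\<And>b. b \<in> \<Omega> \<Longrightarrow> f b = f a \<Longrightarrow> b = a"
  shows "z \<longlonglongrightarrow> a"
proof (rule ccontr)
  assume "\<not> z \<longlonglongrightarrow> a"
  then obtain e where e: "e > 0" "\<exists>\<^sub>F n in sequentially. e \<le> dist (z n) a"
    by (auto simp: tendsto_iff not_eventually not_less)
  then have "infinite {n. e \<le> dist (z n) a}"
    by (simp add: frequently_cofinite flip: cofinite_eq_sequentially)
  then obtain s :: "nat \<Rightarrow> nat" where s: "strict_mono s" "\<And>n. s n \<in> {n. e \<le> dist (z n) a}"
    using infinite_enumerate by blast
  have "(\<lambda>n. f ((z \<circ> s) n)) \<longlonglongrightarrow> f a"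
    using LIMSEQ_subseq_LIMSEQ[OF assms(3) s(1)] by (simp add: o_def)
  then obtain r l where r: "strict_mono r" "(z \<circ> s \<circ> r) \<longlonglongrightarrow> l" "l \<in> \<Omega>" "f l = f a"
    using convergent_values[OF assms(1), of "z \<circ> s"] assms(2) by auto
  have "l = a" using unique r by blast
  then have "(\<lambda>n. dist ((z \<circ> s \<circ> r) n) a) \<longlonglongrightarrow> 0"
    using r(2) tendsto_dist_iff by blast
  then have "e \<le> 0"
    by (rule LIMSEQ_le_const) (use s(2) in auto)
  with e show False by simp
qed

text \<open>A height \<open>y\<close> for which large values of \<open>Re f\<close> on the line \<open>Im w = y\<close> force the preimage to the
  negative charge \<open>j\<close>: it is attained near \<open>p j\<close> at an interior angle, near no other negative charge,
  and not near infinity, where \<open>Re f\<close> is also large if the net charge is positive. Positive charges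
  are treated by passing to \<open>- f\<close>.\<close>

definition approach_height :: "'i \<Rightarrow> real \<Rightarrow> bool" where
  "approach_height j y \<longleftrightarrow> j \<in> I \<and> c j < 0 \<and>
     pole_height j + pi * c j < y \<and> y < pole_height j \<and>
     (\<forall>i\<in>I. i \<noteq> j \<longrightarrow> c i < 0 \<longrightarrow> y < pole_height i + pi * c i \<or> pole_height i < y) \<and>
     (0 < net_charge \<longrightarrow> y < 0)"

text \<open>Otherwise points with \<open>Re f\<close> growing along the line would accumulate at a point of the closed
  half-plane; near infinity either the height or the sign of \<open>Re f\<close> is wrong. The limit cannot be a free point or a positive charge, where \<open>Re f\<close> stays bounded above, and
  a negative charge other than \<open>j\<close> does not have the right height.\<close>

lemma high_values_near_pole:
  assumes "net_charge \<noteq> 0" "approach_height j y" "0 < e"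
  obtains R where "\<And>z. 0 < Im z \<Longrightarrow> Im (f z) = y \<Longrightarrow> R < Re (f z) \<Longrightarrow> dist z (of_real (p j)) < e"
proof (rule ccontr)
  note y = assms(2)[unfolded approach_height_def]
  assume "\<not> thesis"
  then have "\<forall>n::nat. \<exists>z. 0 < Im z \<and> Im (f z) = y \<and> real n < Re (f z) \<and> e \<le> dist z (of_real (p j))"
    using that by (metis not_le)
  then obtain z where z: "\<And>n. 0 < Im (z n)" "\<And>n. Im (f (z n)) = y" "\<And>n::nat. real n < Re (f (z n))"
    "\<And>n. e \<le> dist (z n) (of_real (p j))" by metis
  have free: "z n \<in> \<Omega>" for n using z(1) by (rule free_points_upper)
  obtain B where B: "\<And>n. cmod (z n) \<le> B"
  proof (cases "0 < net_charge")
    case True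
    then obtain B where "\<And>z. 0 < Im z \<Longrightarrow> B \<le> cmod z \<Longrightarrow> y < Im (f z)"
      using Im_far_away[of y] y by auto
    then show ?thesis using that[of B] z(1,2) by (metis less_irrefl nle_le)
  next
    case False
    interpret minus: charges I "\<lambda>i. - c i" p by (rule uminus_charges)
    obtain B where B: "\<And>z. z \<in> \<Omega> \<Longrightarrow> B \<le> cmod z \<Longrightarrow> 0 < Re (- f z)"
      using minus.Re_far_away[of 0] False assms(1) by (auto simp: sum_negf log_pot_uminus)
    have "cmod (z n) \<le> B" for n
      using B[OF free, of n] z(3)[of n] by force
    then show ?thesis by (rule that)
  qed
  then have "bounded (range z)" by (auto intro: boundedI)
  then obtain l r where r: "strict_mono (r :: nat \<Rightarrow> nat)" "(z \<circ> r) \<longlonglongrightarrow> l"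
    using bounded_imp_convergent_subsequence by blast
  have free': "\<forall>\<^sub>F n in sequentially. (z \<circ> r) n \<in> \<Omega>" using free by auto
  have top: "filterlim (\<lambda>n. Re (f ((z \<circ> r) n))) at_top sequentially"
  proof (rule filterlim_at_top_mono[OF filterlim_real_sequentially])
    show "\<forall>\<^sub>F n in sequentially. real n \<le> Re (f ((z \<circ> r) n))"
      using z(3) seq_suble[OF r(1)] by (intro always_eventually) (metis comp_apply less_le_trans nle_le not_less of_nat_le_iff)
  qed
  have "0 \<le> Im l"
    using tendsto_Im[OF r(2)] z(1)
    by (intro LIMSEQ_le_const[where X = "\<lambda>n. Im ((z \<circ> r) n)"]) (auto intro: less_imp_le)
  moreover have "l \<notin> \<Omega>"
  proof
    assume l: "l \<in> \<Omega>"
    have "(\<lambda>n. f ((z \<circ> r) n)) \<longlonglongrightarrow> f l"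
      using free by (intro log_pot_tendsto[OF l r(2)]) (simp add: free_points_def)
    then have "(\<lambda>n. Re (f ((z \<circ> r) n))) \<longlonglongrightarrow> Re (f l)" by (rule tendsto_Re)
    with top show False
      using not_tendsto_and_filterlim_at_infinity[OF _ _ filterlim_at_top_imp_at_infinity] by force
  qed
  ultimately obtain i where i: "i \<in> I" "l = of_real (p i)"
    by (auto simp: free_points_def)
  note lim = r(2)[unfolded i(2)]
  have "i \<noteq> j"
  proof
    assume "i = j"
    then have "(\<lambda>n. dist ((z \<circ> r) n) (of_real (p j))) \<longlonglongrightarrow> 0" using lim tendsto_dist_iff by blast
    then have "e \<le> 0" by (rule LIMSEQ_le_const) (use z(4) in auto)
    with assms(3) show False by simp
  qed
  show False
  proof (cases "c i < 0")
    case True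
    have lim': "(\<lambda>n. y - c i * Arg ((z \<circ> r) n - of_real (p i))) \<longlonglongrightarrow> pole_height i"
      using height_near_pole[OF i(1) lim free'] z(2) by simp
    have Arg: "0 \<le> Arg (z n - of_real (p i))" "Arg (z n - of_real (p i)) \<le> pi" for n
      using z(1)[of n] by (auto simp: Arg_less_0 Arg_le_pi)
    have "y \<le> pole_height i"
      by (rule LIMSEQ_le_const[OF lim']) (use Arg True in \<open>simp add: mult_nonpos_nonneg\<close>)
    moreover have "pole_height i \<le> y - pi * c i"
      by (rule LIMSEQ_le_const2[OF lim']) (use Arg True in \<open>auto simp: mult.commute[of pi]\<close>)
    ultimately show False using y i(1) \<open>i \<noteq> j\<close> True by force
  next
    case False
    interpret minus: charges I "\<lambda>i. - c i" p by (rule uminus_charges)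
    have "filterlim (\<lambda>n. - Re (f ((z \<circ> r) n))) at_top sequentially"
      using minus.Re_at_negative_pole[OF i(1) _ lim free'] False c_nonzero[OF i(1)]
      by (simp add: log_pot_uminus)
    then have "\<forall>\<^sub>F n in sequentially. 0 < - Re (f ((z \<circ> r) n))"
      by (simp only: filterlim_at_top_dense)
    then obtain n where "0 < - Re (f ((z \<circ> r) n))"
      using eventually_happens sequentially_bot by blast
    with z(3)[of "r n"] show False by simp
  qed
qed

lemma approach_pole:
  assumes "net_charge \<noteq> 0" "approach_height j y"
    and "\<forall>\<^sub>F t in F. 0 < Im (z t) \<and> Im (f (z t)) = y"
    and "filterlim (\<lambda>t. Re (f (z t))) at_top F"
  shows "(z \<longlongrightarrow> of_real (p j)) F"
    and "((\<lambda>t. Arg (z t - of_real (p j))) \<longlongrightarrow> (y - pole_height j) / c j) F"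
proof -
  note y = assms(2)[unfolded approach_height_def]
  show lim: "(z \<longlongrightarrow> of_real (p j)) F"
  proof (rule tendstoI)
    fix e :: real assume "0 < e"
    then obtain R where R: "\<And>z. 0 < Im z \<Longrightarrow> Im (f z) = y \<Longrightarrow> R < Re (f z) \<Longrightarrow> dist z (of_real (p j)) < e"
      using high_values_near_pole[OF assms(1,2)] by metis
    have "\<forall>\<^sub>F t in F. R < Re (f (z t))" using assms(4) by (simp add: filterlim_at_top_dense)
    with assms(3) show "\<forall>\<^sub>F t in F. dist (z t) (of_real (p j)) < e"
      by eventually_elim (use R in auto)
  qed
  have "\<forall>\<^sub>F t in F. z t \<in> \<Omega>"
    using assms(3) by eventually_elim (auto intro: free_points_upper)
  from height_near_pole[OF _ lim this]
  have "((\<lambda>t. (y - (Im (f (z t)) - c j * Arg (z t - of_real (p j)))) / c j) \<longlongrightarrow> (y - pole_height j) / c j) F"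
    using y by (intro tendsto_divide tendsto_diff tendsto_const) auto
  moreover have "\<forall>\<^sub>F t in F. (y - (Im (f (z t)) - c j * Arg (z t - of_real (p j)))) / c j
       = Arg (z t - of_real (p j))"
    using assms(3) by eventually_elim (use y in auto)
  ultimately show "((\<lambda>t. Arg (z t - of_real (p j))) \<longlongrightarrow> (y - pole_height j) / c j) F"
    by (rule Lim_transform_eventually)
qed

lemma continuous_on_free: "continuous_on \<Omega> f"
  unfolding continuous_on_eq_continuous_within
  using continuous_within_subset[OF DERIV_continuous[OF log_pot_has_field_derivative], of _ I p \<Omega> c]
  by (auto simp: free_points_def)

lemma continuous_on_upper: "continuous_on {z. 0 < Im z} f"
  by (rule continuous_on_subset[OF continuous_on_free]) (auto intro: free_points_upper)

text \<open>Seen along a small half-circle around the pole the height runs almost linearly between the two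
  edges of the strip, so the intermediate value theorem finds the height \<open>y\<close>.\<close>

lemma high_value_exists:
  assumes "approach_height j y"
  obtains z where "0 < Im z" "Im (f z) = y" "R < Re (f z)"
proof -
  note y = assms[unfolded approach_height_def]
  define P where "P = complex_of_real (p j)"
  define \<alpha> where "\<alpha> = (y - pole_height j) / c j"
  have \<alpha>: "0 < \<alpha>" "\<alpha> < pi" "y = pole_height j + c j * \<alpha>"
    using y by (auto simp: \<alpha>_def field_simps)
  \<comment> \<open>Two angles on either side of the expected one; \<open>\<delta>\<close> is the resulting margin in height.\<close>
  define \<alpha>1 \<alpha>2 where "\<alpha>1 = \<alpha> / 2" and "\<alpha>2 = (\<alpha> + pi) / 2"
  have \<alpha>12: "0 < \<alpha>1" "\<alpha>1 < \<alpha>" "\<alpha> < \<alpha>2" "\<alpha>2 < pi" using \<alpha> by (auto simp: \<alpha>1_def \<alpha>2_def)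
  define \<delta> where "\<delta> = min (- c j * (\<alpha> - \<alpha>1)) (- c j * (\<alpha>2 - \<alpha>))"
  have "\<delta> > 0" unfolding \<delta>_def using y \<alpha>12 by (simp add: mult_neg_pos)
  have free: "\<forall>\<^sub>F z in at P within \<Omega>. z \<in> \<Omega>" by (simp add: eventually_at_filter)
  have lim: "((\<lambda>z. z) \<longlongrightarrow> of_real (p j)) (at P within \<Omega>)" by (simp add: P_def)
  have "\<forall>\<^sub>F z in at P within \<Omega>. R < Re (f z)"
    using Re_at_negative_pole[OF _ _ lim free] y by (simp add: filterlim_at_top_dense)
  moreover have "\<forall>\<^sub>F z in at P within \<Omega>. dist (Im (f z) - c j * Arg (z - P)) (pole_height j) < \<delta>"
    using height_near_pole[OF _ lim free] y \<open>\<delta> > 0\<close> unfolding P_def by (auto simp: tendsto_iff)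
  ultimately have "\<forall>\<^sub>F z in at P within \<Omega>. R < Re (f z) \<and>
      dist (Im (f z) - c j * Arg (z - P)) (pole_height j) < \<delta>" by (rule eventually_conj)
  then obtain d where d: "d > 0" "\<And>z. z \<in> \<Omega> \<Longrightarrow> z \<noteq> P \<Longrightarrow> dist z P < d \<Longrightarrow>
      R < Re (f z) \<and> dist (Im (f z) - c j * Arg (z - P)) (pole_height j) < \<delta>"
    unfolding eventually_at by auto
  define g where "g t = P + of_real (d / 2) * cis t" for t
  have up: "0 < Im (g t)" if "0 < t" "t < pi" for t
    using that d(1) sin_gt_zero by (simp add: g_def P_def)
  have Arg: "Arg (g t - P) = t" if "0 < t" "t < pi" for t
    by (rule Arg_unique[of "d / 2"]) (use that d(1) in \<open>auto simp: g_def cis_conv_exp\<close>)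
  have near: "R < Re (f (g t))" "dist (Im (f (g t)) - c j * t) (pole_height j) < \<delta>" if "0 < t" "t < pi" for t
  proof -
    have "g t \<noteq> P" "dist (g t) P < d" using d(1) by (auto simp: g_def dist_norm norm_mult)
    with d(2)[of "g t"] Arg[OF that] free_points_upper[OF up[OF that]]
    show "R < Re (f (g t))" "dist (Im (f (g t)) - c j * t) (pole_height j) < \<delta>" by auto
  qed
  have "continuous_on {\<alpha>1..\<alpha>2} (\<lambda>t. f (g t))"
    by (rule continuous_on_compose2[OF continuous_on_upper])
       (use up \<alpha>12 in \<open>auto simp: g_def [abs_def] cis_conv_exp intro!: continuous_intros\<close>)
  then have cont: "continuous_on {\<alpha>1..\<alpha>2} (\<lambda>t. Im (f (g t)))" by (rule continuous_on_Im)
  have "Im (f (g \<alpha>2)) \<le> y" "y \<le> Im (f (g \<alpha>1))"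
    using near(2)[of \<alpha>1] near(2)[of \<alpha>2] \<alpha>12
    by (auto simp: \<alpha>(3) \<delta>_def dist_real_def algebra_simps abs_if split: if_splits)
  from IVT2'[OF this _ cont] obtain t where "\<alpha>1 \<le> t" "t \<le> \<alpha>2" "Im (f (g t)) = y"
    using \<alpha>12 by auto
  with that[of "g t"] near(1)[of t] up[of t] \<alpha>12 show ?thesis by auto
qed

text \<open>The set of attained values on the half-line is open by invariance of domain, closed because \<open>f\<close>
  is proper and no boundary point is mapped to it, and nonempty because the half-line ends at a pole.\<close>

lemma half_line_in_image:
  assumes "net_charge \<noteq> 0" "inj_on f {z. 0 < Im z}" "approach_height j y"
    and no_real: "\<And>x. of_real x \<in> \<Omega> \<Longrightarrow> Im (f (of_real x)) = y \<Longrightarrow> Re (f (of_real x)) \<le> R0"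
    and "R0 < R"
  shows "\<exists>z. 0 < Im z \<and> f z = Complex R y"
proof -
  define A where "A = {R0<..} \<inter> (\<lambda>R. Complex R y) -` f ` {z. 0 < Im z}"
  have "open (f ` {z. 0 < Im z})"
    using continuous_on_upper open_halfspace_Im_gt assms(2) by (rule invariance_of_domain)
  then have "open ((\<lambda>R. Complex R y) -` f ` {z. 0 < Im z})"
    by (intro open_vimage) (auto simp: Complex_eq intro!: continuous_intros)
  then have op: "openin (top_of_set {R0<..}) A"
    unfolding A_def by (rule openin_open_Int)
  have "A = {R0<..} \<inter> closure A"
  proof
    show "A \<subseteq> {R0<..} \<inter> closure A" using closure_subset[of A] unfolding A_def by blast
    show "{R0<..} \<inter> closure A \<subseteq> A"
    proof
      fix S assume S: "S \<in> {R0<..} \<inter> closure A"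
      then obtain x where x: "\<And>n. x n \<in> A" "x \<longlonglongrightarrow> S"
        by (auto simp: closure_sequential)
      have "\<exists>z. 0 < Im z \<and> f z = Complex (x n) y" for n
        using x(1)[of n] unfolding A_def image_iff vimage_def by (auto dest: sym)
      then obtain z where z: "\<And>n. 0 < Im (z n)" "\<And>n. f (z n) = Complex (x n) y" by metis
      have "(\<lambda>n. f (z n)) \<longlonglongrightarrow> Complex S y"
        unfolding z(2) Complex_eq by (intro tendsto_intros x(2))
      then obtain l where l: "l \<in> \<Omega>" "f l = Complex S y"
        using convergent_values[OF assms(1), of z] free_points_upper[OF z(1)] by metis
      have "Im l \<noteq> 0"
      proof
        assume "Im l = 0"
        then have "l = of_real (Re l)" by (simp add: complex_eq_iff)
        then have "Re (f l) \<le> R0" using no_real[of "Re l"] l by simp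
        with l S show False by simp
      qed
      with l have "0 < Im l" by (auto simp: free_points_def)
      with l S show "S \<in> A" by (auto simp: A_def intro: rev_image_eqI)
    qed
  qed
  then have "closedin (top_of_set {R0<..}) A"
    by (metis closed_closure closedin_closed_Int)
  moreover have "connected {R0<..}" by (simp add: convex_connected)
  ultimately have "A = {} \<or> A = {R0<..}"
    using op by (simp add: connected_clopen)
  moreover have "A \<noteq> {}"
  proof -
    obtain z where "0 < Im z" "Im (f z) = y" "R0 < Re (f z)"
      using high_value_exists[OF assms(3)] .
    then have "Re (f z) \<in> A" by (auto simp: A_def intro!: rev_image_eqI[of z] complex_eqI)
    then show ?thesis by blast
  qed
  ultimately have "R \<in> A" using assms(5) by auto
  then show ?thesis by (auto simp: A_def)
qed

text \<open>The fate of a point that starts at the tip of a slit and moves along the free part of its line: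
  \<open>strict\<close> says that the slit of \<open>x0\<close> is the only boundary piece at this height and ends at \<open>x0\<close>,
  \<open>not_attained\<close> that the tip is not an interior value.\<close>

lemma inverse_half_line_converges:
  assumes "net_charge \<noteq> 0" "inj_on f {z. 0 < Im z}" "approach_height j y"
    and tip: "of_real x0 \<in> \<Omega>" "Im (f (of_real x0)) = y"
    and strict: "\<And>x. of_real x \<in> \<Omega> \<Longrightarrow> Im (f (of_real x)) = y \<Longrightarrow> x \<noteq> x0 \<Longrightarrow>
        Re (f (of_real x)) < Re (f (of_real x0))"
    and not_attained: "\<And>z. 0 < Im z \<Longrightarrow> f z \<noteq> f (of_real x0)"
    and W: "continuous_on {0..} W" "W 0 = Re (f (of_real x0))"
      "\<And>t. 0 < t \<Longrightarrow> Re (f (of_real x0)) < W t" "filterlim W at_top at_top"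
  shows "converges_to_real_by_angle
           (\<lambda>t. if t = 0 then of_real x0 else inv_into {z. 0 < Im z} f (Complex (W t) y))
           ((y - pole_height j) / c j)"
proof -
  define \<eta> where "\<eta> t = (if t = 0 then of_real x0 else inv_into {z. 0 < Im z} f (Complex (W t) y))" for t
  let ?H = "{z. 0 < Im z}"
  have no_real: "Re (f (of_real x)) \<le> Re (f (of_real x0))" if "of_real x \<in> \<Omega>" "Im (f (of_real x)) = y" for x
    using strict[OF that] by (cases "x = x0") auto
  have \<eta>: "0 < Im (\<eta> t)" "f (\<eta> t) = Complex (W t) y" if "0 < t" for t
  proof -
    have *: "Complex (W t) y \<in> f ` ?H"
      using half_line_in_image[OF assms(1-3) no_real W(3)[OF that]] by (force intro: rev_image_eqI)
    show "0 < Im (\<eta> t)" "f (\<eta> t) = Complex (W t) y"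
      using inv_into_into[OF *] f_inv_into_f[OF *] that by (auto simp: \<eta>_def)
  qed
  have \<eta>0: "\<eta> 0 = of_real x0" by (simp add: \<eta>_def)
  have f\<eta>: "f (\<eta> t) = Complex (W t) y" if "0 \<le> t" for t
    using \<eta>(2)[of t] that tip W(2) by (cases "t = 0") (auto simp: \<eta>0 complex_eq_iff)
  have free: "\<eta> t \<in> \<Omega>" if "0 \<le> t" for t
    using \<eta>(1)[of t] that tip by (cases "t = 0") (auto simp: \<eta>0 free_points_upper)
  have unique: "b = \<eta> t" if "0 \<le> t" "b \<in> \<Omega>" "f b = f (\<eta> t)" for b t
  proof (cases "0 < Im b")
    case True
    then have "t \<noteq> 0" using not_attained[OF True] that by (auto simp: \<eta>0)
    then show ?thesis using inj_onD[OF assms(2) that(3)] True \<eta>(1)[of t] that(1) by auto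
  next
    case False
    then have b: "b = of_real (Re b)" using that(2) by (auto simp: free_points_def complex_eq_iff)
    have fb: "f b = Complex (W t) y" using that(3) f\<eta>[OF that(1)] by simp
    have "t = 0"
    proof (rule ccontr)
      assume "t \<noteq> 0"
      then have "Re (f (of_real x0)) < Re (f b)" using W(3)[of t] that(1) fb by simp
      moreover have "Re (f b) \<le> Re (f (of_real x0))" using no_real[of "Re b"] b fb that(2) by simp
      ultimately show False by simp
    qed
    then have "Re (f b) = Re (f (of_real x0))" using fb W(2) by simp
    then have "Re b = x0" using strict[of "Re b"] b fb that(2) by force
    then show ?thesis using b \<open>t = 0\<close> \<eta>0 by simp
  qed
  have "continuous_on {0..} \<eta>"
    unfolding continuous_on_sequentially
  proof (intro ballI allI impI)
    fix t and x :: "nat \<Rightarrow> real"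
    assume t: "t \<in> {0..}" and x: "(\<forall>n. x n \<in> {0..}) \<and> x \<longlonglongrightarrow> t"
    have "(\<lambda>n. W (x n)) \<longlonglongrightarrow> W t"
      using W(1) t x by (auto simp: continuous_on_sequentially o_def)
    then have "(\<lambda>n. Complex (W (x n)) y) \<longlonglongrightarrow> Complex (W t) y"
      unfolding Complex_eq by (intro tendsto_intros)
    then have "(\<lambda>n. f ((\<eta> \<circ> x) n)) \<longlonglongrightarrow> f (\<eta> t)"
      using x t by (simp add: f\<eta>)
    moreover have "(\<eta> \<circ> x) n \<in> \<Omega>" for n using x by (simp add: free)
    moreover have "0 \<le> t" using t by simp
    ultimately show "(\<eta> \<circ> x) \<longlonglongrightarrow> \<eta> t"
      by (intro preimages_converge[OF assms(1) _ _ unique])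
  qed
  moreover have ev: "\<forall>\<^sub>F t in at_top. 0 < Im (\<eta> t) \<and> Im (f (\<eta> t)) = y"
    using eventually_gt_at_top[of 0] by eventually_elim (simp add: \<eta>)
  moreover have top: "filterlim (\<lambda>t. Re (f (\<eta> t))) at_top at_top"
    by (rule filterlim_cong[OF refl refl, THEN iffD1, OF _ W(4)])
       (use eventually_gt_at_top[of 0] in eventually_elim, simp add: \<eta>)
  moreover have "0 \<le> Im (\<eta> t)" if "0 \<le> t" for t
    using free[OF that] by (simp add: free_points_def)
  moreover have "0 \<le> (y - pole_height j) / c j" "(y - pole_height j) / c j \<le> pi"
    using assms(3) by (auto simp: approach_height_def field_simps)
  ultimately show ?thesis
    unfolding converges_to_real_by_angle_def \<eta>_def[symmetric]
    by (intro conjI exI[of _ "p j"] approach_pole[OF assms(1,3) ev top]) (simp_all add: \<eta>)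
qed


section \<open>Critical points on the real axis\<close>

definition field :: "real \<Rightarrow> real" where
  "field x = (\<Sum>i\<in>I. c i / (x - p i))"

lemma real_free_point: "of_real x \<in> \<Omega> \<longleftrightarrow> (\<forall>i\<in>I. x \<noteq> p i)"
  by (auto simp: free_points_def)

lemma Re_log_pot_real:
  assumes "of_real x \<in> \<Omega>"
  shows "Re (f (of_real x)) = (\<Sum>i\<in>I. c i * ln \<bar>x - p i\<bar>)"
  unfolding Re_log_pot[OF assms] by (simp flip: of_real_diff)

lemma Re_log_pot_real_derivative:
  assumes "of_real x \<in> \<Omega>"
  shows "((\<lambda>x. Re (f (of_real x))) has_real_derivative field x) (at x)"
proof -
  \<comment> \<open>The square avoids a case distinction on the side of the pole.\<close>
  have "((\<lambda>x. ln ((x - a)\<^sup>2) / 2) has_real_derivative 1 / (x - a)) (at x)" if "x \<noteq> a" for a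
  proof -
    have "((\<lambda>x. (x - a)\<^sup>2) has_real_derivative 2 * (x - a)) (at x)"
      by (auto intro!: derivative_eq_intros)
    moreover have "0 < (x - a)\<^sup>2" using that by simp
    ultimately have "((\<lambda>x. ln ((x - a)\<^sup>2) / 2) has_real_derivative
        1 / (x - a)\<^sup>2 * (2 * (x - a)) / 2) (at x)"
      by (intro DERIV_cdivide DERIV_ln_divide[THEN DERIV_chain2])
    moreover have "1 / u\<^sup>2 * (2 * u) / 2 = 1 / u" if "u \<noteq> 0" for u :: real
      using that by (simp add: power2_eq_square)
    then have "1 / (x - a)\<^sup>2 * (2 * (x - a)) / 2 = 1 / (x - a)"
      using that by (metis right_minus_eq)
    ultimately show ?thesis by (simp only:)
  qed
  then have "((\<lambda>x. \<Sum>i\<in>I. c i * (ln ((x - p i)\<^sup>2) / 2)) has_real_derivative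
          (\<Sum>i\<in>I. c i * (1 / (x - p i)))) (at x)"
    using assms by (intro DERIV_sum DERIV_cmult) (auto simp: real_free_point)
  then have "((\<lambda>x. \<Sum>i\<in>I. c i * (ln ((x - p i)\<^sup>2) / 2)) has_real_derivative field x) (at x)"
    by (simp add: field_def)
  moreover have "\<forall>\<^sub>F u in nhds x. (\<Sum>i\<in>I. c i * (ln ((u - p i)\<^sup>2) / 2)) = Re (f (of_real u))"
  proof -
    have "\<forall>\<^sub>F u in nhds x. \<forall>i\<in>I. u \<noteq> p i"
      using assms finite_I by (intro eventually_ball_finite) (auto simp: real_free_point intro!: t1_space_nhds)
    then show ?thesis
    proof eventually_elim
      case (elim u)
      have "ln ((u - p i)\<^sup>2) / 2 = ln \<bar>u - p i\<bar>" if "i \<in> I" for i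
        using ln_realpow[of "\<bar>u - p i\<bar>" 2] elim that by simp
      then show ?case using elim by (simp add: Re_log_pot_real real_free_point)
    qed
  qed
  ultimately show ?thesis
    by (subst (asm) DERIV_cong_ev[OF refl _ refl]) simp_all
qed

text \<open>Rolle's argument: the potential has an interior minimum.\<close>

lemma critical_point_in_valley:
  assumes "x1 < x0" "x0 < x2" and free: "\<And>x. x1 \<le> x \<Longrightarrow> x \<le> x2 \<Longrightarrow> of_real x \<in> \<Omega>"
    and "Re (f (of_real x0)) < Re (f (of_real x1))" "Re (f (of_real x0)) < Re (f (of_real x2))"
  obtains \<xi> where "x1 < \<xi>" "\<xi> < x2" "field \<xi> = 0"
proof -
  define V where "V x = Re (f (of_real x))" for x
  have D: "(V has_real_derivative field x) (at x)" if "x1 \<le> x" "x \<le> x2" for x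
    using Re_log_pot_real_derivative[OF free[OF that]] by (simp add: V_def [abs_def])
  have "continuous_on {x1..x2} V"
    using D by (intro continuous_at_imp_continuous_on) (use DERIV_isCont in force)
  then obtain \<xi> where \<xi>: "\<xi> \<in> {x1..x2}" "\<And>x. x \<in> {x1..x2} \<Longrightarrow> V \<xi> \<le> V x"
    using continuous_attains_inf[of "{x1..x2}" V] assms(1,2) by auto
  have "\<xi> \<noteq> x1" "\<xi> \<noteq> x2" using \<xi>(2)[of x0] assms by (auto simp: V_def)
  then have in1: "x1 < \<xi>" "\<xi> < x2" using \<xi>(1) by auto
  have "field \<xi> = 0"
  proof (rule DERIV_local_min[OF D])
    show "0 < min (\<xi> - x1) (x2 - \<xi>)" using in1 by simp
    show "\<forall>y. \<bar>\<xi> - y\<bar> < min (\<xi> - x1) (x2 - \<xi>) \<longrightarrow> V \<xi> \<le> V y"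
      by (intro allI impI \<xi>(2)) (auto simp: abs_if split: if_splits)
  qed (use in1 in auto)
  with in1 that show ?thesis by blast
qed

lemma high_right_of_pole:
  assumes "i \<in> I" "c i < 0" "p i < x0" "\<And>x. p i < x \<Longrightarrow> x \<le> x0 \<Longrightarrow> of_real x \<in> \<Omega>"
  obtains x where "p i < x" "x < x0" "R < Re (f (of_real x))"
proof -
  have "filterlim (\<lambda>x. Re (f (of_real x))) at_top (at_right (p i))"
    by (rule Re_at_negative_pole[OF assms(1,2)])
       (use assms(3,4) in \<open>auto intro!: tendsto_of_real eventually_at_rightI[of _ x0]\<close>)
  then have "\<forall>\<^sub>F x in at_right (p i). R < Re (f (of_real x))"
    by (simp add: filterlim_at_top_dense)
  moreover have "\<forall>\<^sub>F x in at_right (p i). p i < x \<and> x < x0"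
    by (rule eventually_at_rightI[of _ x0]) (use assms(3) in auto)
  ultimately have "\<forall>\<^sub>F x in at_right (p i). p i < x \<and> x < x0 \<and> R < Re (f (of_real x))"
    by eventually_elim auto
  then show ?thesis
    using that eventually_happens trivial_limit_at_right_real by blast
qed

lemma high_left_of_pole:
  assumes "i \<in> I" "c i < 0" "x0 < p i" "\<And>x. x0 \<le> x \<Longrightarrow> x < p i \<Longrightarrow> of_real x \<in> \<Omega>"
  obtains x where "x0 < x" "x < p i" "R < Re (f (of_real x))"
proof -
  have "filterlim (\<lambda>x. Re (f (of_real x))) at_top (at_left (p i))"
    by (rule Re_at_negative_pole[OF assms(1,2)])
       (use assms(3,4) in \<open>auto intro!: tendsto_of_real eventually_at_leftI[of x0]\<close>)
  then have "\<forall>\<^sub>F x in at_left (p i). R < Re (f (of_real x))"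
    by (simp add: filterlim_at_top_dense)
  moreover have "\<forall>\<^sub>F x in at_left (p i). x0 < x \<and> x < p i"
    by (rule eventually_at_leftI[of x0]) (use assms(3) in auto)
  ultimately have "\<forall>\<^sub>F x in at_left (p i). x0 < x \<and> x < p i \<and> R < Re (f (of_real x))"
    by eventually_elim auto
  then show ?thesis
    using that eventually_happens trivial_limit_at_left_real by blast
qed

lemma critical_point_between_negative:
  assumes "i \<in> I" "c i < 0" "j \<in> I" "c j < 0" "p i < p j"
    and free: "\<And>x. p i < x \<Longrightarrow> x < p j \<Longrightarrow> of_real x \<in> \<Omega>"
  obtains \<xi> where "p i < \<xi>" "\<xi> < p j" "field \<xi> = 0"
proof -
  define x0 where "x0 = (p i + p j) / 2"
  have x0: "p i < x0" "x0 < p j" using assms(5) by (auto simp: x0_def)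
  obtain x1 where x1: "p i < x1" "x1 < x0" "Re (f (of_real x0)) < Re (f (of_real x1))"
    using high_right_of_pole[OF assms(1,2) x0(1)] free x0 by (metis le_less_trans)
  obtain x2 where x2: "x0 < x2" "x2 < p j" "Re (f (of_real x0)) < Re (f (of_real x2))"
    using high_left_of_pole[OF assms(3,4) x0(2)] free x0 by (metis less_le_trans)
  obtain \<xi> where "x1 < \<xi>" "\<xi> < x2" "field \<xi> = 0"
    by (rule critical_point_in_valley[OF x1(2) x2(1) _ x1(3) x2(3)])
       (use x1 x2 free in auto)
  then show ?thesis using x1 x2 by (intro that[of \<xi>]) auto
qed

lemma critical_point_between_positive:
  assumes "i \<in> I" "0 < c i" "j \<in> I" "0 < c j" "p i < p j"
    and free: "\<And>x. p i < x \<Longrightarrow> x < p j \<Longrightarrow> of_real x \<in> \<Omega>"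
  obtains \<xi> where "p i < \<xi>" "\<xi> < p j" "field \<xi> = 0"
proof -
  interpret minus: charges I "\<lambda>i. - c i" p by (rule uminus_charges)
  obtain \<xi> where "p i < \<xi>" "\<xi> < p j" "minus.field \<xi> = 0"
    by (rule minus.critical_point_between_negative[OF assms(1) _ assms(3)]) (use assms in auto)
  then show ?thesis
    using that by (simp add: field_def minus.field_def sum_negf)
qed

lemma critical_point_beyond_last:
  assumes "i \<in> I" "c i < 0" "0 < net_charge" and free: "\<And>x. p i < x \<Longrightarrow> of_real x \<in> \<Omega>"
  obtains \<xi> where "p i < \<xi>" "field \<xi> = 0"
proof -
  define x0 where "x0 = p i + 1"
  have x0: "p i < x0" by (simp add: x0_def)
  obtain x1 where x1: "p i < x1" "x1 < x0" "Re (f (of_real x0)) < Re (f (of_real x1))"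
    using high_right_of_pole[OF assms(1,2) x0] free by metis
  obtain B where B: "\<And>z. z \<in> \<Omega> \<Longrightarrow> B \<le> cmod z \<Longrightarrow> Re (f (of_real x0)) < Re (f z)"
    using Re_far_away[OF assms(3)] by metis
  define x2 where "x2 = max (x0 + 1) \<bar>B\<bar>"
  have x2: "x0 < x2" "Re (f (of_real x0)) < Re (f (of_real x2))"
    using B[of "of_real x2"] free[of x2] x0 by (auto simp: x2_def)
  obtain \<xi> where "x1 < \<xi>" "field \<xi> = 0"
    by (rule critical_point_in_valley[OF x1(2) x2(1) _ x1(3) x2(2)])
       (use x1 free in auto)
  then show ?thesis using x1 by (intro that[of \<xi>]) auto
qed

end

section \<open>Positive charges to the left of negative charges\<close>

locale separated_charges = charges I c p for I :: "'i set" and c p :: "'i \<Rightarrow> real" +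
  fixes K :: real
  assumes separated: "i \<in> I \<Longrightarrow> 0 < c i \<and> p i \<le> K \<or> c i < 0 \<and> K < p i"
    and pole_at_K: "K \<in> p ` I" and other_pole: "\<exists>i\<in>I. p i \<noteq> K"
begin

lemma charge_side: "i \<in> I \<Longrightarrow> c i * (p i - K) \<le> 0" "i \<in> I \<Longrightarrow> p i \<noteq> K \<Longrightarrow> c i * (p i - K) < 0"
  using separated[of i] by (auto simp: mult_le_0_iff mult_less_0_iff)

text \<open>Since \<open>(z - K) / (z - p) = 1 + (p - K) / (z - p)\<close>, each summand has an imaginary part with the
  sign of \<open>- c (p - K)\<close>, which separation makes nonnegative.\<close>

lemma Im_log_derivative_pos:
  assumes "0 < Im z"
  shows "0 < Im ((z - of_real K) * (\<Sum>i\<in>I. of_real (c i) / (z - of_real (p i))))"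
proof -
  have nz: "z - of_real (p i) \<noteq> 0" for i using assms by (auto simp: complex_eq_iff)
  have part: "Im ((z - of_real K) * (of_real (c i) / (z - of_real (p i))))
      = - (c i * (p i - K)) * (Im z / (cmod (z - of_real (p i)))\<^sup>2)" for i
    using nz[of i] unfolding cmod_power2
    by (simp add: Im_divide power2_eq_square field_simps)
  have pos: "0 < Im z / (cmod (z - of_real (p i)))\<^sup>2" for i
    using assms nz[of i] by simp
  have "0 < (\<Sum>i\<in>I. - (c i * (p i - K)) * (Im z / (cmod (z - of_real (p i)))\<^sup>2))"
  proof -
    obtain i where i: "i \<in> I" "p i \<noteq> K" using other_pole by blast
    show ?thesis
    proof (rule sum_pos2[OF finite_I i(1)])
      show "0 < - (c i * (p i - K)) * (Im z / (cmod (z - of_real (p i)))\<^sup>2)"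
        using charge_side(2)[OF i] pos[of i] by (intro mult_pos_pos) auto
      show "0 \<le> - (c l * (p l - K)) * (Im z / (cmod (z - of_real (p l)))\<^sup>2)" if "l \<in> I" for l
        using charge_side(1)[OF that] less_imp_le[OF pos[of l]] by (intro mult_nonneg_nonneg) auto
    qed
  qed
  then show ?thesis
    unfolding sum_distrib_left Im_sum part .
qed

text \<open>Univalence by the Noshiro-Warschawski argument in the coordinate \<open>Ln (z - K)\<close>. The second
  point may lie on the boundary, so this also shows that a slit tip is not an interior value.\<close>

lemma log_pot_eq_imp_eq:
  assumes "0 < Im z1" "z2 \<in> \<Omega>" "f z1 = f z2"
  shows "z1 = z2"
proof (rule ccontr)
  assume "z1 \<noteq> z2"
  have z2: "0 \<le> Im z2" "z2 - of_real K \<noteq> 0"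
    using assms(2) pole_at_K by (auto simp: free_points_def)
  have z1: "z1 - of_real K \<noteq> 0" using assms(1) by (auto simp: complex_eq_iff)
  \<comment> \<open>The path \<open>\<gamma>\<close> is the image of a straight segment in the strip \<open>0 < Im u < \<pi>\<close>, which reaches the boundary only at
    its end; \<open>g\<close> is strictly increasing along it.\<close>
  define u where "u = Ln (z1 - of_real K)"
  define d where "d = Ln (z2 - of_real K) - u"
  define \<gamma> where "\<gamma> s = of_real K + exp (u + s * d)" for s :: complex
  have ends: "\<gamma> 0 = z1" "\<gamma> 1 = z2"
    using z1 z2(2) by (auto simp: \<gamma>_def u_def d_def)
  have "d \<noteq> 0" using ends \<open>z1 \<noteq> z2\<close> by (auto simp: \<gamma>_def)
  have up: "0 < Im (\<gamma> (of_real s))" if "0 \<le> s" "s < 1" for s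
  proof -
    have 1: "0 < Im u" "Im u < pi"
      using Im_Ln_pos_lt[OF z1] assms(1) by (auto simp: u_def)
    have 2: "0 \<le> Im (u + d)" "Im (u + d) \<le> pi"
      using Im_Ln_pos_le[OF z2(2)] z2(1) by (auto simp: d_def)
    have e: "Im (u + of_real s * d) = (1 - s) * Im u + s * Im (u + d)"
      by (simp add: algebra_simps)
    have "0 < (1 - s) * Im u" "0 \<le> s * Im (u + d)"
      using that 1 2 by auto
    moreover have "(1 - s) * Im u < (1 - s) * pi" "s * Im (u + d) \<le> s * pi"
      using that 1 2 by (auto intro: mult_left_mono)
    ultimately have "0 < Im (u + of_real s * d)" "Im (u + of_real s * d) < pi"
      unfolding e by (auto simp: algebra_simps)
    then show ?thesis by (simp add: \<gamma>_def Im_exp sin_gt_zero)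
  qed
  have free: "\<gamma> (of_real s) \<in> \<Omega>" if "0 \<le> s" "s \<le> 1" for s
    using up[of s] that ends assms(2) by (cases "s = 1") (auto intro: free_points_upper)
  define g where "g s = Im (f (\<gamma> (of_real s)) * cnj d)" for s
  have cont_g: "continuous_on {0..1} g"
    unfolding g_def
    by (intro continuous_intros continuous_on_compose2[OF continuous_on_free])
       (use free in \<open>auto simp: \<gamma>_def [abs_def] intro!: continuous_intros\<close>)
  have deriv_g: "\<exists>y. (g has_real_derivative y) (at s) \<and> 0 < y" if s: "0 < s" "s < 1" for s
  proof -
    define z where "z = \<gamma> (of_real s)"
    define f' where "f' = (\<Sum>i\<in>I. of_real (c i) / (z - of_real (p i)))"
    have z: "0 < Im z" using up[of s] s by (simp add: z_def)
    have "(f has_field_derivative f') (at z within {z. 0 < Im z})"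
      unfolding f'_def
      by (rule DERIV_subset[OF log_pot_has_field_derivative]) (use z in \<open>auto intro: free_points_upper\<close>)
    then have "(f has_field_derivative f') (at z)"
      using z by (simp add: at_within_open[OF _ open_halfspace_Im_gt])
    moreover have "(\<gamma> has_field_derivative (z - of_real K) * d) (at (of_real s))"
      unfolding \<gamma>_def [abs_def] z_def by (auto intro!: derivative_eq_intros)
    ultimately have "((\<lambda>s. f (\<gamma> s)) has_field_derivative f' * ((z - of_real K) * d)) (at (of_real s))"
      unfolding z_def by (rule DERIV_chain2)
    then have "((\<lambda>s. f (\<gamma> s) * cnj d) has_field_derivative f' * ((z - of_real K) * d) * cnj d) (at (of_real s))"
      by (rule DERIV_cmult_right)
    then have "((\<lambda>s. f (\<gamma> (of_real s)) * cnj d) has_vector_derivative f' * ((z - of_real K) * d) * cnj d) (at s)"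
      by (rule has_vector_derivative_real_field)
    from bounded_linear.has_vector_derivative[OF bounded_linear_Im this]
    have "(g has_real_derivative Im (f' * ((z - of_real K) * d) * cnj d)) (at s)"
      by (simp add: g_def [abs_def] has_real_derivative_iff_has_vector_derivative)
    moreover have "0 < Im (f' * ((z - of_real K) * d) * cnj d)"
    proof -
      have "f' * ((z - of_real K) * d) * cnj d = of_real ((cmod d)\<^sup>2) * ((z - of_real K) * f')"
        by (simp add: complex_norm_square mult_ac del: of_real_power)
      then have "Im (f' * ((z - of_real K) * d) * cnj d) = (cmod d)\<^sup>2 * Im ((z - of_real K) * f')"
        by (simp only: Im_complex_of_real Re_complex_of_real times_complex.sel)
      then show ?thesis
        using Im_log_derivative_pos[OF z] \<open>d \<noteq> 0\<close> by (simp add: f'_def)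
    qed
    ultimately show ?thesis by blast
  qed
  have "g 0 < g 1"
    using zero_less_one deriv_g cont_g by (rule DERIV_pos_imp_increasing_open)
  then show False using assms(3) by (simp add: g_def ends[simplified])
qed

lemma inj_on_upper: "inj_on f {z. 0 < Im z}"
  using log_pot_eq_imp_eq[OF _ free_points_upper] by (simp add: inj_on_def)

text \<open>The real counterpart of \<open>Im_log_derivative_pos\<close>: each summand is a Pick function.\<close>

lemma log_field_strict_mono:
  assumes "x < x'" and gap: "\<And>i. i \<in> I \<Longrightarrow> p i < x \<or> x' < p i"
  shows "(x - K) * field x < (x' - K) * field x'"
proof -
  have diff: "(x' - K) * (c i / (x' - p i)) - (x - K) * (c i / (x - p i))
        = - (c i * (p i - K)) * ((x' - x) / ((x' - p i) * (x - p i)))" if "i \<in> I" for i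
  proof -
    have "x - p i \<noteq> 0" "x' - p i \<noteq> 0" using gap[OF that] assms(1) by auto
    then show ?thesis by (simp add: divide_simps) (simp add: algebra_simps)
  qed
  have pos: "0 < (x' - x) / ((x' - p i) * (x - p i))" if "i \<in> I" for i
  proof -
    have "0 < (x' - p i) * (x - p i)"
      using gap[OF that] assms(1) by (auto simp: zero_less_mult_iff)
    then show ?thesis using assms(1) by simp
  qed
  obtain i where i: "i \<in> I" "p i \<noteq> K" using other_pole by blast
  have "0 < (\<Sum>i\<in>I. (x' - K) * (c i / (x' - p i)) - (x - K) * (c i / (x - p i)))"
  proof (rule sum_pos2[OF finite_I i(1)])
    show "0 < (x' - K) * (c i / (x' - p i)) - (x - K) * (c i / (x - p i))"
      unfolding diff[OF i(1)] using charge_side(2)[OF i] pos[OF i(1)] by (intro mult_pos_pos) auto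
    show "0 \<le> (x' - K) * (c l / (x' - p l)) - (x - K) * (c l / (x - p l))" if "l \<in> I" for l
      unfolding diff[OF that] using charge_side(1)[OF that] less_imp_le[OF pos[OF that]]
      by (intro mult_nonneg_nonneg) auto
  qed
  then show ?thesis
    by (simp add: field_def sum_subtractf sum_distrib_left)
qed

lemma critical_point_unique:
  assumes "field x = 0" "field x' = 0" "\<And>i. i \<in> I \<Longrightarrow> p i < min x x' \<or> max x x' < p i"
  shows "x = x'"
proof (rule ccontr)
  assume "x \<noteq> x'"
  then have "(min x x' - K) * field (min x x') < (max x x' - K) * field (max x x')"
    by (intro log_field_strict_mono assms(3)) auto
  with assms(1,2) show False by (auto simp: min_def max_def split: if_splits)
qed

text \<open>\<open>(x - K) * field x\<close> changes sign from minus to plus at \<open>\<xi>\<close>. Whether this makes the critical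
  value a maximum or a minimum depends on the sign of \<open>x - K\<close>.\<close>

lemma critical_value_extremal:
  assumes "field \<xi> = 0" "x \<noteq> \<xi>" and gap: "\<And>i. i \<in> I \<Longrightarrow> p i < min x \<xi> \<or> max x \<xi> < p i"
  shows "x < K \<Longrightarrow> Re (f (of_real x)) < Re (f (of_real \<xi>))"
    and "K < x \<Longrightarrow> Re (f (of_real \<xi>)) < Re (f (of_real x))"
proof -
  define V where "V x = Re (f (of_real x))" for x
  have free: "of_real s \<in> \<Omega>" if "min x \<xi> \<le> s" "s \<le> max x \<xi>" for s
    using gap that by (force simp: real_free_point)
  have D: "(V has_real_derivative field s) (at s)" if "min x \<xi> \<le> s" "s \<le> max x \<xi>" for s
    using Re_log_pot_real_derivative[OF free[OF that]] by (simp add: V_def [abs_def])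
  have "min x \<xi> < max x \<xi>" using assms(2) by auto
  from MVT2[OF this D] obtain s where s: "min x \<xi> < s" "s < max x \<xi>"
    "V (max x \<xi>) - V (min x \<xi>) = (max x \<xi> - min x \<xi>) * field s" by auto
  have sK: "x < K \<longleftrightarrow> s < K" "K < x \<longleftrightarrow> K < s" "s \<noteq> K"
    using pole_at_K gap s(1,2) by (force split: if_splits simp: min_def max_def)+
  show "Re (f (of_real x)) < Re (f (of_real \<xi>))" if "x < K"
  proof (cases "x < \<xi>")
    case True
    have "(s - K) * field s < (\<xi> - K) * field \<xi>"
      by (rule log_field_strict_mono) (use True s gap in force)+
    then have "0 < field s" using assms(1) sK that by (simp add: mult_less_0_iff)
    then have "0 < (\<xi> - x) * field s" using True by simp
    then show ?thesis using s(3) True by (simp add: V_def)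
  next
    case False
    have "(\<xi> - K) * field \<xi> < (s - K) * field s"
      by (rule log_field_strict_mono) (use False s gap in force)+
    then have "field s < 0" using assms(1) sK that by (simp add: zero_less_mult_iff)
    then have "(x - \<xi>) * field s < 0" using False assms(2) by (simp add: mult_less_0_iff)
    then show ?thesis using s(3) False by (simp add: V_def)
  qed
  show "Re (f (of_real \<xi>)) < Re (f (of_real x))" if "K < x"
  proof (cases "x < \<xi>")
    case True
    have "(s - K) * field s < (\<xi> - K) * field \<xi>"
      by (rule log_field_strict_mono) (use True s gap in force)+
    then have "field s < 0" using assms(1) sK that by (simp add: mult_less_0_iff)
    then have "(\<xi> - x) * field s < 0" using True by (simp add: mult_less_0_iff)
    then show ?thesis using s(3) True by (simp add: V_def)
  next
    case False
    have "(\<xi> - K) * field \<xi> < (s - K) * field s"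
      by (rule log_field_strict_mono) (use False s gap in force)+
    then have "0 < field s" using assms(1) sK that by (simp add: zero_less_mult_iff)
    then have "0 < (x - \<xi>) * field s" using False assms(2) by simp
    then show ?thesis using s(3) False by (simp add: V_def)
  qed
qed

end

section \<open>Concavity of the extremal value between moving poles\<close>

definition geo_mean :: "real \<Rightarrow> real \<Rightarrow> real \<Rightarrow> real" where
  "geo_mean s x y = x powr (1 - s) * y powr s"

text \<open>Hoelder's inequality for two summands, obtained from weighted arithmetic-geometric means of the
  ratios to the sums.\<close>

lemma geo_mean_superadditive:
  assumes "0 \<le> s" "s \<le> 1" "0 < x" "0 < y" "0 \<le> x'" "0 \<le> y'"
  shows "geo_mean s x y + geo_mean s x' y' \<le> geo_mean s (x + x') (y + y')"
proof -
  have X: "0 < x + x'" "0 < y + y'" using assms by auto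
  have ratio: "geo_mean s v w \<le> ((1 - s) * (v / (x + x')) + s * (w / (y + y'))) * geo_mean s (x + x') (y + y')"
    if "0 \<le> v" "0 \<le> w" for v w
  proof (cases "v = 0 \<or> w = 0")
    case True
    then show ?thesis
      using X assms(1,2) that by (auto simp: geo_mean_def intro!: mult_nonneg_nonneg add_nonneg_nonneg)
  next
    case False
    then have vw: "0 < v" "0 < w" using that by auto
    have "(v / (x + x')) powr (1 - s) * (w / (y + y')) powr s
        \<le> (1 - s) * (v / (x + x')) + s * (w / (y + y'))"
      using assms(1,2) vw X by (intro Youngs_inequality_0) auto
    then have "((v / (x + x')) powr (1 - s) * (w / (y + y')) powr s) * geo_mean s (x + x') (y + y')
        \<le> ((1 - s) * (v / (x + x')) + s * (w / (y + y'))) * geo_mean s (x + x') (y + y')"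
      by (rule mult_right_mono) (simp add: geo_mean_def)
    moreover have "((v / (x + x')) powr (1 - s) * (w / (y + y')) powr s) * geo_mean s (x + x') (y + y')
        = geo_mean s v w"
      using vw X by (simp add: geo_mean_def powr_divide)
    ultimately show ?thesis by simp
  qed
  have "geo_mean s x y + geo_mean s x' y' \<le>
      ((1 - s) * (x / (x + x')) + s * (y / (y + y'))) * geo_mean s (x + x') (y + y')
    + ((1 - s) * (x' / (x + x')) + s * (y' / (y + y'))) * geo_mean s (x + x') (y + y')"
    using assms by (intro add_mono ratio) auto
  also have "\<dots> = ((1 - s) * ((x + x') / (x + x')) + s * ((y + y') / (y + y'))) * geo_mean s (x + x') (y + y')"
    by (simp only: add_divide_distrib) (simp add: algebra_simps)
  also have "\<dots> = geo_mean s (x + x') (y + y')" using X by simp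
  finally show ?thesis .
qed

lemma geo_mean_pos: "0 < x \<Longrightarrow> 0 < y \<Longrightarrow> 0 < geo_mean s x y"
  by (simp add: geo_mean_def)

lemma ln_geo_mean: "0 < x \<Longrightarrow> 0 < y \<Longrightarrow> ln (geo_mean s x y) = (1 - s) * ln x + s * ln y"
  by (simp add: geo_mean_def ln_mult ln_powr)

text \<open>In the variables \<open>ln x\<close>, \<open>ln a\<close> the function \<open>ln (x - a)\<close> is jointly concave.\<close>

lemma geo_mean_diff:
  assumes "0 \<le> s" "s \<le> 1" "0 \<le> a" "a < x" "0 \<le> b" "b < y"
  shows "geo_mean s a b < geo_mean s x y"
    and "(1 - s) * ln (x - a) + s * ln (y - b) \<le> ln (geo_mean s x y - geo_mean s a b)"
proof -
  have *: "geo_mean s (x - a) (y - b) + geo_mean s a b \<le> geo_mean s x y"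
    using geo_mean_superadditive[of s "x - a" "y - b" a b] assms by simp
  have pos: "0 < geo_mean s (x - a) (y - b)" using assms by (intro geo_mean_pos) auto
  with * show "geo_mean s a b < geo_mean s x y" by linarith
  have "ln (geo_mean s (x - a) (y - b)) \<le> ln (geo_mean s x y - geo_mean s a b)"
    using * pos by simp
  then show "(1 - s) * ln (x - a) + s * ln (y - b) \<le> ln (geo_mean s x y - geo_mean s a b)"
    using assms by (simp add: ln_geo_mean)
qed

text \<open>In the variables \<open>ln x\<close>, \<open>ln a\<close> the function \<open>ln (x + a)\<close> is jointly convex.\<close>

lemma geo_mean_add:
  assumes "0 \<le> s" "s \<le> 1" "0 \<le> a" "0 < x" "0 \<le> b" "0 < y"
  shows "ln (geo_mean s x y + geo_mean s a b) \<le> (1 - s) * ln (x + a) + s * ln (y + b)"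
proof -
  have "0 < geo_mean s x y + geo_mean s a b"
    using geo_mean_pos[of x y s] assms by (simp add: geo_mean_def add_pos_nonneg)
  then have "ln (geo_mean s x y + geo_mean s a b) \<le> ln (geo_mean s (x + a) (y + b))"
    using geo_mean_superadditive[of s x y a b] assms by simp
  then show ?thesis using assms by (simp add: ln_geo_mean)
qed

lemma geo_mean_exp:
  assumes "0 \<le> a"
  shows "geo_mean s (a * exp (- \<theta> * t)) (a * exp (- \<theta> * t')) = a * exp (- \<theta> * ((1 - s) * t + s * t'))"
proof (cases "a = 0")
  case False
  then have "a powr (1 - s) * a powr s = a" using assms by (simp flip: powr_add)
  then have "geo_mean s (a * exp (- \<theta> * t)) (a * exp (- \<theta> * t'))
      = a * (exp ((1 - s) * (- \<theta> * t)) * exp (s * (- \<theta> * t')))"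
    using assms by (simp add: geo_mean_def powr_mult exp_powr_real mult_ac)
  then show ?thesis by (simp add: algebra_simps flip: exp_add)
qed (simp add: geo_mean_def)

text \<open>The difference quotients of a concave function from a fixed point decrease, so they converge as
  soon as they are bounded below, and each of them is at least the limit.\<close>

lemma concave_slope:
  fixes g :: "real \<Rightarrow> real"
  assumes "concave_on S g" "{0..} \<subseteq> S" "\<And>t. 0 \<le> t \<Longrightarrow> g 0 + m * t \<le> g t"
  shows "\<exists>L. ((\<lambda>t. g t / t) \<longlongrightarrow> L) at_top \<and> (\<forall>t\<ge>0. g 0 + L * t \<le> g t) \<and> m \<le> L"
proof -
  define q where "q t = (g t - g 0) / t" for t
  have anti: "q t \<le> q s" if "0 < s" "s \<le> t" for s t
  proof -
    have "(1 - s / t) * g 0 + s / t * g t \<le> g ((1 - s / t) *\<^sub>R 0 + (s / t) *\<^sub>R t)"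
      using that assms(2) by (intro concave_onD[OF assms(1)]) auto
    then have "g 0 + s * q t \<le> g s" using that by (simp add: q_def field_simps)
    then show ?thesis using that by (simp add: q_def[of s] field_simps)
  qed
  have lower: "m \<le> q t" if "0 < t" for t
    using assms(3)[of t] that by (simp add: q_def field_simps)
  define L where "L = Inf (q ` {0<..})"
  have bdd: "bdd_below (q ` {0<..})" using lower by (intro bdd_belowI2) auto
  have L: "L \<le> q t" if "0 < t" for t
    unfolding L_def using bdd that by (intro cINF_lower) auto
  have "(q \<longlongrightarrow> L) at_top"
  proof (rule order_tendstoI)
    fix a assume "a < L"
    show "\<forall>\<^sub>F t in at_top. a < q t"
      by (rule eventually_mono[OF eventually_gt_at_top[of 0]]) (use L \<open>a < L\<close> in force)
  next
    fix a assume "L < a"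
    then obtain t0 where t0: "0 < t0" "q t0 < a"
      unfolding L_def using cINF_less_iff[OF _ bdd] by auto
    show "\<forall>\<^sub>F t in at_top. q t < a"
      by (rule eventually_mono[OF eventually_ge_at_top[of t0]]) (use anti t0 in force)
  qed
  then have "((\<lambda>t. q t + g 0 / t) \<longlongrightarrow> L + 0) at_top"
    by (intro tendsto_add tendsto_divide_0[OF tendsto_const] filterlim_at_top_imp_at_infinity filterlim_ident)
  then have "((\<lambda>t. g t / t) \<longlongrightarrow> L) at_top"
    by (simp add: q_def diff_divide_distrib)
  moreover have "g 0 + L * t \<le> g t" if "0 \<le> t" for t
    using L[of t] that by (cases "t = 0") (auto simp: q_def field_simps)
  moreover have "m \<le> L" unfolding L_def using lower by (intro cINF_greatest) auto
  ultimately show ?thesis by blast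
qed

text \<open>The potential as a function of the distance \<open>u = |x - K|\<close>: the poles \<open>a i\<close> lie on the same side of
  \<open>K\<close> as \<open>x\<close>, the poles \<open>a' j\<close> on the other side. This form is common to \<open>Re h\<close> on the left of \<open>K\<close> and
  \<open>- Re h\<close> on the right.\<close>

definition gap_pot :: "'i set \<Rightarrow> ('i \<Rightarrow> real) \<Rightarrow> ('i \<Rightarrow> real) \<Rightarrow> 'j set \<Rightarrow> ('j \<Rightarrow> real) \<Rightarrow> ('j \<Rightarrow> real) \<Rightarrow> real \<Rightarrow> real" where
  "gap_pot A \<beta> a B \<beta>' a' u = (\<Sum>i\<in>A. \<beta> i * ln \<bar>u - a i\<bar>) - (\<Sum>j\<in>B. \<beta>' j * ln (u + a' j))"

text \<open>The distance of each pole from \<open>K\<close> is an exponential function of time, and \<open>r t\<close> maximizes the potential in the gap between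
  the poles marked \<open>below\<close> and the others. The open time domain \<open>T\<close> reaches beyond \<open>0\<close> in order that
  concavity yields continuity at \<open>0\<close>.\<close>

locale moving_gap =
  fixes A :: "'i set" and \<beta> a \<theta> :: "'i \<Rightarrow> real" and B :: "'j set" and \<beta>' a' \<theta>' :: "'j \<Rightarrow> real"
    and below :: "'i \<Rightarrow> bool" and T :: "real set" and r :: "real \<Rightarrow> real"
  assumes weights: "\<And>i. i \<in> A \<Longrightarrow> 0 \<le> \<beta> i" "\<And>j. j \<in> B \<Longrightarrow> 0 \<le> \<beta>' j"
    and positions: "\<And>i. i \<in> A \<Longrightarrow> 0 \<le> a i" "\<And>j. j \<in> B \<Longrightarrow> 0 \<le> a' j"
    and T: "open T" "convex T" "{0..} \<subseteq> T"
    and r_pos: "\<And>t. t \<in> T \<Longrightarrow> 0 < r t"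
    and r_gap: "\<And>t i. t \<in> T \<Longrightarrow> i \<in> A \<Longrightarrow>
        (if below i then a i * exp (- \<theta> i * t) < r t else r t < a i * exp (- \<theta> i * t))"
    and r_max: "\<And>t u. t \<in> T \<Longrightarrow> 0 < u \<Longrightarrow>
        (\<And>i. i \<in> A \<Longrightarrow> (if below i then a i * exp (- \<theta> i * t) < u else u < a i * exp (- \<theta> i * t))) \<Longrightarrow>
        gap_pot A \<beta> (\<lambda>i. a i * exp (- \<theta> i * t)) B \<beta>' (\<lambda>j. a' j * exp (- \<theta>' j * t)) u
        \<le> gap_pot A \<beta> (\<lambda>i. a i * exp (- \<theta> i * t)) B \<beta>' (\<lambda>j. a' j * exp (- \<theta>' j * t)) (r t)"
begin

definition top_value :: "real \<Rightarrow> real" where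
  "top_value t = gap_pot A \<beta> (\<lambda>i. a i * exp (- \<theta> i * t)) B \<beta>' (\<lambda>j. a' j * exp (- \<theta>' j * t)) (r t)"

text \<open>The geometric mean of two admissible positions at times \<open>x\<close>, \<open>y\<close> is admissible at the mean time,
  and the potential there is at least the mean of the two values.\<close>

lemma top_value_concave: "concave_on T top_value"
proof (rule concave_on_linorderI)
  fix s x y assume s: "0 < s" "s < (1::real)" and xy: "x \<in> T" "y \<in> T"
  define t where "t = (1 - s) * x + s * y"
  define u where "u = geo_mean s (r x) (r y)"
  have t: "t \<in> T" unfolding t_def using convexD[OF T(2), of x y "1 - s" s] s xy by simp
  have u: "0 < u" unfolding u_def using r_pos xy by (intro geo_mean_pos) auto
  let ?a = "\<lambda>t i. a i * exp (- \<theta> i * t)" and ?a' = "\<lambda>t j. a' j * exp (- \<theta>' j * t)"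
  have a_t: "?a t i = geo_mean s (?a x i) (?a y i)" if "i \<in> A" for i
    unfolding t_def using geo_mean_exp[OF positions(1)[OF that]] by (rule sym)
  have a'_t: "?a' t j = geo_mean s (?a' x j) (?a' y j)" if "j \<in> B" for j
    unfolding t_def using geo_mean_exp[OF positions(2)[OF that]] by (rule sym)
  have gap: "if below i then ?a t i < u else u < ?a t i" if "i \<in> A" for i
    using r_gap[OF xy(1) that] r_gap[OF xy(2) that] positions(1)[OF that] s
      less_imp_le[OF r_pos[OF xy(1)]] less_imp_le[OF r_pos[OF xy(2)]]
    unfolding a_t[OF that] u_def by (auto intro: geo_mean_diff(1))
  have below_le: "(1 - s) * ln \<bar>r x - ?a x i\<bar> + s * ln \<bar>r y - ?a y i\<bar> \<le> ln \<bar>u - ?a t i\<bar>"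
    if "i \<in> A" for i
  proof (cases "below i")
    case True
    then show ?thesis
      using r_gap[OF xy(1) that] r_gap[OF xy(2) that] positions(1)[OF that] s gap[OF that]
        geo_mean_diff(2)[of s "?a x i" "r x" "?a y i" "r y"]
      unfolding a_t[OF that] u_def by simp
  next
    case False
    have "(1 - s) * ln (?a x i - r x) + s * ln (?a y i - r y) \<le> ln (?a t i - u)"
      using r_gap[OF xy(1) that] r_gap[OF xy(2) that] s False
        less_imp_le[OF r_pos[OF xy(1)]] less_imp_le[OF r_pos[OF xy(2)]]
      unfolding a_t[OF that] u_def by (intro geo_mean_diff(2)) auto
    then show ?thesis
      using r_gap[OF xy(1) that] r_gap[OF xy(2) that] gap[OF that] False by (simp add: abs_if)
  qed
  have add_le: "ln (u + ?a' t j) \<le> (1 - s) * ln (r x + ?a' x j) + s * ln (r y + ?a' y j)" if "j \<in> B" for j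
    unfolding a'_t[OF that] u_def
    using s positions(2)[OF that] r_pos xy by (intro geo_mean_add) auto
  have "(1 - s) * top_value x + s * top_value y
      = (\<Sum>i\<in>A. \<beta> i * ((1 - s) * ln \<bar>r x - ?a x i\<bar> + s * ln \<bar>r y - ?a y i\<bar>))
      - (\<Sum>j\<in>B. \<beta>' j * ((1 - s) * ln (r x + ?a' x j) + s * ln (r y + ?a' y j)))"
    by (simp add: top_value_def gap_pot_def algebra_simps sum.distrib sum_distrib_left sum_subtractf)
  also have "\<dots> \<le> (\<Sum>i\<in>A. \<beta> i * ln \<bar>u - ?a t i\<bar>) - (\<Sum>j\<in>B. \<beta>' j * ln (u + ?a' t j))"
    by (intro diff_mono sum_mono mult_left_mono below_le add_le weights)
  also have "\<dots> = gap_pot A \<beta> (?a t) B \<beta>' (?a' t) u" by (simp add: gap_pot_def)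
  also have "\<dots> \<le> top_value t"
    unfolding top_value_def by (rule r_max[OF t u gap])
  finally show "(1 - s) * top_value x + s * top_value y \<le> top_value ((1 - s) *\<^sub>R x + s *\<^sub>R y)"
    by (simp add: t_def)
qed (rule T(2))

lemma top_value_continuous: "continuous_on {0..} top_value"
proof -
  have "convex_on T (\<lambda>t. - top_value t)"
    using top_value_concave by (simp add: concave_on_def)
  then have "continuous_on T (\<lambda>t. - top_value t)"
    by (rule convex_on_continuous[OF T(1)])
  then have "continuous_on T (\<lambda>t. - (- top_value t))" by (rule continuous_on_minus)
  then show ?thesis using T(3) by (auto intro: continuous_on_subset)
qed

text \<open>Test position: the initial maximizer, carried along with the exponent \<open>\<sigma>\<close>. If the poles below move
  at least as fast and the poles above at most as fast, its distance to each pole on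
  the same side decays at most like \<open>exp (- \<sigma> t)\<close>, and on the other side no distance grows. A pole at \<open>K\<close> itself (\<open>a i = 0\<close>) does not move, whatever its exponent.\<close>

lemma top_value_lower_bound:
  assumes "0 \<le> \<sigma>" "\<And>i. i \<in> A \<Longrightarrow> below i \<Longrightarrow> a i = 0 \<or> \<sigma> \<le> \<theta> i"
    and "\<And>i. i \<in> A \<Longrightarrow> \<not> below i \<Longrightarrow> \<theta> i \<le> \<sigma>"
    and "\<And>j. j \<in> B \<Longrightarrow> 0 \<le> \<theta>' j" "0 \<le> t"
  shows "top_value 0 - (\<Sum>i\<in>A. \<beta> i) * \<sigma> * t \<le> top_value t"
proof -
  let ?a = "\<lambda>t i. a i * exp (- \<theta> i * t)" and ?a' = "\<lambda>t j. a' j * exp (- \<theta>' j * t)"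
  define u where "u = r 0 * exp (- \<sigma> * t)"
  have T0: "0 \<in> T" "t \<in> T" using T(3) assms(5) by auto
  have r0: "0 < r 0" by (rule r_pos[OF T0(1)])
  have u: "0 < u" using r0 by (simp add: u_def)
  have dist: "if below i then (r 0 - a i) * exp (- \<sigma> * t) \<le> u - ?a t i \<and> a i < r 0
      else (a i - r 0) * exp (- \<sigma> * t) \<le> ?a t i - u \<and> r 0 < a i" if "i \<in> A" for i
  proof (cases "below i")
    case True
    then have "a i * exp (- \<theta> i * t) \<le> a i * exp (- \<sigma> * t)"
      using assms(2)[OF that True] positions(1)[OF that] assms(5)
      by (cases "a i = 0") (auto intro!: mult_left_mono mult_right_mono)
    then show ?thesis using True r_gap[OF T0(1) that] by (simp add: u_def algebra_simps)
  next
    case False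
    then have "a i * exp (- \<sigma> * t) \<le> a i * exp (- \<theta> i * t)"
      using assms(3)[OF that False] positions(1)[OF that] assms(5)
      by (auto intro!: mult_left_mono mult_right_mono)
    then show ?thesis using False r_gap[OF T0(1) that] by (simp add: u_def algebra_simps)
  qed
  have far: "\<bar>r 0 - a i\<bar> * exp (- \<sigma> * t) \<le> \<bar>u - ?a t i\<bar>" "0 < \<bar>r 0 - a i\<bar>"
     "if below i then ?a t i < u else u < ?a t i" if "i \<in> A" for i
  proof -
    have e: "0 < exp (- \<sigma> * t)" by simp
    show 1: "0 < \<bar>r 0 - a i\<bar>" using dist[OF that] by (auto split: if_splits)
    show "if below i then ?a t i < u else u < ?a t i"
    proof (cases "below i")
      case True
      then have "0 < (r 0 - a i) * exp (- \<sigma> * t)" using dist[OF that] e by (intro mult_pos_pos) auto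
      also have "\<dots> \<le> u - ?a t i" using dist[OF that] True by simp
      finally show ?thesis using True by simp
    next
      case False
      then have "0 < (a i - r 0) * exp (- \<sigma> * t)" using dist[OF that] e by (intro mult_pos_pos) auto
      also have "\<dots> \<le> ?a t i - u" using dist[OF that] False by simp
      finally show ?thesis using False by simp
    qed
    show "\<bar>r 0 - a i\<bar> * exp (- \<sigma> * t) \<le> \<bar>u - ?a t i\<bar>"
      using dist[OF that] by (auto simp: abs_if split: if_splits)
  qed
  have lnA: "ln \<bar>r 0 - a i\<bar> - \<sigma> * t \<le> ln \<bar>u - ?a t i\<bar>" if "i \<in> A" for i
  proof -
    have "ln \<bar>r 0 - a i\<bar> - \<sigma> * t = ln (\<bar>r 0 - a i\<bar> * exp (- \<sigma> * t))"
      using far(2)[OF that] by (subst ln_mult) auto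
    also have "\<dots> \<le> ln \<bar>u - ?a t i\<bar>"
      using far(1,2)[OF that] by (intro ln_mono) auto
    finally show ?thesis .
  qed
  have lnB: "ln (u + ?a' t j) \<le> ln (r 0 + a' j)" if "j \<in> B" for j
  proof -
    have "u \<le> r 0" "?a' t j \<le> a' j"
      using r0 positions(2)[OF that] assms(1,4,5) that
      by (auto simp: u_def mult_le_cancel_left1 mult_le_cancel_left2)
    moreover have "0 < u + ?a' t j" using u positions(2)[OF that] by (simp add: add_pos_nonneg)
    ultimately show ?thesis by (intro ln_mono) auto
  qed
  have "top_value 0 - (\<Sum>i\<in>A. \<beta> i) * \<sigma> * t
      = (\<Sum>i\<in>A. \<beta> i * (ln \<bar>r 0 - a i\<bar> - \<sigma> * t)) - (\<Sum>j\<in>B. \<beta>' j * ln (r 0 + a' j))"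
    by (simp add: top_value_def gap_pot_def algebra_simps sum.distrib sum_distrib_left sum_subtractf)
  also have "\<dots> \<le> (\<Sum>i\<in>A. \<beta> i * ln \<bar>u - ?a t i\<bar>) - (\<Sum>j\<in>B. \<beta>' j * ln (u + ?a' t j))"
    by (intro diff_mono sum_mono mult_left_mono lnA lnB weights)
  also have "\<dots> = gap_pot A \<beta> (?a t) B \<beta>' (?a' t) u" by (simp add: gap_pot_def)
  also have "\<dots> \<le> top_value t"
    unfolding top_value_def by (rule r_max[OF T0(2) u far(3)])
  finally show ?thesis .
qed

end

section \<open>The slit maps as potentials\<close>

abbreviation slit_index :: "slit_data \<Rightarrow> (nat + nat) set" where
  "slit_index P \<equiv> {1..Np P} <+> {1..Nm P}"

abbreviation charge :: "slit_data \<Rightarrow> nat + nat \<Rightarrow> real" where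
  "charge P \<equiv> case_sum (bp P) (\<lambda>j. - bm P j)"

abbreviation position :: "slit_data \<Rightarrow> real \<Rightarrow> nat + nat \<Rightarrow> real" where
  "position P t \<equiv> case_sum (kp P t) (km P t)"

lemma h_eq_log_pot: "h P t = log_pot (slit_index P) (charge P) (position P t)"
  by (simp add: fun_eq_iff h_def log_pot_def sum.Plus sum_negf)

definition ordered :: "slit_data \<Rightarrow> real \<Rightarrow> bool" where
  "ordered P t \<longleftrightarrow> strict_mono_on {1..Np P} (kp P t) \<and> strict_mono_on {1..Nm P} (km P t)"

text \<open>The poles to the right of a point form a final segment of the index range.\<close>

lemma upper_segment:
  fixes k :: "nat \<Rightarrow> real"
  assumes "strict_mono_on {1..n} k"
  obtains m where "m \<le> n" "{j \<in> {1..n}. x < k j} = {m+1..n}"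
proof -
  define S where "S = insert 0 {j \<in> {1..n}. k j \<le> x}"
  define m where "m = Max S"
  have S: "finite S" "S \<noteq> {}" by (auto simp: S_def)
  have m: "m \<in> S" unfolding m_def using S by (rule Max_in)
  have "{j \<in> {1..n}. x < k j} = {m+1..n}"
  proof (intro equalityI subsetI)
    fix j assume j: "j \<in> {j \<in> {1..n}. x < k j}"
    have "\<not> j \<le> m"
    proof
      assume "j \<le> m"
      then have "m \<in> {1..n}" "k m \<le> x" using m j by (auto simp: S_def)
      moreover have "k j \<le> k m"
        using strict_mono_on_leD[OF assms _ _ \<open>j \<le> m\<close>] j \<open>m \<in> {1..n}\<close> by auto
      ultimately show False using j by auto
    qed
    then show "j \<in> {m+1..n}" using j by auto
  next
    fix j assume j: "j \<in> {m+1..n}"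
    then have "j \<notin> S" using Max_ge[OF S(1), of j] by (auto simp: m_def)
    then show "j \<in> {j \<in> {1..n}. x < k j}" using j by (auto simp: S_def)
  qed
  moreover have "m \<le> n" using m by (auto simp: S_def)
  ultimately show ?thesis using that by blast
qed

locale admissible_slits =
  fixes P :: slit_data
  assumes standing: "standing P" and admissible: "admissible P"
begin

abbreviation "N \<equiv> Np P"
abbreviation "M \<equiv> Nm P"
abbreviation "K \<equiv> kp0 P N"

definition ap :: "nat \<Rightarrow> real" where "ap j = K - kp0 P j"
definition am :: "nat \<Rightarrow> real" where "am j = km0 P j - K"
text \<open>The exponents of all left poles: \<open>k\<^sup>+\<^sub>1\<close> and \<open>k\<^sup>+\<^sub>N\<close> do not move.\<close>

definition \<theta>p :: "nat \<Rightarrow> real" where "\<theta>p j = (if j = 1 \<or> j = N then 0 else thetap P j)"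

lemma NM: "2 \<le> N" "1 \<le> M"
  using standing by (auto simp: standing_def)

lemma weights_pos: "j \<in> {1..N} \<Longrightarrow> 0 < bp P j" "j \<in> {1..M} \<Longrightarrow> 0 < bm P j"
  using standing by (auto simp: standing_def)

lemma kp_eq: "kp P t j = K - ap j * exp (- \<theta>p j * t)"
  by (auto simp: kp_def ap_def \<theta>p_def algebra_simps)

lemma km_eq: "km P t j = K + am j * exp (- thetam P j * t)"
  by (simp add: km_def am_def)

lemma ap_less: "i \<in> {1..N} \<Longrightarrow> j \<in> {1..N} \<Longrightarrow> i < j \<Longrightarrow> ap j < ap i"
  using standing by (auto simp: standing_def ap_def strict_mono_on_def)

lemma ap_N: "ap N = 0" by (simp add: ap_def)

lemma ap_nonneg: "j \<in> {1..N} \<Longrightarrow> 0 \<le> ap j"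
  using ap_less[of j N] ap_N by (cases "j = N") auto

lemma am_pos: "j \<in> {1..M} \<Longrightarrow> 0 < am j"
proof -
  assume j: "j \<in> {1..M}"
  have "km0 P 1 \<le> km0 P j"
    using standing j strict_mono_on_leD[of "{1..M}" "km0 P" 1 j] by (auto simp: standing_def)
  then show ?thesis using standing by (auto simp: standing_def am_def)
qed

lemma \<theta>p_nonneg: "j \<in> {1..N} \<Longrightarrow> 0 \<le> \<theta>p j"
  using admissible by (auto simp: admissible_def \<theta>p_def less_imp_le)

lemma \<theta>p_mono:
  assumes "i \<in> {1..N}" "i \<le> j" "j < N"
  shows "\<theta>p i \<le> \<theta>p j"
proof (cases "i = 1")
  case True
  then show ?thesis using \<theta>p_nonneg[of j] assms by (simp add: \<theta>p_def)
next
  case False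
  then have "i \<in> {2..N - 1}" "j \<in> {2..N - 1}" using assms by auto
  then show ?thesis
    using admissible assms(2,3) False by (auto simp: admissible_def E0_def mono_on_def \<theta>p_def)
qed

lemma thetam_nonneg: "j \<in> {1..M} \<Longrightarrow> 0 \<le> thetam P j"
  using admissible by (auto simp: admissible_def less_imp_le)

lemma thetam_antimono: "i \<in> {1..M} \<Longrightarrow> j \<in> {1..M} \<Longrightarrow> i \<le> j \<Longrightarrow> thetam P j \<le> thetam P i"
  using admissible by (auto simp: admissible_def E0_def monotone_on_def)

lemma kp_le_K: "j \<in> {1..N} \<Longrightarrow> kp P t j \<le> K"
  using ap_nonneg[of j] by (simp add: kp_eq)

lemma K_less_km: "j \<in> {1..M} \<Longrightarrow> K < km P t j"
  using am_pos[of j] by (simp add: km_eq)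

lemma kp_N: "kp P t N = K" by (simp add: kp_eq ap_N)

lemma ordered_forward:
  assumes "0 \<le> t"
  shows "ordered P t"
  unfolding ordered_def
proof (intro conjI strict_mono_onI)
  fix i j assume ij: "i \<in> {1..N}" "j \<in> {1..N}" "i < j"
  have "ap j * exp (- \<theta>p j * t) < ap i * exp (- \<theta>p i * t)"
  proof (cases "j = N")
    case True
    then show ?thesis using ap_less[OF ij] by (simp add: ap_N)
  next
    case False
    then have "exp (- \<theta>p j * t) \<le> exp (- \<theta>p i * t)"
      using \<theta>p_mono[of i j] ij assms by (auto intro: mult_right_mono)
    then have "ap j * exp (- \<theta>p j * t) \<le> ap j * exp (- \<theta>p i * t)"
      using ap_nonneg[of j] ij by (intro mult_left_mono) auto
    also have "\<dots> < ap i * exp (- \<theta>p i * t)" using ap_less[OF ij] by simp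
    finally show ?thesis .
  qed
  then show "kp P t i < kp P t j" by (simp add: kp_eq)
next
  fix i j assume ij: "i \<in> {1..M}" "j \<in> {1..M}" "i < j"
  then have "am i < am j" using standing by (auto simp: standing_def am_def strict_mono_on_def)
  then have "am i * exp (- thetam P i * t) < am j * exp (- thetam P i * t)" by simp
  also have "\<dots> \<le> am j * exp (- thetam P j * t)"
    using thetam_antimono[of i j] ij assms am_pos[of j] by (auto intro!: mult_right_mono)
  finally show "km P t i < km P t j" by (simp add: km_eq)
qed

text \<open>The order of the poles is an open condition at \<open>t = 0\<close>, so it persists for a short time into the
  past.\<close>

lemma ordered_past:
  obtains T where "open T" "convex T" "{0..} \<subseteq> T" "\<And>t. t \<in> T \<Longrightarrow> ordered P t"
proof -
  have near: "\<forall>\<^sub>F t in nhds 0. \<forall>i\<in>{1..n}. \<forall>j\<in>{1..n}. i < j \<longrightarrow> k t i < k t j"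
    if k: "\<And>j. isCont (\<lambda>t. k t j) 0" "strict_mono_on {1..n} (k 0)" for k :: "real \<Rightarrow> nat \<Rightarrow> real" and n
  proof (intro eventually_ball_finite ballI finite_atLeastAtMost)
    fix i j assume ij: "i \<in> {1..n}" "j \<in> {1..n}"
    have "((\<lambda>t. k t j - k t i) \<longlongrightarrow> k 0 j - k 0 i) (nhds 0)"
      by (intro tendsto_diff isCont_tendsto_compose[OF k(1) filterlim_ident])
    then have "\<forall>\<^sub>F t in nhds 0. 0 < k t j - k t i" if "i < j"
      using k(2) ij that by (intro order_tendstoD) (auto simp: strict_mono_on_def)
    then show "\<forall>\<^sub>F t in nhds 0. i < j \<longrightarrow> k t i < k t j"
      by (cases "i < j") auto
  qed
  have "\<forall>\<^sub>F t in nhds 0. ordered P t"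
    using near[of "kp P" N] near[of "km P" M] ordered_forward[of 0]
    unfolding ordered_def strict_mono_on_def
    by (auto simp: kp_eq km_eq eventually_conj_iff elim: eventually_elim2 intro!: continuous_intros)
  then obtain d where d: "d > 0" "\<And>t. dist t 0 < d \<Longrightarrow> ordered P t"
    by (auto simp: eventually_nhds_metric)
  have "ordered P t" if "t \<in> {-d<..}" for t
    using that ordered_forward[of t] d(2)[of t] by (cases "0 \<le> t") (auto simp: dist_real_def)
  then show ?thesis using d(1) by (intro that[of "{-d<..}"]) auto
qed

lemma separated_at:
  assumes "ordered P t"
  shows "separated_charges (slit_index P) (charge P) (position P t) K"
proof
  show "finite (slit_index P)" by simp
  show "inj_on (position P t) (slit_index P)"
  proof (rule inj_onI)
    have inj: "inj_on (kp P t) {1..N}" "inj_on (km P t) {1..M}"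
      using assms by (auto simp: ordered_def strict_mono_on_imp_inj_on)
    have ne: "kp P t j \<noteq> km P t l" if "j \<in> {1..N}" "l \<in> {1..M}" for j l
      using kp_le_K[OF that(1), of t] K_less_km[OF that(2), of t] by linarith
    fix x y assume "x \<in> slit_index P" "y \<in> slit_index P" "position P t x = position P t y"
    then show "x = y"
      using inj_onD[OF inj(1)] inj_onD[OF inj(2)] ne ne[symmetric]
      by (cases x; cases y) (simp_all add: Plus_def image_iff)
  qed
  show "charge P i \<noteq> 0" if "i \<in> slit_index P" for i
    using that weights_pos by force
  show "0 < charge P i \<and> position P t i \<le> K \<or> charge P i < 0 \<and> K < position P t i"
    if "i \<in> slit_index P" for i
    using that weights_pos kp_le_K[of _ t] K_less_km[of _ t] by auto
  show "K \<in> position P t ` slit_index P"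
    using NM kp_N by (intro image_eqI[of _ _ "Inl N"]) auto
  show "\<exists>i\<in>slit_index P. position P t i \<noteq> K"
    using NM K_less_km[of 1 t] by (intro bexI[of _ "Inr 1"]) auto
qed

lemma net_charge_eq: "(\<Sum>i\<in>slit_index P. charge P i) = bp_total P - bm_total P"
  by (simp add: sum.Plus sum_negf bp_total_def bm_total_def)

lemma net_charge_pos: "0 < (\<Sum>i\<in>slit_index P. charge P i)"
  using standing unfolding net_charge_eq by (simp add: standing_def)

lemma h'_real:
  assumes "ordered P t"
  shows "h' P t (of_real x) = of_real (charges.field (slit_index P) (charge P) (position P t) x)"
proof -
  interpret separated_charges "slit_index P" "charge P" "position P t" K
    by (rule separated_at[OF assms])
  show ?thesis
    by (simp add: h'_def field_def sum.Plus sum_negf del: One_nat_def)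
qed

lemma gap_plus:
  assumes "ordered P t" "\<nu> \<in> {1..N - 1}" "kp P t \<nu> < x" "x < kp P t (\<nu> + 1)" "i \<in> slit_index P"
  shows "(i \<in> Inl ` {1..\<nu>} \<and> position P t i \<le> kp P t \<nu>) \<or>
         (i \<in> {\<nu>+1..N} <+> {1..M} \<and> kp P t (\<nu> + 1) \<le> position P t i)"
proof -
  have mono: "kp P t j \<le> kp P t l" if "j \<in> {1..N}" "l \<in> {1..N}" "j \<le> l" for j l
    using assms(1) that strict_mono_on_leD unfolding ordered_def by blast
  show ?thesis
  proof (cases i)
    case (Inl j)
    then have j: "j \<in> {1..N}" using assms(5) by auto
    show ?thesis
    proof (cases "j \<le> \<nu>")
      case True
      then show ?thesis using mono[of j \<nu>] j assms(2) Inl by auto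
    next
      case False
      then show ?thesis using mono[of "\<nu> + 1" j] j assms(2) Inl by auto
    qed
  next
    case (Inr j)
    then have j: "j \<in> {1..M}" using assms(5) by auto
    have "kp P t (\<nu> + 1) \<le> K" using kp_le_K assms(2) by auto
    then show ?thesis using K_less_km[OF j, of t] Inr j by auto
  qed
qed

lemma gap_minus:
  assumes "ordered P t" "\<mu> \<in> {1..M}" "km P t \<mu> < x" "\<mu> < M \<longrightarrow> x < km P t (\<mu> + 1)" "i \<in> slit_index P"
  shows "(i \<in> {1..N} <+> {1..\<mu>} \<and> position P t i \<le> km P t \<mu>) \<or>
         (i \<in> Inr ` {\<mu>+1..M} \<and> \<mu> < M \<and> km P t (\<mu> + 1) \<le> position P t i)"
proof -
  have mono: "km P t j \<le> km P t l" if "j \<in> {1..M}" "l \<in> {1..M}" "j \<le> l" for j l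
    using assms(1) that strict_mono_on_leD unfolding ordered_def by blast
  show ?thesis
  proof (cases i)
    case (Inr j)
    then have j: "j \<in> {1..M}" using assms(5) by auto
    show ?thesis
    proof (cases "j \<le> \<mu>")
      case True
      then show ?thesis using mono[of j \<mu>] j assms(2) Inr by auto
    next
      case False
      then show ?thesis using mono[of "\<mu> + 1" j] j assms(2) Inr by auto
    qed
  next
    case (Inl j)
    then have j: "j \<in> {1..N}" using assms(5) by auto
    then show ?thesis using kp_le_K[OF j, of t] K_less_km[OF assms(2), of t] Inl by auto
  qed
qed

lemma rhop:
  assumes "ordered P t" "\<nu> \<in> {1..N - 1}"
  shows "kp P t \<nu> < rhop P \<nu> t" "rhop P \<nu> t < kp P t (\<nu> + 1)"
    and "charges.field (slit_index P) (charge P) (position P t) (rhop P \<nu> t) = 0"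
proof -
  interpret separated_charges "slit_index P" "charge P" "position P t" K
    by (rule separated_at[OF assms(1)])
  have "\<nu> \<in> {1..N}" "\<nu> + 1 \<in> {1..N}" using assms(2) by auto
  then have less: "kp P t \<nu> < kp P t (\<nu> + 1)"
    using assms(1) by (auto simp: ordered_def strict_mono_on_def)
  obtain \<xi> where \<xi>: "kp P t \<nu> < \<xi>" "\<xi> < kp P t (\<nu> + 1)" "field \<xi> = 0"
  proof (rule critical_point_between_positive[of "Inl \<nu>" "Inl (\<nu> + 1)"])
    show "of_real x \<in> free_points (slit_index P) (position P t)"
      if "position P t (Inl \<nu>) < x" "x < position P t (Inl (\<nu> + 1))" for x
      using that gap_plus[OF assms, of x] unfolding real_free_point by fastforce
  qed (use assms(2) weights_pos less in auto)
  have "\<exists>!x. kp P t \<nu> < x \<and> x < kp P t (\<nu> + 1) \<and> h' P t (of_real x) = 0"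
  proof (intro ex1I[of _ \<xi>])
    fix x assume x: "kp P t \<nu> < x \<and> x < kp P t (\<nu> + 1) \<and> h' P t (of_real x) = 0"
    show "x = \<xi>"
    proof (rule critical_point_unique)
      show "position P t i < min x \<xi> \<or> max x \<xi> < position P t i" if "i \<in> slit_index P" for i
        using gap_plus[OF assms _ _ that, of x] x \<xi>(1,2) by auto
    qed (use x \<xi> h'_real[OF assms(1)] in auto)
  qed (use \<xi> h'_real[OF assms(1)] in auto)
  from theI'[OF this, folded rhop_def] show "kp P t \<nu> < rhop P \<nu> t" "rhop P \<nu> t < kp P t (\<nu> + 1)"
    "field (rhop P \<nu> t) = 0"
    using h'_real[OF assms(1)] by auto
qed

lemma rhom:
  assumes "ordered P t" "\<mu> \<in> {1..M}"
  shows "km P t \<mu> < rhom P \<mu> t" "\<mu> < M \<longrightarrow> rhom P \<mu> t < km P t (\<mu> + 1)"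
    and "charges.field (slit_index P) (charge P) (position P t) (rhom P \<mu> t) = 0"
proof -
  interpret separated_charges "slit_index P" "charge P" "position P t" K
    by (rule separated_at[OF assms(1)])
  have free: "of_real x \<in> free_points (slit_index P) (position P t)"
    if "km P t \<mu> < x" "\<mu> < M \<longrightarrow> x < km P t (\<mu> + 1)" for x
    using gap_minus[OF assms that] that unfolding real_free_point by fastforce
  obtain \<xi> where \<xi>: "km P t \<mu> < \<xi>" "\<mu> < M \<longrightarrow> \<xi> < km P t (\<mu> + 1)" "field \<xi> = 0"
  proof (cases "\<mu> < M")
    case True
    then have "km P t \<mu> < km P t (\<mu> + 1)"
      using assms by (auto simp: ordered_def strict_mono_on_def)
    then show ?thesis
      using critical_point_between_negative[of "Inr \<mu>" "Inr (\<mu> + 1)"] assms(2) True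
        weights_pos(2)[of \<mu>] weights_pos(2)[of "\<mu> + 1"] free that
      by (auto simp: InlI InrI simp del: One_nat_def)
  next
    case False
    then have all: "of_real x \<in> free_points (slit_index P) (position P t)"
      if "position P t (Inr \<mu>) < x" for x using free that by simp
    have "Inr \<mu> \<in> slit_index P" "charge P (Inr \<mu>) < 0"
      using assms(2) weights_pos(2)[of \<mu>] by auto
    from critical_point_beyond_last[OF this net_charge_pos all]
    show ?thesis using that False by auto
  qed
  have "\<exists>!x. km P t \<mu> < x \<and> (\<mu> < M \<longrightarrow> x < km P t (\<mu> + 1)) \<and> h' P t (of_real x) = 0"
  proof (intro ex1I[of _ \<xi>])
    fix x assume x: "km P t \<mu> < x \<and> (\<mu> < M \<longrightarrow> x < km P t (\<mu> + 1)) \<and> h' P t (of_real x) = 0"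
    show "x = \<xi>"
    proof (rule critical_point_unique)
      show "position P t i < min x \<xi> \<or> max x \<xi> < position P t i" if "i \<in> slit_index P" for i
        using gap_minus[OF assms _ _ that, of x] x \<xi>(1,2) by auto
    qed (use x \<xi> h'_real[OF assms(1)] in auto)
  qed (use \<xi> h'_real[OF assms(1)] in auto)
  from theI'[OF this, folded rhom_def] show "km P t \<mu> < rhom P \<mu> t" "\<mu> < M \<longrightarrow> rhom P \<mu> t < km P t (\<mu> + 1)"
    "field (rhom P \<mu> t) = 0"
    using h'_real[OF assms(1)] by auto
qed


section \<open>Heights of the slits\<close>

definition tail_p :: "nat \<Rightarrow> real" where "tail_p \<nu> = (\<Sum>j=\<nu>+1..N. bp P j)"
definition head_m :: "nat \<Rightarrow> real" where "head_m \<mu> = (\<Sum>j=1..\<mu>. bm P j)"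

lemma tail_p_less: "i < j \<Longrightarrow> j \<le> N \<Longrightarrow> tail_p j < tail_p i"
proof -
  assume ij: "i < j" "j \<le> N"
  have "tail_p i = (\<Sum>l\<in>{i+1..j}. bp P l) + tail_p j"
    unfolding tail_p_def using ij by (subst sum.union_disjoint[symmetric]) (auto intro!: sum.cong)
  moreover have "0 < (\<Sum>l\<in>{i+1..j}. bp P l)"
    using ij weights_pos by (intro sum_pos) auto
  ultimately show ?thesis by simp
qed

lemma head_m_less: "i < j \<Longrightarrow> j \<le> M \<Longrightarrow> head_m i < head_m j"
proof -
  assume ij: "i < j" "j \<le> M"
  have "head_m j = head_m i + (\<Sum>l\<in>{i+1..j}. bm P l)"
    unfolding head_m_def using ij by (subst sum.union_disjoint[symmetric]) (auto intro!: sum.cong)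
  moreover have "0 < (\<Sum>l\<in>{i+1..j}. bm P l)"
    using ij weights_pos by (intro sum_pos) auto
  ultimately show ?thesis by simp
qed

lemma tail_p_mono: "i \<le> j \<Longrightarrow> j \<le> N \<Longrightarrow> tail_p j \<le> tail_p i"
  using tail_p_less[of i j] by (cases "i = j") auto

lemma head_m_mono: "i \<le> j \<Longrightarrow> j \<le> M \<Longrightarrow> head_m i \<le> head_m j"
  using head_m_less[of i j] by (cases "i = j") auto

lemma tail_p_step: "j \<in> {1..N} \<Longrightarrow> tail_p (j - 1) = tail_p j + bp P j"
  unfolding tail_p_def by (subst sum.atLeast_Suc_atMost) auto

lemma head_m_step: "j \<in> {1..M} \<Longrightarrow> head_m j = head_m (j - 1) + bm P j"
  unfolding head_m_def by (cases j) auto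

lemma ends: "tail_p N = 0" "tail_p 0 = bp_total P" "head_m 0 = 0" "head_m M = bm_total P"
  by (simp_all add: tail_p_def head_m_def bp_total_def bm_total_def)

lemma totals: "bm_total P < bp_total P" "tail_p 1 < bm_total P"
  using standing by (simp_all add: standing_def tail_p_def numeral_2_eq_2)

lemma heights_distinct: "\<nu> \<in> {1..N - 1} \<Longrightarrow> \<mu> \<in> {1..M} \<Longrightarrow> tail_p \<nu> \<noteq> head_m \<mu>"
  using standing by (auto simp: standing_def tail_p_def head_m_def)

lemma yp_eq: "yp P \<nu> = pi * (tail_p \<nu> - bm_total P)"
  by (simp add: yp_def tail_p_def)

lemma total_split: "\<mu> \<le> M \<Longrightarrow> bm_total P = head_m \<mu> + (\<Sum>l\<in>{\<mu>+1..M}. bm P l)"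
  unfolding bm_total_def head_m_def by (subst sum.union_disjoint[symmetric]) (auto intro!: sum.cong)

lemma ym_eq: "\<mu> \<le> M \<Longrightarrow> ym P \<mu> = pi * (head_m \<mu> - bm_total P)"
  using total_split by (simp add: ym_def)

lemma height_of_charges:
  assumes "n \<le> N" "m \<le> M"
  shows "pi * (\<Sum>i\<in>{n+1..N} <+> {m+1..M}. charge P i) = pi * (tail_p n + head_m m - bm_total P)"
  using total_split[OF assms(2)] by (simp add: sum.Plus sum_negf tail_p_def)

lemma free_real_point:
  "of_real x \<in> free_points (slit_index P) (position P t) \<longleftrightarrow>
     (\<forall>j\<in>{1..N}. x \<noteq> kp P t j) \<and> (\<forall>j\<in>{1..M}. x \<noteq> km P t j)"
  by (simp add: free_points_def Plus_def ball_Un)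

text \<open>A real point is located by the numbers \<open>n\<close>, \<open>m\<close> of left and right poles that it has passed, and
  these determine its height.\<close>

lemma positions_above:
  assumes "ordered P t"
  obtains n m where "n \<le> N" "m \<le> M" "{i \<in> slit_index P. x < position P t i} = {n+1..N} <+> {m+1..M}"
    "x < K \<Longrightarrow> n < N \<and> m = 0" "K \<le> x \<Longrightarrow> n = N"
proof -
  obtain n where n: "n \<le> N" "{j \<in> {1..N}. x < kp P t j} = {n+1..N}"
    using upper_segment assms unfolding ordered_def by metis
  obtain m where m: "m \<le> M" "{j \<in> {1..M}. x < km P t j} = {m+1..M}"
    using upper_segment assms unfolding ordered_def by metis
  have "{i \<in> slit_index P. x < position P t i}
      = {j \<in> {1..N}. x < kp P t j} <+> {j \<in> {1..M}. x < km P t j}"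
    by auto
  also have "\<dots> = {n+1..N} <+> {m+1..M}" by (simp only: n(2) m(2))
  finally have eq: "{i \<in> slit_index P. x < position P t i} = {n+1..N} <+> {m+1..M}" .
  have "n < N \<and> m = 0" if "x < K"
  proof
    have "N \<in> {n+1..N}" unfolding n(2)[symmetric] using NM that kp_N by auto
    then show "n < N" by auto
    have "1 \<in> {m+1..M}" unfolding m(2)[symmetric] using NM that K_less_km[of 1 t] by auto
    then show "m = 0" by auto
  qed
  moreover have "n = N" if "K \<le> x"
  proof (rule ccontr)
    assume "n \<noteq> N"
    then have "N \<in> {n+1..N}" using n(1) by auto
    then show False unfolding n(2)[symmetric] using that kp_N by auto
  qed
  ultimately show ?thesis using that[OF n(1) m(1) eq] by blast
qed

lemma gap_height_plus:
  assumes "ordered P t" "\<nu> \<in> {1..N - 1}" "kp P t \<nu> < x" "x < kp P t (\<nu> + 1)"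
  shows "of_real x \<in> free_points (slit_index P) (position P t)"
    and "Im (h P t (of_real x)) = yp P \<nu>"
proof -
  show free: "of_real x \<in> free_points (slit_index P) (position P t)"
    using gap_plus[OF assms] assms(3,4) unfolding free_points_def by fastforce
  have "{i \<in> slit_index P. x < position P t i} = {\<nu>+1..N} <+> {0+1..M}" (is "?L = ?R")
  proof (intro equalityI subsetI)
    fix i assume "i \<in> ?L"
    then show "i \<in> ?R" using gap_plus[OF assms, of i] assms(3) by auto
  next
    fix i assume "i \<in> ?R"
    then have "i \<in> slit_index P" "i \<notin> Inl ` {1..\<nu>}" by auto
    then show "i \<in> ?L" using gap_plus[OF assms, of i] assms(4) by auto
  qed
  moreover have "\<nu> \<le> N" using assms(2) by auto
  ultimately show "Im (h P t (of_real x)) = yp P \<nu>"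
    unfolding h_eq_log_pot using height_of_charges[of \<nu> 0] free
    by (simp add: Im_log_pot_real ends yp_eq del: One_nat_def)
qed

lemma gap_height_minus:
  assumes "ordered P t" "\<mu> \<in> {1..M}" "km P t \<mu> < x" "\<mu> < M \<longrightarrow> x < km P t (\<mu> + 1)"
  shows "of_real x \<in> free_points (slit_index P) (position P t)"
    and "Im (h P t (of_real x)) = ym P \<mu>"
proof -
  show free: "of_real x \<in> free_points (slit_index P) (position P t)"
    using gap_minus[OF assms] assms(3,4) unfolding free_points_def by fastforce
  have "{i \<in> slit_index P. x < position P t i} = {N+1..N} <+> {\<mu>+1..M}" (is "?L = ?R")
  proof (intro equalityI subsetI)
    fix i assume "i \<in> ?L"
    then show "i \<in> ?R" using gap_minus[OF assms, of i] assms(3) by auto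
  next
    fix i assume "i \<in> ?R"
    then have "i \<in> slit_index P" "i \<notin> {1..N} <+> {1..\<mu>}" by auto
    then show "i \<in> ?L" using gap_minus[OF assms, of i] assms(4) by auto
  qed
  moreover have "\<mu> \<le> M" using assms(2) by auto
  ultimately show "Im (h P t (of_real x)) = ym P \<mu>"
    unfolding h_eq_log_pot using height_of_charges[of N \<mu>] free
    by (simp add: Im_log_pot_real ends ym_eq del: One_nat_def)
qed

lemma segment_gap:
  fixes k :: "nat \<Rightarrow> real"
  assumes "{j \<in> {1..n}. x < k j} = {m+1..n}" "\<And>j. j \<in> {1..n} \<Longrightarrow> x \<noteq> k j"
  shows "m \<in> {1..n} \<Longrightarrow> k m < x" and "m < n \<Longrightarrow> x < k (m + 1)"
proof -
  show "k m < x" if "m \<in> {1..n}"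
  proof -
    have "m \<notin> {j \<in> {1..n}. x < k j}" unfolding assms(1) by simp
    then show ?thesis using assms(2)[OF that] that by force
  qed
  show "x < k (m + 1)" if "m < n"
  proof -
    have "m + 1 \<in> {j \<in> {1..n}. x < k j}" unfolding assms(1) using that by simp
    then show ?thesis by simp
  qed
qed

text \<open>The heights of the left gaps are strictly monotone, and by assumption no right gap has the same
  height. Hence each slit comes from one gap only.\<close>

lemma height_determines_gap_plus:
  assumes "ordered P t" "\<nu> \<in> {1..N - 1}" "of_real x \<in> free_points (slit_index P) (position P t)"
    and "Im (h P t (of_real x)) = yp P \<nu>"
  shows "kp P t \<nu> < x \<and> x < kp P t (\<nu> + 1)"
proof -
  obtain n m where nm: "n \<le> N" "m \<le> M"
    "{i \<in> slit_index P. x < position P t i} = {n+1..N} <+> {m+1..M}"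
    "x < K \<Longrightarrow> n < N \<and> m = 0" "K \<le> x \<Longrightarrow> n = N"
    using positions_above[OF assms(1)] by blast
  have "Im (h P t (of_real x)) = pi * (tail_p n + head_m m - bm_total P)"
    unfolding h_eq_log_pot height_of_charges[OF nm(1,2), symmetric] nm(3)[symmetric]
    by (rule Im_log_pot_real) (use assms(3) in auto)
  then have eq: "tail_p n + head_m m = tail_p \<nu>"
    using assms(4) by (simp add: yp_eq)
  have \<nu>: "\<nu> < N" using assms(2) NM by auto
  have "x < K"
  proof (rule ccontr)
    assume "\<not> x < K"
    then have "head_m m = tail_p \<nu>" using eq nm(5) ends by simp
    moreover have "m \<noteq> 0" using \<nu> tail_p_less[of \<nu> N] calculation ends by (cases m) auto
    ultimately show False using heights_distinct[OF assms(2), of m] nm(2) by auto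
  qed
  then have "n < N" "tail_p n = tail_p \<nu>" using eq nm(4) ends by auto
  then have "n = \<nu>"
    using tail_p_less[of n \<nu>] tail_p_less[of \<nu> n] \<nu> by (cases n \<nu> rule: linorder_cases) auto
  have "{j \<in> {1..N}. x < kp P t j} = {\<nu>+1..N}"
  proof -
    have "{j \<in> {1..N}. x < kp P t j} = Inl -` {i \<in> slit_index P. x < position P t i}" by auto
    also have "\<dots> = {\<nu>+1..N}" unfolding nm(3) \<open>n = \<nu>\<close> by auto
    finally show ?thesis .
  qed
  moreover have "x \<noteq> kp P t j" if "j \<in> {1..N}" for j
    using assms(3) that unfolding free_real_point by blast
  ultimately show ?thesis
    using segment_gap[of N x "kp P t" \<nu>] assms(2) \<nu> by auto
qed

lemma height_determines_gap_minus:
  assumes "ordered P t" "\<mu> \<in> {1..M}" "of_real x \<in> free_points (slit_index P) (position P t)"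
    and "Im (h P t (of_real x)) = ym P \<mu>"
  shows "km P t \<mu> < x \<and> (\<mu> < M \<longrightarrow> x < km P t (\<mu> + 1))"
proof -
  obtain n m where nm: "n \<le> N" "m \<le> M"
    "{i \<in> slit_index P. x < position P t i} = {n+1..N} <+> {m+1..M}"
    "x < K \<Longrightarrow> n < N \<and> m = 0" "K \<le> x \<Longrightarrow> n = N"
    using positions_above[OF assms(1)] by blast
  have "Im (h P t (of_real x)) = pi * (tail_p n + head_m m - bm_total P)"
    unfolding h_eq_log_pot height_of_charges[OF nm(1,2), symmetric] nm(3)[symmetric]
    by (rule Im_log_pot_real) (use assms(3) in auto)
  then have eq: "tail_p n + head_m m = head_m \<mu>"
    using assms(2,4) by (simp add: ym_eq)
  have \<mu>: "\<mu> \<le> M" using assms(2) by auto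
  have "\<not> x < K"
  proof
    assume "x < K"
    then have n: "n < N" "tail_p n = head_m \<mu>" using eq nm(4) ends by auto
    moreover have "n \<noteq> 0"
      using head_m_mono[OF \<mu> order_refl] n(2) ends totals(1) by (cases n) auto
    ultimately show False using heights_distinct[OF _ assms(2), of n] by auto
  qed
  then have "head_m m = head_m \<mu>" using eq nm(5) ends by auto
  then have "m = \<mu>"
    using head_m_less[of m \<mu>] head_m_less[of \<mu> m] \<mu> nm(2) by (cases m \<mu> rule: linorder_cases) auto
  have "{j \<in> {1..M}. x < km P t j} = {\<mu>+1..M}"
  proof -
    have "{j \<in> {1..M}. x < km P t j} = Inr -` {i \<in> slit_index P. x < position P t i}" by auto
    also have "\<dots> = {\<mu>+1..M}" unfolding nm(3) \<open>m = \<mu>\<close> by auto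
    finally show ?thesis .
  qed
  moreover have "x \<noteq> km P t j" if "j \<in> {1..M}" for j
    using assms(3) that unfolding free_real_point by blast
  ultimately show ?thesis
    using segment_gap[of M x "km P t" \<mu>] assms(2) \<mu> by auto
qed

text \<open>The strip between two consecutive left (or right) slit heights is the range of heights near one pole.\<close>

lemma pole_heights:
  "j \<in> {1..N} \<Longrightarrow> charges.pole_height (slit_index P) (charge P) (position P 0) (Inl j) = yp P j"
  "j \<in> {1..M} \<Longrightarrow> charges.pole_height (slit_index P) (charge P) (position P 0) (Inr j) = ym P j"
proof -
  have ord: "ordered P 0" by (rule ordered_forward) simp
  interpret separated_charges "slit_index P" "charge P" "position P 0" K
    by (rule separated_at[OF ord])
  have mono: "kp P 0 i < kp P 0 j \<longleftrightarrow> i < j" if "i \<in> {1..N}" "j \<in> {1..N}" for i j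
    using ord that strict_mono_on_less unfolding ordered_def by blast
  have mono': "km P 0 i < km P 0 j \<longleftrightarrow> i < j" if "i \<in> {1..M}" "j \<in> {1..M}" for i j
    using ord that strict_mono_on_less unfolding ordered_def by blast
  show "pole_height (Inl j) = yp P j" if j: "j \<in> {1..N}"
  proof -
    have "{i \<in> slit_index P. position P 0 (Inl j) < position P 0 i} = {j+1..N} <+> {0+1..M}"
      using mono[OF j] j kp_le_K[OF j, of 0] K_less_km[of _ 0]
      by (auto simp: Plus_def image_iff intro: le_less_trans)
    then show ?thesis
      unfolding pole_height_def using height_of_charges[of j 0] j by (simp add: ends yp_eq del: One_nat_def)
  qed
  show "pole_height (Inr j) = ym P j" if j: "j \<in> {1..M}"
  proof -
    have below: "\<not> km P 0 j < kp P 0 l" if "l \<in> {1..N}" for l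
      using kp_le_K[OF that, of 0] K_less_km[OF j, of 0] by linarith
    have "{i \<in> slit_index P. position P 0 (Inr j) < position P 0 i} = {N+1..N} <+> {j+1..M}"
      using mono'[OF j] j below by (auto simp: Plus_def image_iff)
    then show ?thesis
      unfolding pole_height_def using height_of_charges[of N j] j by (simp add: ends ym_eq del: One_nat_def)
  qed
qed

end

section \<open>Orbits of the tip points\<close>

lemma cmod_diff_of_real: "cmod (of_real a - of_real b) = \<bar>a - b\<bar>"
  by (metis norm_of_real of_real_diff)

lemma converges_to_real_by_angle_cong:
  assumes "converges_to_real_by_angle \<eta> \<theta>" "\<And>t. 0 \<le> t \<Longrightarrow> \<eta> t = \<eta>' t"
  shows "converges_to_real_by_angle \<eta>' \<theta>"
proof -
  have ev: "\<forall>\<^sub>F t in at_top. \<eta> t = \<eta>' t"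
    by (rule eventually_mono[OF eventually_ge_at_top[of 0]]) (rule assms(2))
  have "continuous_on {0..} \<eta> \<longleftrightarrow> continuous_on {0..} \<eta>'"
    using assms(2) by (intro continuous_on_cong) auto
  moreover have "(\<eta> \<longlongrightarrow> l) at_top \<longleftrightarrow> (\<eta>' \<longlongrightarrow> l) at_top" for l
    using ev by (rule tendsto_cong)
  moreover have "((\<lambda>t. Arg (\<eta> t - a)) \<longlongrightarrow> l) at_top \<longleftrightarrow> ((\<lambda>t. Arg (\<eta>' t - a)) \<longlongrightarrow> l) at_top" for l a
    by (rule tendsto_cong, rule eventually_mono[OF ev]) simp
  ultimately show ?thesis
    using assms unfolding converges_to_real_by_angle_def by simp
qed

context admissible_slits
begin

lemma Re_h_left_of_K:
  assumes "0 < u" "of_real (K - u) \<in> free_points (slit_index P) (position P t)"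
  shows "Re (h P t (of_real (K - u))) = gap_pot {1..N} (bp P) (\<lambda>j. ap j * exp (- \<theta>p j * t))
           {1..M} (bm P) (\<lambda>j. am j * exp (- thetam P j * t)) u"
proof -
  have "cmod (of_real (K - u) - of_real (kp P t j)) = \<bar>u - ap j * exp (- \<theta>p j * t)\<bar>" for j
    unfolding cmod_diff_of_real kp_eq by (simp add: abs_minus_commute)
  moreover have "cmod (of_real (K - u) - of_real (km P t j)) = u + am j * exp (- thetam P j * t)"
    if "j \<in> {1..M}" for j
  proof -
    have "cmod (of_real (K - u) - of_real (km P t j)) = \<bar>- (u + am j * exp (- thetam P j * t))\<bar>"
      unfolding cmod_diff_of_real km_eq by simp
    moreover have "0 < u + am j * exp (- thetam P j * t)"
      using assms(1) am_pos[OF that] by (simp add: add_pos_pos)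
    ultimately show ?thesis by linarith
  qed
  ultimately show ?thesis
    unfolding h_eq_log_pot Re_log_pot[OF assms(2)] gap_pot_def
    by (simp add: sum.Plus sum_negf del: of_real_diff One_nat_def)
qed

lemma Re_h_right_of_K:
  assumes "0 < u" "of_real (K + u) \<in> free_points (slit_index P) (position P t)"
  shows "- Re (h P t (of_real (K + u))) = gap_pot {1..M} (bm P) (\<lambda>j. am j * exp (- thetam P j * t))
           {1..N} (bp P) (\<lambda>j. ap j * exp (- \<theta>p j * t)) u"
proof -
  have "cmod (of_real (K + u) - of_real (km P t j)) = \<bar>u - am j * exp (- thetam P j * t)\<bar>" for j
    unfolding cmod_diff_of_real km_eq by simp
  moreover have "cmod (of_real (K + u) - of_real (kp P t j)) = u + ap j * exp (- \<theta>p j * t)"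
    if "j \<in> {1..N}" for j
  proof -
    have "cmod (of_real (K + u) - of_real (kp P t j)) = \<bar>u + ap j * exp (- \<theta>p j * t)\<bar>"
      unfolding cmod_diff_of_real kp_eq by simp
    then show ?thesis using assms(1) ap_nonneg[OF that] by simp
  qed
  ultimately show ?thesis
    unfolding h_eq_log_pot Re_log_pot[OF assms(2)] gap_pot_def
    by (simp add: sum.Plus sum_negf del: of_real_add One_nat_def)
qed

lemma rhop_maximal:
  assumes "ordered P t" "\<nu> \<in> {1..N - 1}" "kp P t \<nu> < x" "x < kp P t (\<nu> + 1)" "x \<noteq> rhop P \<nu> t"
  shows "Re (h P t (of_real x)) < Re (h P t (of_real (rhop P \<nu> t)))"
proof -
  interpret separated_charges "slit_index P" "charge P" "position P t" K
    by (rule separated_at[OF assms(1)])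
  have "kp P t (\<nu> + 1) \<le> K" using assms(2) by (intro kp_le_K) auto
  then have "x < K" using assms(4) by linarith
  then show ?thesis
    unfolding h_eq_log_pot
  proof (rule critical_value_extremal(1)[OF rhop(3)[OF assms(1,2)] assms(5), rotated])
    show "position P t i < min x (rhop P \<nu> t) \<or> max x (rhop P \<nu> t) < position P t i"
      if "i \<in> slit_index P" for i
      using gap_plus[OF assms(1-4) that] assms(3,4) rhop[OF assms(1,2)] by auto
  qed
qed

lemma rhom_minimal:
  assumes "ordered P t" "\<mu> \<in> {1..M}" "km P t \<mu> < x" "\<mu> < M \<longrightarrow> x < km P t (\<mu> + 1)" "x \<noteq> rhom P \<mu> t"
  shows "Re (h P t (of_real (rhom P \<mu> t))) < Re (h P t (of_real x))"
proof -
  interpret separated_charges "slit_index P" "charge P" "position P t" K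
    by (rule separated_at[OF assms(1)])
  have "K < x" using K_less_km[OF assms(2), of t] assms(3) by linarith
  then show ?thesis
    unfolding h_eq_log_pot
  proof (rule critical_value_extremal(2)[OF rhom(3)[OF assms(1,2)] assms(5), rotated])
    show "position P t i < min x (rhom P \<mu> t) \<or> max x (rhom P \<mu> t) < position P t i"
      if "i \<in> slit_index P" for i
      using gap_minus[OF assms(1-4) that] assms(3,4) rhom[OF assms(1,2)] by auto
  qed
qed

text \<open>The test position that bounds the rate from below moves with the left end of the gap, that is, with
  exponent \<open>\<theta>p \<nu>\<close>.\<close>

lemma plus_tip_growth:
  assumes \<nu>: "\<nu> \<in> {1..N - 1}"
  defines "\<Phi> \<equiv> \<lambda>t. Re (h P t (of_real (rhop P \<nu> t)))"
  shows "continuous_on {0..} \<Phi>"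
    and "\<exists>L. ((\<lambda>t. \<Phi> t / t) \<longlongrightarrow> L) at_top \<and> (\<forall>t\<ge>0. \<Phi> 0 + L * t \<le> \<Phi> t)"
proof -
  obtain T where past: "open T" "convex T" "{0..} \<subseteq> T" "\<And>t. t \<in> T \<Longrightarrow> ordered P t"
    using ordered_past by blast
  have \<nu>': "\<nu> \<in> {1..N}" "\<nu> + 1 \<in> {1..N}" "\<nu> < N" using \<nu> by auto
  let ?G = "\<lambda>t. gap_pot {1..N} (bp P) (\<lambda>j. ap j * exp (- \<theta>p j * t))
           {1..M} (bm P) (\<lambda>j. am j * exp (- thetam P j * t))"
  have Re_h: "Re (h P t (of_real x)) = ?G t (K - x)"
    if "t \<in> T" "kp P t \<nu> < x" "x < kp P t (\<nu> + 1)" for t x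
    using Re_h_left_of_K[of "K - x" t] gap_height_plus(1)[OF past(4)[OF that(1)] \<nu> that(2,3)]
      that(3) kp_le_K[OF \<nu>'(2), of t] by simp
  interpret moving_gap "{1..N}" "bp P" ap \<theta>p "{1..M}" "bm P" am "thetam P" "\<lambda>i. \<nu> < i" T "\<lambda>t. K - rhop P \<nu> t"
  proof
    fix t assume t: "t \<in> T"
    note ord = past(4)[OF t]
    note \<rho> = rhop(1,2)[OF ord \<nu>]
    show "0 < K - rhop P \<nu> t" using \<rho>(2) kp_le_K[OF \<nu>'(2), of t] by linarith
    show "if \<nu> < i then ap i * exp (- \<theta>p i * t) < K - rhop P \<nu> t
          else K - rhop P \<nu> t < ap i * exp (- \<theta>p i * t)" if "i \<in> {1..N}" for i
      using gap_plus[OF ord \<nu> \<rho> InlI[OF that]] \<rho> by (auto simp: kp_eq Plus_def)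
    show "?G t u \<le> ?G t (K - rhop P \<nu> t)"
      if u: "0 < u" "\<And>i. i \<in> {1..N} \<Longrightarrow> (if \<nu> < i then ap i * exp (- \<theta>p i * t) < u
          else u < ap i * exp (- \<theta>p i * t))" for u
    proof -
      have x: "kp P t \<nu> < K - u" "K - u < kp P t (\<nu> + 1)"
        using u(2)[OF \<nu>'(1)] u(2)[OF \<nu>'(2)] by (auto simp: kp_eq)
      have "Re (h P t (of_real (K - u))) \<le> Re (h P t (of_real (rhop P \<nu> t)))"
        using rhop_maximal[OF ord \<nu> x] by (cases "K - u = rhop P \<nu> t") auto
      then show ?thesis using Re_h[OF t x] Re_h[OF t \<rho>] by simp
    qed
  qed (use past weights_pos ap_nonneg am_pos in \<open>auto intro: less_imp_le\<close>)
  have \<Phi>: "top_value t = \<Phi> t" if "t \<in> T" for t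
    unfolding top_value_def \<Phi>_def using Re_h[OF that rhop(1,2)[OF past(4)[OF that] \<nu>]] by simp
  show "continuous_on {0..} \<Phi>"
    using top_value_continuous
    by (rule continuous_on_eq) (use \<Phi> past(3) in auto)
  have "top_value 0 - (\<Sum>i=1..N. bp P i) * \<theta>p \<nu> * t \<le> top_value t" if "0 \<le> t" for t
  proof (rule top_value_lower_bound[OF _ _ _ _ that])
    show "ap i = 0 \<or> \<theta>p \<nu> \<le> \<theta>p i" if "i \<in> {1..N}" "\<nu> < i" for i
      using that ap_N \<theta>p_mono[OF \<nu>'(1), of i] by (cases "i = N") auto
    show "\<theta>p i \<le> \<theta>p \<nu>" if "i \<in> {1..N}" "\<not> \<nu> < i" for i
      using that \<theta>p_mono[of i \<nu>] \<nu>'(3) by auto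
  qed (use \<theta>p_nonneg[OF \<nu>'(1)] thetam_nonneg in auto)
  then have "top_value 0 + (- ((\<Sum>i=1..N. bp P i) * \<theta>p \<nu>)) * t \<le> top_value t" if "0 \<le> t" for t
    using that by force
  then obtain L where L: "((\<lambda>t. top_value t / t) \<longlongrightarrow> L) at_top" "\<And>t. 0 \<le> t \<Longrightarrow> top_value 0 + L * t \<le> top_value t"
    "- ((\<Sum>i=1..N. bp P i) * \<theta>p \<nu>) \<le> L"
    using concave_slope[OF top_value_concave past(3)] by blast
  have eq: "top_value t = \<Phi> t" if "0 \<le> t" for t using \<Phi> past(3) that by auto
  have "((\<lambda>t. \<Phi> t / t) \<longlongrightarrow> L) at_top"
    by (rule Lim_transform_eventually[OF L(1)])
       (rule eventually_mono[OF eventually_ge_at_top[of 0]], simp only: eq)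
  then show "\<exists>L. ((\<lambda>t. \<Phi> t / t) \<longlongrightarrow> L) at_top \<and> (\<forall>t\<ge>0. \<Phi> 0 + L * t \<le> \<Phi> t)"
    using L(2) eq by (intro exI[of _ L]) auto
qed

text \<open>The sign is reversed in order to treat a minimum as a maximum. The gap of the last critical point is
  unbounded, so the test position can stay at rest there, whence \<open>0 \<le> L\<close>.\<close>

lemma minus_tip_growth:
  assumes \<mu>: "\<mu> \<in> {1..M}"
  defines "\<Phi> \<equiv> \<lambda>t. - Re (h P t (of_real (rhom P \<mu> t)))"
  shows "continuous_on {0..} \<Phi>"
    and "\<exists>L. ((\<lambda>t. \<Phi> t / t) \<longlongrightarrow> L) at_top \<and> (\<forall>t\<ge>0. \<Phi> 0 + L * t \<le> \<Phi> t) \<and> (\<mu> = M \<longrightarrow> 0 \<le> L)"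
proof -
  obtain T where past: "open T" "convex T" "{0..} \<subseteq> T" "\<And>t. t \<in> T \<Longrightarrow> ordered P t"
    using ordered_past by blast
  let ?G = "\<lambda>t. gap_pot {1..M} (bm P) (\<lambda>j. am j * exp (- thetam P j * t))
           {1..N} (bp P) (\<lambda>j. ap j * exp (- \<theta>p j * t))"
  have Re_h: "- Re (h P t (of_real x)) = ?G t (x - K)"
    if "t \<in> T" "km P t \<mu> < x" "\<mu> < M \<longrightarrow> x < km P t (\<mu> + 1)" for t x
    using Re_h_right_of_K[of "x - K" t] gap_height_minus(1)[OF past(4)[OF that(1)] \<mu> that(2,3)]
      that(2) K_less_km[OF \<mu>, of t] by simp
  interpret moving_gap "{1..M}" "bm P" am "thetam P" "{1..N}" "bp P" ap \<theta>p "\<lambda>i. i \<le> \<mu>" T "\<lambda>t. rhom P \<mu> t - K"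
  proof
    fix t assume t: "t \<in> T"
    note ord = past(4)[OF t]
    note \<rho> = rhom(1,2)[OF ord \<mu>]
    show "0 < rhom P \<mu> t - K" using \<rho>(1) K_less_km[OF \<mu>, of t] by linarith
    show "if i \<le> \<mu> then am i * exp (- thetam P i * t) < rhom P \<mu> t - K
          else rhom P \<mu> t - K < am i * exp (- thetam P i * t)" if "i \<in> {1..M}" for i
      using gap_minus[OF ord \<mu> \<rho> InrI[OF that]] \<rho> by (auto simp: km_eq Plus_def)
    show "?G t u \<le> ?G t (rhom P \<mu> t - K)"
      if u: "0 < u" "\<And>i. i \<in> {1..M} \<Longrightarrow> (if i \<le> \<mu> then am i * exp (- thetam P i * t) < u
          else u < am i * exp (- thetam P i * t))" for u
    proof -
      have x: "km P t \<mu> < K + u" "\<mu> < M \<longrightarrow> K + u < km P t (\<mu> + 1)"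
        using u(2)[OF \<mu>] u(2)[of "\<mu> + 1"] by (auto simp: km_eq)
      have "Re (h P t (of_real (rhom P \<mu> t))) \<le> Re (h P t (of_real (K + u)))"
        using rhom_minimal[OF ord \<mu> x] by (cases "K + u = rhom P \<mu> t") auto
      then show ?thesis using Re_h[OF t x] Re_h[OF t \<rho>] by simp
    qed
  qed (use past weights_pos ap_nonneg am_pos in \<open>auto intro: less_imp_le\<close>)
  have \<Phi>: "top_value t = \<Phi> t" if "t \<in> T" for t
    unfolding top_value_def \<Phi>_def using Re_h[OF that rhom(1,2)[OF past(4)[OF that] \<mu>]] by simp
  show "continuous_on {0..} \<Phi>"
    using top_value_continuous
    by (rule continuous_on_eq) (use \<Phi> past(3) in auto)
  define \<sigma> where "\<sigma> = (if \<mu> = M then 0 else thetam P \<mu>)"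
  have "top_value 0 - (\<Sum>i=1..M. bm P i) * \<sigma> * t \<le> top_value t" if "0 \<le> t" for t
  proof (rule top_value_lower_bound[OF _ _ _ _ that])
    show "am i = 0 \<or> \<sigma> \<le> thetam P i" if "i \<in> {1..M}" "i \<le> \<mu>" for i
      using that thetam_nonneg thetam_antimono[OF _ \<mu>, of i] by (auto simp: \<sigma>_def)
    show "thetam P i \<le> \<sigma>" if "i \<in> {1..M}" "\<not> i \<le> \<mu>" for i
      using that thetam_antimono[OF \<mu>, of i] by (auto simp: \<sigma>_def)
  qed (use \<theta>p_nonneg thetam_nonneg[OF \<mu>] in \<open>auto simp: \<sigma>_def\<close>)
  then have "top_value 0 + (- ((\<Sum>i=1..M. bm P i) * \<sigma>)) * t \<le> top_value t" if "0 \<le> t" for t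
    using that by force
  then obtain L where L: "((\<lambda>t. top_value t / t) \<longlongrightarrow> L) at_top" "\<And>t. 0 \<le> t \<Longrightarrow> top_value 0 + L * t \<le> top_value t"
    "- ((\<Sum>i=1..M. bm P i) * \<sigma>) \<le> L"
    using concave_slope[OF top_value_concave past(3)] by blast
  have eq: "top_value t = \<Phi> t" if "0 \<le> t" for t using \<Phi> past(3) that by auto
  have "((\<lambda>t. \<Phi> t / t) \<longlongrightarrow> L) at_top"
    by (rule Lim_transform_eventually[OF L(1)])
       (rule eventually_mono[OF eventually_ge_at_top[of 0]], simp only: eq)
  then show "\<exists>L. ((\<lambda>t. \<Phi> t / t) \<longlongrightarrow> L) at_top \<and> (\<forall>t\<ge>0. \<Phi> 0 + L * t \<le> \<Phi> t) \<and> (\<mu> = M \<longrightarrow> 0 \<le> L)"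
    using L(2,3) eq by (intro exI[of _ L]) (auto simp: \<sigma>_def)
qed

text \<open>The free part of the line at height \<open>y\<^sup>+\<^sub>\<nu>\<close> goes to the right, where \<open>h\<^sub>0\<close> approaches the negative charge
  \<open>k\<^sup>-\<^sub>\<mu>\<close> whose strip contains the line.\<close>

lemma plus_orbit:
  assumes \<nu>: "\<nu> \<in> {1..N - 1}" and \<mu>: "\<mu> \<in> {1..M}" and strip: "head_m (\<mu> - 1) < tail_p \<nu>" "tail_p \<nu> < head_m \<mu>"
    and \<gamma>: "ereal \<gamma> < min_rate_plus P"
  defines "\<alpha> \<equiv> pi * ((head_m \<mu> - tail_p \<nu>) / bm P \<mu>)"
  shows "0 < \<alpha> \<and> \<alpha> < pi \<and> converges_to_real_by_angle (Gammap P \<gamma> \<nu>) \<alpha>"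
proof -
  have bm: "0 < bm P \<mu>" using weights_pos(2)[OF \<mu>] .
  have pos: "0 < \<alpha>" using strip bm by (simp add: \<alpha>_def)
  have "(head_m \<mu> - tail_p \<nu>) / bm P \<mu> < 1" using strip(1) head_m_step[OF \<mu>] bm by simp
  then have less: "\<alpha> < pi" unfolding \<alpha>_def using mult_strict_left_mono[OF _ pi_gt_zero] by fastforce
  have ord: "ordered P t" if "0 \<le> t" for t using that by (rule ordered_forward)
  interpret separated_charges "slit_index P" "charge P" "position P 0" K
    by (rule separated_at[OF ord[OF order_refl]])
  define \<Phi> where "\<Phi> t = Re (h P t (of_real (rhop P \<nu> t)))" for t
  obtain L where L: "((\<lambda>t. \<Phi> t / t) \<longlongrightarrow> L) at_top" "\<And>t. 0 \<le> t \<Longrightarrow> \<Phi> 0 + L * t \<le> \<Phi> t"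
    using plus_tip_growth(2)[OF \<nu>] unfolding \<Phi>_def by blast
  have "rate P (rhop P \<nu>) = L"
    unfolding rate_def using L(1) by (intro tendsto_Lim) (auto simp: \<Phi>_def)
  then have "min_rate_plus P \<le> ereal L"
    unfolding min_rate_plus_def using \<nu> by (metis INF_lower)
  with \<gamma> have "\<gamma> < L" using less_le_trans by fastforce
  define W where "W t = \<Phi> t - \<gamma> * t" for t
  have W_lower: "\<Phi> 0 + (L - \<gamma>) * t \<le> W t" if "0 \<le> t" for t
    using L(2)[OF that] by (simp add: W_def algebra_simps)
  have "continuous_on {0..} \<Phi>"
    unfolding \<Phi>_def by (rule plus_tip_growth(1)[OF \<nu>])
  then have W_cont: "continuous_on {0..} W"
    unfolding W_def by (intro continuous_intros)
  have "filterlim (\<lambda>t. \<Phi> 0 + (L - \<gamma>) * t) at_top at_top"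
    using \<open>\<gamma> < L\<close>
    by (intro filterlim_tendsto_add_at_top[OF tendsto_const] filterlim_tendsto_pos_mult_at_top[OF tendsto_const]
        filterlim_ident) auto
  then have W_top: "filterlim W at_top at_top"
    by (rule filterlim_at_top_mono) (rule eventually_mono[OF eventually_ge_at_top[of 0]], rule W_lower)
  define y where "y = yp P \<nu>"
  have Im_tip: "Im (h P t (of_real (rhop P \<nu> t))) = y" if "0 \<le> t" for t
    unfolding y_def by (rule gap_height_plus(2)[OF ord[OF that] \<nu> rhop(1,2)[OF ord[OF that] \<nu>]])
  have "approach_height (Inr \<mu>) y"
    unfolding approach_height_def
  proof (intro conjI ballI impI)
    have h\<mu>: "\<mu> \<le> M" "\<mu> - 1 \<le> M" using \<mu> by auto
    show "Inr \<mu> \<in> slit_index P" using \<mu> by auto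
    show "charge P (Inr \<mu>) < 0" using bm by simp
    show "y < pole_height (Inr \<mu>)"
      unfolding pole_heights(2)[OF \<mu>] y_def yp_eq ym_eq[OF h\<mu>(1)] using strip by simp
    have "pi * (head_m \<mu> - bm_total P) - pi * bm P \<mu> = pi * (head_m (\<mu> - 1) - bm_total P)"
      using head_m_step[OF \<mu>] by (simp add: algebra_simps)
    also have "\<dots> < y" using strip by (simp add: y_def yp_eq)
    finally show "pole_height (Inr \<mu>) + pi * charge P (Inr \<mu>) < y"
      unfolding pole_heights(2)[OF \<mu>] ym_eq[OF h\<mu>(1)] by simp
    have "\<nu> \<le> N" "1 \<le> \<nu>" using \<nu> by auto
    then show "y < 0" using tail_p_mono[of 1 \<nu>] totals by (simp add: y_def yp_eq mult_less_0_iff)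
    fix i assume i: "i \<in> slit_index P" "i \<noteq> Inr \<mu>" "charge P i < 0"
    have "charge P (Inl j) > 0" if "j \<in> {1..N}" for j using weights_pos(1)[OF that] by simp
    with i(1,3) have "i \<notin> Inl ` {1..N}" by fastforce
    with i(1,2) obtain j where j: "i = Inr j" "j \<in> {1..M}" "j \<noteq> \<mu>"
      by (auto simp only: Plus_def)
    have ph: "pole_height i = pi * (head_m j - bm_total P)"
      "pole_height i + pi * charge P i = pi * (head_m (j - 1) - bm_total P)"
      using j head_m_step[OF j(2)] unfolding j(1) pole_heights(2)[OF j(2)]
      by (simp_all add: ym_eq algebra_simps)
    show "y < pole_height i + pi * charge P i \<or> pole_height i < y"
    proof (cases "j < \<mu>")
      case True
      then have "j \<le> \<mu> - 1" by simp
      then have "head_m j < tail_p \<nu>" using head_m_mono[of j "\<mu> - 1"] h\<mu> strip(1) by linarith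
      then show ?thesis unfolding ph by (simp add: y_def yp_eq)
    next
      case False
      then have "\<mu> \<le> j - 1" "j - 1 \<le> M" using j by auto
      then have "tail_p \<nu> < head_m (j - 1)" using head_m_mono[of \<mu> "j - 1"] strip(2) by linarith
      then show ?thesis unfolding ph(2) by (simp add: y_def yp_eq)
    qed
  qed
  have "converges_to_real_by_angle
      (\<lambda>t. if t = 0 then of_real (rhop P \<nu> 0) else inv_into {z. 0 < Im z} f (Complex (W t) y))
      ((y - pole_height (Inr \<mu>)) / charge P (Inr \<mu>))"
  proof (rule inverse_half_line_converges[OF _ inj_on_upper \<open>approach_height (Inr \<mu>) y\<close> _ _ _ _ W_cont _ _ W_top])
    show "net_charge \<noteq> 0" using net_charge_pos by simp
    show free: "of_real (rhop P \<nu> 0) \<in> \<Omega>"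
      by (rule gap_height_plus(1)[OF ord[OF order_refl] \<nu> rhop(1,2)[OF ord[OF order_refl] \<nu>]])
    show "Im (f (of_real (rhop P \<nu> 0))) = y"
      using Im_tip[OF order_refl] by (simp add: h_eq_log_pot)
    show "Re (f (of_real x)) < Re (f (of_real (rhop P \<nu> 0)))"
      if "of_real x \<in> \<Omega>" "Im (f (of_real x)) = y" "x \<noteq> rhop P \<nu> 0" for x
      using rhop_maximal[OF ord[OF order_refl] \<nu>, of x] that
        height_determines_gap_plus[OF ord[OF order_refl] \<nu>, of x]
      by (simp add: h_eq_log_pot y_def)
    show "f z \<noteq> f (of_real (rhop P \<nu> 0))" if "0 < Im z" for z
      using log_pot_eq_imp_eq[OF that free] that by auto
    show "W 0 = Re (f (of_real (rhop P \<nu> 0)))"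
      by (simp add: W_def \<Phi>_def h_eq_log_pot)
    fix t :: real assume "0 < t"
    then have "0 < (L - \<gamma>) * t" using \<open>\<gamma> < L\<close> by simp
    then show "Re (f (of_real (rhop P \<nu> 0))) < W t"
      using W_lower[of t] \<open>0 < t\<close> by (simp add: \<Phi>_def h_eq_log_pot)
  qed
  then have "converges_to_real_by_angle (Gammap P \<gamma> \<nu>) ((y - pole_height (Inr \<mu>)) / charge P (Inr \<mu>))"
  proof (rule converges_to_real_by_angle_cong)
    fix t :: real assume "0 \<le> t"
    have "h P t (of_real (rhop P \<nu> t)) - of_real (\<gamma> * t) = Complex (W t) y"
      using Im_tip[OF \<open>0 \<le> t\<close>] by (simp add: complex_eq_iff W_def \<Phi>_def)
    then show "(if t = 0 then of_real (rhop P \<nu> 0) else inv_into {z. 0 < Im z} f (Complex (W t) y))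
        = Gammap P \<gamma> \<nu> t" by (simp add: tip_orbit_def h_eq_log_pot)
  qed
  moreover have "(y - pole_height (Inr \<mu>)) / charge P (Inr \<mu>) = \<alpha>"
    unfolding pole_heights(2)[OF \<mu>] y_def yp_eq \<alpha>_def using \<mu> bm by (simp add: ym_eq field_simps)
  ultimately show ?thesis using pos less by simp
qed

text \<open>The free part of the line at height \<open>y\<^sup>-\<^sub>\<mu>\<close> goes to the left, where \<open>h\<^sub>0\<close> approaches the positive charge
  \<open>k\<^sup>+\<^sub>\<nu>\<close> whose strip contains the line. The general statement applies to \<open>- h\<^sub>0\<close>. The last tip is
  not controlled by \<open>max_rate_minus\<close>, but there \<open>0 \<le> L\<close> and \<open>\<gamma> > 0\<close> suffice.\<close>

lemma minus_orbit:
  assumes \<mu>: "\<mu> \<in> {1..M}" and \<nu>: "\<nu> \<in> {1..N}" and strip: "tail_p \<nu> < head_m \<mu>" "head_m \<mu> < tail_p (\<nu> - 1)"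
    and \<gamma>: "0 < \<gamma>" "max_rate_minus P < ereal \<gamma>"
  defines "\<alpha> \<equiv> pi * ((head_m \<mu> - tail_p \<nu>) / bp P \<nu>)"
  shows "0 < \<alpha> \<and> \<alpha> < pi \<and> converges_to_real_by_angle (Gammam P \<gamma> \<mu>) \<alpha>"
proof -
  have bp: "0 < bp P \<nu>" using weights_pos(1)[OF \<nu>] .
  have pos: "0 < \<alpha>" using strip bp by (simp add: \<alpha>_def)
  have "(head_m \<mu> - tail_p \<nu>) / bp P \<nu> < 1" using strip(2) tail_p_step[OF \<nu>] bp by simp
  then have less: "\<alpha> < pi" unfolding \<alpha>_def using mult_strict_left_mono[OF _ pi_gt_zero] by fastforce
  have ord: "ordered P t" if "0 \<le> t" for t using that by (rule ordered_forward)
  interpret separated_charges "slit_index P" "charge P" "position P 0" K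
    by (rule separated_at[OF ord[OF order_refl]])
  interpret minus: charges "slit_index P" "\<lambda>i. - charge P i" "position P 0"
    by (rule uminus_charges)
  have minus_height: "minus.pole_height i = - pole_height i" for i
    unfolding minus.pole_height_def pole_height_def by (simp add: sum_negf)
  define \<Phi> where "\<Phi> t = - Re (h P t (of_real (rhom P \<mu> t)))" for t
  obtain L where L: "((\<lambda>t. \<Phi> t / t) \<longlongrightarrow> L) at_top" "\<And>t. 0 \<le> t \<Longrightarrow> \<Phi> 0 + L * t \<le> \<Phi> t"
    "\<mu> = M \<Longrightarrow> 0 \<le> L"
    using minus_tip_growth(2)[OF \<mu>] unfolding \<Phi>_def by blast
  have "0 < L + \<gamma>"
  proof (cases "\<mu> = M")
    case True
    then show ?thesis using L(3) \<gamma>(1) by simp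
  next
    case False
    have "((\<lambda>t. - (\<Phi> t / t)) \<longlongrightarrow> - L) at_top" using L(1) by (rule tendsto_minus)
    then have "rate P (rhom P \<mu>) = - L"
      unfolding rate_def by (intro tendsto_Lim) (auto simp: \<Phi>_def)
    then have "ereal (- L) \<le> max_rate_minus P"
      unfolding max_rate_minus_def using \<mu> False by (intro SUP_upper2[of \<mu>]) auto
    then have "ereal (- L) < ereal \<gamma>" using \<gamma>(2) by (rule le_less_trans)
    then show ?thesis by simp
  qed
  define W where "W t = \<Phi> t + \<gamma> * t" for t
  have W_lower: "\<Phi> 0 + (L + \<gamma>) * t \<le> W t" if "0 \<le> t" for t
    using L(2)[OF that] by (simp add: W_def algebra_simps)
  have "continuous_on {0..} \<Phi>"
    unfolding \<Phi>_def by (rule minus_tip_growth(1)[OF \<mu>])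
  then have W_cont: "continuous_on {0..} W"
    unfolding W_def by (intro continuous_intros)
  have "filterlim (\<lambda>t. \<Phi> 0 + (L + \<gamma>) * t) at_top at_top"
    using \<open>0 < L + \<gamma>\<close>
    by (intro filterlim_tendsto_add_at_top[OF tendsto_const] filterlim_tendsto_pos_mult_at_top[OF tendsto_const]
        filterlim_ident) auto
  then have W_top: "filterlim W at_top at_top"
    by (rule filterlim_at_top_mono) (rule eventually_mono[OF eventually_ge_at_top[of 0]], rule W_lower)
  have h\<mu>: "\<mu> \<le> M" using \<mu> by auto
  define y where "y = - ym P \<mu>"
  have y_eq: "y = pi * (bm_total P - head_m \<mu>)" by (simp add: y_def ym_eq h\<mu> algebra_simps)
  have Im_tip: "Im (h P t (of_real (rhom P \<mu> t))) = - y" if "0 \<le> t" for t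
    unfolding y_def using gap_height_minus(2)[OF ord[OF that] \<mu> rhom(1,2)[OF ord[OF that] \<mu>]] by simp
  have "minus.approach_height (Inl \<nu>) y"
    unfolding minus.approach_height_def minus_height
  proof (intro conjI ballI impI)
    show "Inl \<nu> \<in> slit_index P" using \<nu> by auto
    show "- charge P (Inl \<nu>) < 0" using bp by simp
    show "y < - pole_height (Inl \<nu>)"
      unfolding pole_heights(1)[OF \<nu>] y_eq yp_eq using strip by (simp flip: mult_minus_right)
    have "- pole_height (Inl \<nu>) + pi * - charge P (Inl \<nu>) = pi * (bm_total P - tail_p (\<nu> - 1))"
      unfolding pole_heights(1)[OF \<nu>] yp_eq using tail_p_step[OF \<nu>] by (simp add: algebra_simps)
    also have "\<dots> < y" using strip by (simp add: y_eq)
    finally show "- pole_height (Inl \<nu>) + pi * - charge P (Inl \<nu>) < y" .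
    show "y < 0" if "0 < (\<Sum>i\<in>slit_index P. - charge P i)"
      using that net_charge_pos by (simp add: sum_negf)
    fix i assume i: "i \<in> slit_index P" "i \<noteq> Inl \<nu>" "- charge P i < 0"
    have "- charge P (Inr j) > 0" if "j \<in> {1..M}" for j using weights_pos(2)[OF that] by simp
    with i(1,3) have "i \<notin> Inr ` {1..M}" by fastforce
    with i(1,2) obtain j where j: "i = Inl j" "j \<in> {1..N}" "j \<noteq> \<nu>"
      by (auto simp only: Plus_def)
    have ph: "- pole_height i = pi * (bm_total P - tail_p j)"
      "- pole_height i + pi * - charge P i = pi * (bm_total P - tail_p (j - 1))"
      using tail_p_step[OF j(2)] unfolding j(1) pole_heights(1)[OF j(2)] yp_eq
      by (simp_all add: algebra_simps)
    show "y < - pole_height i + pi * - charge P i \<or> - pole_height i < y"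
    proof (cases "j < \<nu>")
      case True
      then have "j \<le> \<nu> - 1" "\<nu> - 1 \<le> N" using \<nu> by auto
      then have "head_m \<mu> < tail_p j" using tail_p_mono[of j "\<nu> - 1"] strip(2) by linarith
      then show ?thesis unfolding ph by (simp add: y_eq)
    next
      case False
      then have "\<nu> \<le> j - 1" "j - 1 \<le> N" using j by auto
      then have "tail_p (j - 1) < head_m \<mu>" using tail_p_mono[of \<nu> "j - 1"] strip(1) by linarith
      then show ?thesis unfolding ph(2) by (simp add: y_eq)
    qed
  qed
  have "converges_to_real_by_angle
      (\<lambda>t. if t = 0 then of_real (rhom P \<mu> 0) else inv_into {z. 0 < Im z} minus.f (Complex (W t) y))
      ((y - minus.pole_height (Inl \<nu>)) / - charge P (Inl \<nu>))"
  proof (rule minus.inverse_half_line_converges[OF _ _ \<open>minus.approach_height (Inl \<nu>) y\<close> _ _ _ _ W_cont _ _ W_top])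
    show "(\<Sum>i\<in>slit_index P. - charge P i) \<noteq> 0" using net_charge_pos by (simp add: sum_negf)
    show "inj_on minus.f {z. 0 < Im z}"
      using inj_on_upper by (simp add: inj_on_def log_pot_uminus)
    show free: "of_real (rhom P \<mu> 0) \<in> \<Omega>"
      by (rule gap_height_minus(1)[OF ord[OF order_refl] \<mu> rhom(1,2)[OF ord[OF order_refl] \<mu>]])
    show "Im (minus.f (of_real (rhom P \<mu> 0))) = y"
      using Im_tip[OF order_refl] by (simp add: h_eq_log_pot log_pot_uminus)
    show "Re (minus.f (of_real x)) < Re (minus.f (of_real (rhom P \<mu> 0)))"
      if "of_real x \<in> \<Omega>" "Im (minus.f (of_real x)) = y" "x \<noteq> rhom P \<mu> 0" for x
      using rhom_minimal[OF ord[OF order_refl] \<mu>, of x] that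
        height_determines_gap_minus[OF ord[OF order_refl] \<mu>, of x]
      by (simp add: h_eq_log_pot y_def log_pot_uminus)
    show "minus.f z \<noteq> minus.f (of_real (rhom P \<mu> 0))" if "0 < Im z" for z
      using log_pot_eq_imp_eq[OF that free] that by (auto simp: log_pot_uminus)
    show "W 0 = Re (minus.f (of_real (rhom P \<mu> 0)))"
      by (simp add: W_def \<Phi>_def h_eq_log_pot log_pot_uminus)
    fix t :: real assume "0 < t"
    then have "0 < (L + \<gamma>) * t" using \<open>0 < L + \<gamma>\<close> by simp
    then show "Re (minus.f (of_real (rhom P \<mu> 0))) < W t"
      using W_lower[of t] \<open>0 < t\<close> by (simp add: \<Phi>_def h_eq_log_pot log_pot_uminus)
  qed
  then have "converges_to_real_by_angle (Gammam P \<gamma> \<mu>) ((y - minus.pole_height (Inl \<nu>)) / - charge P (Inl \<nu>))"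
  proof (rule converges_to_real_by_angle_cong)
    fix t :: real assume "0 \<le> t"
    have "h P t (of_real (rhom P \<mu> t)) - of_real (\<gamma> * t) = - Complex (W t) y"
      using Im_tip[OF \<open>0 \<le> t\<close>] by (simp add: complex_eq_iff W_def \<Phi>_def)
    moreover have "inv_into A minus.f w = inv_into A f (- w)" for A w
    proof -
      have "minus.f z = w \<longleftrightarrow> f z = - w" for z by (auto simp: log_pot_uminus)
      then show ?thesis by (simp only: inv_into_def)
    qed
    ultimately show "(if t = 0 then of_real (rhom P \<mu> 0) else inv_into {z. 0 < Im z} minus.f (Complex (W t) y))
        = Gammam P \<gamma> \<mu> t" by (simp add: tip_orbit_def h_eq_log_pot)
  qed
  moreover have "(y - minus.pole_height (Inl \<nu>)) / - charge P (Inl \<nu>) = \<alpha>"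
    unfolding minus_height pole_heights(1)[OF \<nu>] y_eq yp_eq \<alpha>_def using bp by (simp add: field_simps)
  ultimately show ?thesis using pos less by simp
qed


section \<open>Strips containing the critical values\<close>

lemma mu_index:
  assumes "\<nu> \<in> {1..N - 1}"
  shows "mu_index P \<nu> \<in> {1..M}" "head_m (mu_index P \<nu> - 1) < tail_p \<nu>" "tail_p \<nu> < head_m (mu_index P \<nu>)"
proof -
  have \<nu>: "1 \<le> \<nu>" "\<nu> < N" using assms NM by auto
  have below_top: "tail_p \<nu> < head_m M"
    using tail_p_mono[of 1 \<nu>] \<nu> totals(2) ends by simp
  define \<mu> where "\<mu> = (LEAST \<mu>. tail_p \<nu> < head_m \<mu>)"
  have \<mu>: "tail_p \<nu> < head_m \<mu>" unfolding \<mu>_def using below_top by (rule LeastI)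
  have "\<mu> \<le> M" unfolding \<mu>_def using below_top by (rule Least_le)
  have "0 < tail_p \<nu>" using tail_p_less[of \<nu> N] \<nu> ends by simp
  then have "\<mu> \<noteq> 0" using \<mu> ends(3) by (intro notI) simp
  have "\<not> tail_p \<nu> < head_m (\<mu> - 1)"
    unfolding \<mu>_def by (rule not_less_Least) (use \<open>\<mu> \<noteq> 0\<close> in \<open>simp add: \<mu>_def\<close>)
  moreover have "head_m (\<mu> - 1) \<noteq> tail_p \<nu>"
  proof (cases "\<mu> - 1 = 0")
    case True
    then show ?thesis using \<open>0 < tail_p \<nu>\<close> ends(3) by (simp only: True)
  next
    case False
    then have "\<mu> - 1 \<in> {1..M}" using \<open>\<mu> \<le> M\<close>
      unfolding atLeastAtMost_iff by linarith
    then show ?thesis using heights_distinct[OF assms] by metis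
  qed
  ultimately have "head_m (\<mu> - 1) < tail_p \<nu>" by linarith
  then have ex: "\<mu> \<in> {1..M} \<and> head_m (\<mu> - 1) < tail_p \<nu> \<and> tail_p \<nu> < head_m \<mu>"
    using \<mu> \<open>\<mu> \<le> M\<close> \<open>\<mu> \<noteq> 0\<close> by auto
  have "\<exists>!\<mu>. \<mu> \<in> {1..M} \<and> head_m (\<mu> - 1) < tail_p \<nu> \<and> tail_p \<nu> < head_m \<mu>"
  proof (rule ex1I[of _ \<mu>], rule ex)
    fix m assume m: "m \<in> {1..M} \<and> head_m (m - 1) < tail_p \<nu> \<and> tail_p \<nu> < head_m m"
    have "\<mu> - 1 \<le> M" "m - 1 \<le> M" using m ex by auto
    then have "head_m m \<le> head_m (\<mu> - 1)" if "m < \<mu>"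
      using that by (intro head_m_mono) simp_all
    moreover have "head_m \<mu> \<le> head_m (m - 1)" if "\<mu> < m"
      using that \<open>m - 1 \<le> M\<close> by (intro head_m_mono) simp_all
    ultimately show "m = \<mu>" using m ex by (cases m \<mu> rule: linorder_cases) force+
  qed
  from theI'[OF this] show "mu_index P \<nu> \<in> {1..M}" "head_m (mu_index P \<nu> - 1) < tail_p \<nu>"
    "tail_p \<nu> < head_m (mu_index P \<nu>)"
    unfolding mu_index_def head_m_def[symmetric] tail_p_def[symmetric] by auto
qed

lemma mu_index_antimono:
  assumes "i \<in> {1..N - 1}" "j \<in> {1..N - 1}" "i \<le> j"
  shows "mu_index P j \<le> mu_index P i"
proof (rule ccontr)
  assume "\<not> mu_index P j \<le> mu_index P i"
  then have "head_m (mu_index P i) \<le> head_m (mu_index P j - 1)"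
    using mu_index(1)[OF assms(2)] by (intro head_m_mono) auto
  moreover have "tail_p j \<le> tail_p i" using assms by (intro tail_p_mono) auto
  ultimately show False using mu_index(3)[OF assms(1)] mu_index(2)[OF assms(2)] by linarith
qed

lemma is_nu_range: "is_nu P \<omega> \<nu> \<Longrightarrow> \<nu> \<in> {1..N - 1}"
proof (induction rule: is_nu.induct)
  case is_nu_first
  then show ?case using NM by simp
next
  case (is_nu_next \<omega> \<nu>)
  have "finite (later_drops P \<nu>)" by (simp add: later_drops_def)
  then show ?case
    using Min_in[OF _ is_nu_next(2)] by (auto simp: later_drops_def)
qed

text \<open>Take the last term of the sequence before \<open>\<nu>\<close>. Its set of later drops contains \<open>\<nu>\<close>, so the sequence
  continues, and by maximality it continues at \<open>\<nu>\<close>.\<close>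

lemma drop_is_nu:
  assumes "\<nu> \<in> {2..N - 1}" "mu_index P \<nu> < mu_index P (\<nu> - 1)"
  shows "\<exists>\<omega>. is_nu P \<omega> \<nu>"
proof -
  define S where "S = {n. n \<le> \<nu> - 1 \<and> (\<exists>\<omega>. is_nu P \<omega> n)}"
  have "1 \<in> S" using assms is_nu_first by (auto simp: S_def)
  moreover have fin: "finite S" by (rule finite_subset[of _ "{..\<nu> - 1}"]) (auto simp: S_def)
  ultimately have "Max S \<in> S" using Max_in by blast
  then obtain \<omega> where n: "Max S \<le> \<nu> - 1" "is_nu P \<omega> (Max S)" by (auto simp: S_def)
  have "mu_index P (\<nu> - 1) \<le> mu_index P (Max S)"
    using is_nu_range[OF n(2)] n(1) assms(1) by (intro mu_index_antimono) auto
  then have drop: "\<nu> \<in> later_drops P (Max S)"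
    using assms n(1) by (auto simp: later_drops_def)
  have fin': "finite (later_drops P (Max S))" by (simp add: later_drops_def)
  have next_nu: "is_nu P (Suc \<omega>) (Min (later_drops P (Max S)))"
    using n(2) drop by (intro is_nu_next) auto
  have "Max S < Min (later_drops P (Max S))"
  proof -
    have "n < n'" if "n' \<in> later_drops P n" for n n' using that by (simp add: later_drops_def)
    then show ?thesis using Min_in[OF fin'] drop by blast
  qed
  then have "Min (later_drops P (Max S)) \<notin> S" using Max_ge[OF fin] by (meson not_le)
  then have "\<nu> - 1 < Min (later_drops P (Max S))" using next_nu by (auto simp: S_def)
  moreover have "Min (later_drops P (Max S)) \<le> \<nu>" using fin' drop by (rule Min_le)
  ultimately have "Min (later_drops P (Max S)) = \<nu>" using assms by simp
  then show ?thesis using next_nu by auto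
qed

text \<open>The first \<open>\<nu>\<close> whose slit lies below the tip is an index where \<open>mu_index\<close> drops, because the height
  of the tip separates \<open>y\<^sup>+\<^sub>\<nu>\<close> from \<open>y\<^sup>+\<^sub>\<nu>\<^sub>-\<^sub>1\<close> and is itself an edge between two strips of right poles.\<close>

lemma strip_of_middle_tip:
  assumes "\<mu> \<in> {mu_index P (N - 1)..<mu_index P 1}"
  obtains \<omega> \<nu> where "is_nu P \<omega> \<nu>" "tail_p \<nu> < head_m \<mu>" "head_m \<mu> < tail_p (\<nu> - 1)"
proof -
  have ends': "1 \<in> {1..N - 1}" "N - 1 \<in> {1..N - 1}" using NM by auto
  have \<mu>: "\<mu> \<in> {1..M}" using assms mu_index(1)[OF ends'(1)] mu_index(1)[OF ends'(2)] by auto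
  define \<nu> where "\<nu> = (LEAST \<nu>. tail_p \<nu> < head_m \<mu>)"
  have low: "tail_p (N - 1) < head_m \<mu>"
    using mu_index(3)[OF ends'(2)] head_m_mono[of "mu_index P (N - 1)" \<mu>] assms \<mu> by auto
  have \<nu>: "tail_p \<nu> < head_m \<mu>" unfolding \<nu>_def using low by (rule LeastI)
  have "\<nu> \<le> N - 1" unfolding \<nu>_def using low by (rule Least_le)
  have "head_m \<mu> \<le> head_m (mu_index P 1 - 1)"
    using assms mu_index(1)[OF ends'(1)] by (intro head_m_mono) auto
  then have high: "head_m \<mu> < tail_p 1" using mu_index(2)[OF ends'(1)] by linarith
  have "2 \<le> \<nu>"
  proof (rule ccontr)
    assume "\<not> 2 \<le> \<nu>"
    then have "tail_p 1 \<le> tail_p \<nu>" using NM by (intro tail_p_mono) auto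
    then show False using \<nu> high by linarith
  qed
  then have range: "\<nu> \<in> {2..N - 1}" "\<nu> - 1 \<in> {1..N - 1}" "\<nu> \<in> {1..N - 1}"
    using \<open>\<nu> \<le> N - 1\<close> by auto
  have "\<not> tail_p (\<nu> - 1) < head_m \<mu>"
    unfolding \<nu>_def by (rule not_less_Least) (use \<open>2 \<le> \<nu>\<close> in \<open>simp add: \<nu>_def\<close>)
  then have above: "head_m \<mu> < tail_p (\<nu> - 1)"
    using heights_distinct[OF range(2) \<mu>] by linarith
  have "mu_index P \<nu> \<le> \<mu>"
  proof (rule ccontr)
    assume "\<not> mu_index P \<nu> \<le> \<mu>"
    then have "head_m \<mu> \<le> head_m (mu_index P \<nu> - 1)"
      using mu_index(1)[OF range(3)] by (intro head_m_mono) auto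
    then show False using mu_index(2)[OF range(3)] \<nu> by linarith
  qed
  moreover have "\<mu> < mu_index P (\<nu> - 1)"
  proof (rule ccontr)
    assume "\<not> \<mu> < mu_index P (\<nu> - 1)"
    then have "head_m (mu_index P (\<nu> - 1)) \<le> head_m \<mu>" using \<mu> by (intro head_m_mono) auto
    then show False using mu_index(3)[OF range(2)] above by linarith
  qed
  ultimately have "mu_index P \<nu> < mu_index P (\<nu> - 1)" by linarith
  then obtain \<omega> where "is_nu P \<omega> \<nu>" using drop_is_nu[OF range(1)] by blast
  then show ?thesis using \<nu> above by (rule that)
qed

lemma rhom_value_in_strip:
  assumes "\<mu> \<in> {1..M}"
  shows "h P 0 (of_real (rhom P \<mu> 0)) \<in> Sp P \<nu> \<longleftrightarrow> tail_p \<nu> < head_m \<mu> \<and> head_m \<mu> < tail_p (\<nu> - 1)"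
proof -
  have ord: "ordered P 0" by (rule ordered_forward) simp
  have "Im (h P 0 (of_real (rhom P \<mu> 0))) = ym P \<mu>"
    by (rule gap_height_minus(2)[OF ord assms rhom(1,2)[OF ord assms]])
  then show ?thesis using assms by (simp add: Sp_def yp_eq ym_eq)
qed

end

theorem theorem6p1:
  fixes P :: slit_data and \<gamma> :: real
  assumes "standing P" and "admissible P"
    and "max_rate_minus P < min_rate_plus P"
    and "0 < \<gamma>" and "max_rate_minus P < ereal \<gamma>" and "ereal \<gamma> < min_rate_plus P"
  shows "(\<forall>\<nu>\<in>{1..Np P - 1}.
            let \<alpha> = pi * (((\<Sum>j=1..mu_index P \<nu>. bm P j) - (\<Sum>j=\<nu>+1..Np P. bp P j))
                          / bm P (mu_index P \<nu>))
            in 0 < \<alpha> \<and> \<alpha> < pi \<and> converges_to_real_by_angle (Gammap P \<gamma> \<nu>) \<alpha>)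
       \<and> (\<forall>\<mu>\<in>{1..Nm P}.
            (\<mu> \<in> {mu_index P 1..Nm P} \<longrightarrow>
               (let \<alpha> = pi * (((\<Sum>j=1..\<mu>. bm P j) - (\<Sum>j=2..Np P. bp P j)) / bp P 1)
                in 0 < \<alpha> \<and> \<alpha> < pi \<and> converges_to_real_by_angle (Gammam P \<gamma> \<mu>) \<alpha>))
          \<and> (\<mu> \<in> {mu_index P (Np P - 1)..<mu_index P 1} \<longrightarrow>
               (\<exists>\<omega> \<nu>. is_nu P \<omega> \<nu> \<and> h P 0 (of_real (rhom P \<mu> 0)) \<in> Sp P \<nu>) \<and>
               (\<forall>\<omega> \<nu>. is_nu P \<omega> \<nu> \<and> h P 0 (of_real (rhom P \<mu> 0)) \<in> Sp P \<nu> \<longrightarrow>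
                  (let \<alpha> = pi * (((\<Sum>j=1..\<mu>. bm P j) - (\<Sum>j=\<nu>+1..Np P. bp P j)) / bp P \<nu>)
                   in 0 < \<alpha> \<and> \<alpha> < pi \<and> converges_to_real_by_angle (Gammam P \<gamma> \<mu>) \<alpha>)))
          \<and> (\<mu> \<in> {1..<mu_index P (Np P - 1)} \<longrightarrow>
               (let \<alpha> = pi * ((\<Sum>j=1..\<mu>. bm P j) / bp P (Np P))
                in 0 < \<alpha> \<and> \<alpha> < pi \<and> converges_to_real_by_angle (Gammam P \<gamma> \<mu>) \<alpha>)))"
proof (intro conjI ballI impI allI)
  interpret admissible_slits P by unfold_locales (fact assms)+
  have first: "1 \<in> {1..Np P - 1}" and last: "Np P - 1 \<in> {1..Np P - 1}" using NM by auto
  {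
    fix \<nu> assume "\<nu> \<in> {1..Np P - 1}"
    then show "let \<alpha> = pi * (((\<Sum>j=1..mu_index P \<nu>. bm P j) - (\<Sum>j=\<nu>+1..Np P. bp P j))
                  / bm P (mu_index P \<nu>))
               in 0 < \<alpha> \<and> \<alpha> < pi \<and> converges_to_real_by_angle (Gammap P \<gamma> \<nu>) \<alpha>"
      using plus_orbit[OF _ mu_index assms(6)] unfolding Let_def head_m_def tail_p_def by blast
  next
    fix \<mu> assume \<mu>: "\<mu> \<in> {1..Nm P}" "\<mu> \<in> {mu_index P 1..Nm P}"
    have "tail_p 1 < head_m \<mu>"
      using mu_index(3)[OF first] head_m_mono[of "mu_index P 1" \<mu>] \<mu> by auto
    moreover have "head_m \<mu> < tail_p (1 - 1)"
      using head_m_mono[of \<mu> M] \<mu> ends totals by auto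
    ultimately show "let \<alpha> = pi * (((\<Sum>j=1..\<mu>. bm P j) - (\<Sum>j=2..Np P. bp P j)) / bp P 1)
        in 0 < \<alpha> \<and> \<alpha> < pi \<and> converges_to_real_by_angle (Gammam P \<gamma> \<mu>) \<alpha>"
      using minus_orbit[OF \<mu>(1) _ _ _ assms(4,5), of 1] NM
      unfolding Let_def head_m_def tail_p_def by (simp add: numeral_2_eq_2)
  next
    fix \<mu> assume \<mu>: "\<mu> \<in> {1..Nm P}" "\<mu> \<in> {mu_index P (Np P - 1)..<mu_index P 1}"
    show "\<exists>\<omega> \<nu>. is_nu P \<omega> \<nu> \<and> h P 0 (of_real (rhom P \<mu> 0)) \<in> Sp P \<nu>"
      using strip_of_middle_tip[OF \<mu>(2)] rhom_value_in_strip[OF \<mu>(1)] by metis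
  next
    fix \<mu> \<omega> \<nu> assume \<mu>: "\<mu> \<in> {1..Nm P}" "\<mu> \<in> {mu_index P (Np P - 1)..<mu_index P 1}"
      "is_nu P \<omega> \<nu> \<and> h P 0 (of_real (rhom P \<mu> 0)) \<in> Sp P \<nu>"
    then have "tail_p \<nu> < head_m \<mu>" "head_m \<mu> < tail_p (\<nu> - 1)" "\<nu> \<in> {1..Np P}"
      using rhom_value_in_strip[OF \<mu>(1)] is_nu_range[of \<omega> \<nu>] by auto
    then show "let \<alpha> = pi * (((\<Sum>j=1..\<mu>. bm P j) - (\<Sum>j=\<nu>+1..Np P. bp P j)) / bp P \<nu>)
        in 0 < \<alpha> \<and> \<alpha> < pi \<and> converges_to_real_by_angle (Gammam P \<gamma> \<mu>) \<alpha>"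
      using minus_orbit[OF \<mu>(1) _ _ _ assms(4,5), of \<nu>]
      unfolding Let_def head_m_def tail_p_def by blast
  next
    fix \<mu> assume \<mu>: "\<mu> \<in> {1..Nm P}" "\<mu> \<in> {1..<mu_index P (Np P - 1)}"
    have "tail_p (Np P) < head_m \<mu>"
      using head_m_less[of 0 \<mu>] \<mu> ends by auto
    moreover have "head_m \<mu> \<le> head_m (mu_index P (Np P - 1) - 1)"
      using \<mu> mu_index(1)[OF last] by (intro head_m_mono) auto
    then have "head_m \<mu> < tail_p (Np P - 1)" using mu_index(2)[OF last] by linarith
    ultimately show "let \<alpha> = pi * ((\<Sum>j=1..\<mu>. bm P j) / bp P (Np P))
        in 0 < \<alpha> \<and> \<alpha> < pi \<and> converges_to_real_by_angle (Gammam P \<gamma> \<mu>) \<alpha>"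
      using minus_orbit[OF \<mu>(1) _ _ _ assms(4,5), of "Np P"] NM ends(1)
      unfolding Let_def head_m_def[symmetric] by simp
  }
qed

end
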